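(* Let $0\le k\le n$ be integers and let $\Omega\subset\mathbb{C}^n$ be a smooth bounded domain. (a) For any $u_0,\dots,u_k\in\mathcal{P}_k^0(\Omega)$, $$F_k[u_0,\dots,u_k]\le\prod_{j=0}^k\big(I_k[u_j]\big)^{\frac1{k+1}}.$$ (b) Fix an integer $m$ with $0\le m<k$ and fix $v_1,\dots,v_m\in\mathcal{P}_k(\Omega)$. For $u\in\mathcal{P}_k^0(\Omega)$ put $$I_{k,v_1,\dots,v_m}[u]=\int_\Omega(-u)\,\tilde H_k[u,\dots,u,v_1,\dots,v_m],$$ where $u$ appears $k-m$ times in $\tilde H_k$. Then $I_{k,v_1,\dots,v_m}^{1/(k-m+1)}$ is convex on $\mathcal{P}_k^0(\Omega)$ in the sense that for any $u,v\in\mathcal{P}_k^0(\Omega)$, $$I_{k,v_1,\dots,v_m}[u+v]^{\frac1{k-m+1}}\le I_{k,v_1,\dots,v_m}[u]^{\frac1{k-m+1}}+I_{k,v_1,\dots,v_m}[v]^{\frac1{k-m+1}}.$$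
   Context: For $\lambda\in\mathbb{R}^n$, $S_k(\lambda)=\frac{k!(n-k)!}{n!}\sum_{i_1<\dots<i_k}\lambda_{i_1}\cdots\lambda_{i_k}$ is the normalized $k$-th elementary symmetric function ($S_0=1$). For a Hermitian $n\times n$ matrix $A$ with vector of eigenvalues $\lambda(A)\in\mathbb{R}^n$, $S_k(A)=S_k(\lambda(A))$. $\tilde S_k$ denotes the complete polarization of $S_k$, i.e. the symmetric $k$-linear form with $\tilde S_k(A,\dots,A)=S_k(A)$. Let $\Gamma_k=\{\lambda\in\mathbb{R}^n: S_j(\lambda)\ge 0,\ j=1,\dots,k\}$. For a real-valued $C^2$ function $u$, $\mathrm{Hess}_{\mathbb{C}}(u)=(\partial^2u/\partial z_i\partial\bar z_j)$ is the complex Hessian matrix, $H_k[u]=S_k(\mathrm{Hess}_{\mathbb{C}}(u))$, and $\tilde H_k[u_1,\dots,u_k]=\tilde S_k(\mathrm{Hess}_{\mathbb{C}}(u_1),\dots,\mathrm{Hess}_{\mathbb{C}}(u_k))$. $\mathcal{P}_k(\Omega)$ is the set of real-valued $u\in C^2(\bar\Omega)$ with $\lambda(\mathrm{Hess}_{\mathbb{C}}(u))\in\Gamma_k$ at every point, and $\mathcal{P}_k^0(\Omega)$ is the set of $u\in\mathcal{P}_k(\Omega)$ vanishing on $\partial\Omega$. For $u,u_0,\dots,u_k\in C^2(\bar\Omega)$, $$F_k[u_0,\dots,u_k]=\int_\Omega(-u_0)\,\tilde H_k[u_1,\dots,u_k],\qquad I_k[u]=F_k[u,\dots,u]=\int_\Omega(-u)H_k[u].$$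 *)

theory Defs
  imports "HOL-Analysis.Analysis" "HOL-Library.Multiset"
begin

definition dir_deriv :: "'a \<Rightarrow> ('a::real_normed_vector \<Rightarrow> 'b::real_normed_vector) \<Rightarrow> 'a \<Rightarrow> 'b" where
  "dir_deriv v f x = frechet_derivative f (at x) v"

primrec iter_dir_deriv ::
    "'a list \<Rightarrow> ('a::real_normed_vector \<Rightarrow> 'b::real_normed_vector) \<Rightarrow> 'a \<Rightarrow> 'b" where
  "iter_dir_deriv [] f = f"
| "iter_dir_deriv (v # vs) f = dir_deriv v (iter_dir_deriv vs f)"

text \<open>To be used for open \<open>S\<close> only, as \<^const>\<open>dir_deriv\<close> uses the full filter \<open>at x\<close>.\<close>

definition Ck_on :: "nat \<Rightarrow> 'a::real_normed_vector set \<Rightarrow> ('a \<Rightarrow> 'b::real_normed_vector) \<Rightarrow> bool" where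
  "Ck_on k S f \<longleftrightarrow>
     (\<forall>vs. length vs < k \<longrightarrow> iter_dir_deriv vs f differentiable_on S) \<and>
     (\<forall>vs. length vs \<le> k \<longrightarrow> continuous_on S (iter_dir_deriv vs f))"

text \<open>The class C^k on the closure of an open set \<open>S\<close>: all derivatives of order at most \<open>k\<close>
  exist in \<open>S\<close> and extend continuously to the closure. The function itself is required to be
  continuous on the closure, so that its boundary values are the given ones.\<close>

definition Ck_closure :: "nat \<Rightarrow> 'a::real_normed_vector set \<Rightarrow> ('a \<Rightarrow> 'b::real_normed_vector) \<Rightarrow> bool" where
  "Ck_closure k S f \<longleftrightarrow>
     Ck_on k S f \<and> continuous_on (closure S) f \<and>
     (\<forall>vs. length vs \<le> k \<longrightarrow>
        (\<exists>g. continuous_on (closure S) g \<and> (\<forall>x\<in>S. g x = iter_dir_deriv vs f x)))"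

text \<open>Boundary smoothness via smooth local defining functions: the nonvanishing differential makes
  the boundary a smooth hypersurface with the domain on one side.\<close>

definition smooth_bounded_domain :: "'a::euclidean_space set \<Rightarrow> bool" where
  "smooth_bounded_domain D \<longleftrightarrow>
     open D \<and> connected D \<and> D \<noteq> {} \<and> bounded D \<and>
     (\<forall>p \<in> frontier D. \<exists>U \<rho> :: 'a \<Rightarrow> real.
        open U \<and> p \<in> U \<and> (\<forall>k. Ck_on k U \<rho>) \<and>
        (\<exists>v. dir_deriv v \<rho> p \<noteq> 0) \<and>
        D \<inter> U = {x \<in> U. \<rho> x < 0})"

text \<open>The sum over increasing index tuples of length \<open>k\<close> is written as a sum over \<open>k\<close>-element
  subsets of the index type, so that no order on the index type is needed.\<close>

definition elem_sym :: "nat \<Rightarrow> real ^ 'n \<Rightarrow> real" where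
  "elem_sym k l =
     fact k * fact (CARD('n) - k) / fact (CARD('n)) *
     (\<Sum>I | I \<subseteq> (UNIV :: 'n set) \<and> card I = k. \<Prod>i\<in>I. l $ i)"

definition Gamma_cone :: "nat \<Rightarrow> (real ^ 'n) set" where
  "Gamma_cone k = {l. \<forall>j\<in>{1..k}. elem_sym j l \<ge> 0}"

definition hermitian_matrices :: "(complex ^ 'n ^ 'n) set" where
  "hermitian_matrices = {A. \<forall>i j. A $ j $ i = cnj (A $ i $ j)}"

text \<open>The eigenvalues of a Hermitian matrix, listed with multiplicity (the multiplicities being
  those of the characteristic polynomial). The order is immaterial: only symmetric functions
  of this vector are used.\<close>

definition eigenvalue_vector :: "complex ^ 'n ^ 'n \<Rightarrow> real ^ 'n" where
  "eigenvalue_vector A =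
     (SOME l. \<forall>x. det (mat x - A) = (\<Prod>i\<in>UNIV. x - complex_of_real (l $ i)))"

definition S_mat :: "nat \<Rightarrow> complex ^ 'n ^ 'n \<Rightarrow> real" where
  "S_mat k A = elem_sym k (eigenvalue_vector A)"

text \<open>The arguments of the form are passed as a list of length \<open>k\<close>; symmetry is invariance under
  permutations of that list, and linearity is over the reals.\<close>

definition symmetric_multilinear_on ::
    "'a::real_vector set \<Rightarrow> nat \<Rightarrow> ('a list \<Rightarrow> real) \<Rightarrow> bool" where
  "symmetric_multilinear_on V k T \<longleftrightarrow>
     (\<forall>xs ys. length xs = k \<and> set xs \<subseteq> V \<and> mset xs = mset ys \<longrightarrow> T xs = T ys) \<and>
     (\<forall>xs i. length xs = k \<and> set xs \<subseteq> V \<and> i < k \<longrightarrow>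
        (\<forall>a b. \<forall>x\<in>V. \<forall>y\<in>V.
           T (xs[i := a *\<^sub>R x + b *\<^sub>R y]) = a * T (xs[i := x]) + b * T (xs[i := y])))"

text \<open>The complete polarization; its values are determined on lists of \<open>k\<close> Hermitian matrices,
  and it is only used there.\<close>

definition S_polar :: "nat \<Rightarrow> (complex ^ 'n ^ 'n) list \<Rightarrow> real" where
  "S_polar k = (SOME T. symmetric_multilinear_on hermitian_matrices k T \<and>
                        (\<forall>A\<in>hermitian_matrices. T (replicate k A) = S_mat k A))"

definition d_z :: "'n \<Rightarrow> (complex ^ 'n \<Rightarrow> complex) \<Rightarrow> complex ^ 'n \<Rightarrow> complex" where
  "d_z i f x = (dir_deriv (axis i 1) f x - \<i> * dir_deriv (axis i \<i>) f x) / 2"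

definition d_zbar :: "'n \<Rightarrow> (complex ^ 'n \<Rightarrow> complex) \<Rightarrow> complex ^ 'n \<Rightarrow> complex" where
  "d_zbar i f x = (dir_deriv (axis i 1) f x + \<i> * dir_deriv (axis i \<i>) f x) / 2"

definition complex_Hessian :: "(complex ^ 'n \<Rightarrow> real) \<Rightarrow> complex ^ 'n \<Rightarrow> complex ^ 'n ^ 'n" where
  "complex_Hessian u x = (\<chi> i j. d_z i (d_zbar j (\<lambda>y. complex_of_real (u y))) x)"

definition Hess_op :: "nat \<Rightarrow> (complex ^ 'n \<Rightarrow> real) \<Rightarrow> complex ^ 'n \<Rightarrow> real" where
  "Hess_op k u x = S_mat k (complex_Hessian u x)"

definition Hess_polar :: "nat \<Rightarrow> (complex ^ 'n \<Rightarrow> real) list \<Rightarrow> complex ^ 'n \<Rightarrow> real" where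
  "Hess_polar k us x = S_polar k (map (\<lambda>u. complex_Hessian u x) us)"

definition P_class :: "nat \<Rightarrow> (complex ^ 'n) set \<Rightarrow> (complex ^ 'n \<Rightarrow> real) set" where
  "P_class k D =
     {u. Ck_closure 2 D u \<and> (\<forall>x\<in>D. eigenvalue_vector (complex_Hessian u x) \<in> Gamma_cone k)}"

definition P0_class :: "nat \<Rightarrow> (complex ^ 'n) set \<Rightarrow> (complex ^ 'n \<Rightarrow> real) set" where
  "P0_class k D = {u \<in> P_class k D. \<forall>x\<in>frontier D. u x = 0}"

definition F_functional :: "nat \<Rightarrow> (complex ^ 'n) set \<Rightarrow> (nat \<Rightarrow> complex ^ 'n \<Rightarrow> real) \<Rightarrow> real" where
  "F_functional k D u =
     (LINT x:D|lborel. - u 0 x * Hess_polar k (map u [1..<Suc k]) x)"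

definition I_functional :: "nat \<Rightarrow> (complex ^ 'n) set \<Rightarrow> (complex ^ 'n \<Rightarrow> real) \<Rightarrow> real" where
  "I_functional k D u = (LINT x:D|lborel. - u x * Hess_op k u x)"

definition I_mixed ::
    "nat \<Rightarrow> (complex ^ 'n) set \<Rightarrow> (complex ^ 'n \<Rightarrow> real) list \<Rightarrow> (complex ^ 'n \<Rightarrow> real) \<Rightarrow> real" where
  "I_mixed k D vs u =
     (LINT x:D|lborel. - u x * Hess_polar k (replicate (k - length vs) u @ vs) x)"

end

theory Submission
  imports Defs "HOL-Computational_Algebra.Fundamental_Theorem_Algebra"
begin

text \<open>The energy \<open>F(u\<^sub>0, \<dots>, u\<^sub>k)\<close> is a symmetric multilinear form on functions vanishing on the boundary:
  the mixed Hessian operator is in divergence form, so one integration by parts turns the energy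
  into the integral of the mixed discriminant of the remaining Hessians with the rank one form
  \<open>\<partial>u\<^sub>0 \<otimes> \<partial>u\<^sub>1\<close> (conjugated in the second factor). For \<open>u\<^sub>0 = u\<^sub>1\<close> and Hessians in the Garding cone the
  integrand is nonnegative by Garding's theory of hyperbolic polynomials, applied to
  \<open>S\<^sub>k\<close> as a mixed discriminant with identity matrices in the free places. Hence
  \<open>F(u, v, R)\<^sup>2 \<le> F(u, u, R) F(v, v, R)\<close>, and iterating this Cauchy--Schwarz inequality gives (a) and its
  analogue with \<open>v\<^sub>1, \<dots>, v\<^sub>m\<close> frozen; (b) then follows as Minkowski's inequality
  does, by expanding the form on \<open>u + v\<close> with the binomial formula.\<close>

text \<open>The functions are only C^2, so the classical computation is out of reach:
  differentiating the coefficients of the linearized operator would cost a third derivative. This is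
  why derivatives are moved onto test fields, and why those are mollified. Mixed discriminants are
  taken linear over the complex numbers, although only Hermitian arguments occur in the end:
  Garding's theory is derived here from non-vanishing on tubes X + iY, and signs are read off
  afterwards by comparison with the identity matrix. Cutting every polarized \<open>S_k\<close> out
  of one n-linear form means that hyperbolicity and the vanishing on rank one pairs have to be
  checked for the determinant only. Cauchy-Schwarz is available in the first two places alone, where
  it holds for all functions with zero boundary values. Other places are reached by permuting, and
  permuting past the undifferentiated place is an integration by parts. The functions v_1, ..., v_m
  may have any boundary values, so they stay at the end; the exponent k - m + 1 counts the places
  that can be permuted.\<close>

section \<open>Binomial expansion of symmetric multilinear forms\<close>

lemma pascal_sum:
  fixes h :: "nat \<Rightarrow> 'b::comm_ring_1"
  shows "(\<Sum>i\<le>Suc m. of_nat (Suc m choose i) * h i) =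
         (\<Sum>i\<le>m. of_nat (m choose i) * h (Suc i)) + (\<Sum>i\<le>m. of_nat (m choose i) * h i)"
proof -
  have "(\<Sum>i\<le>Suc m. of_nat (m choose i) * h i) = h 0 + (\<Sum>i\<le>m. of_nat (m choose Suc i) * h (Suc i))"
    by (subst sum.atMost_Suc_shift) simp
  moreover have "(\<Sum>i\<le>Suc m. of_nat (m choose i) * h i) = (\<Sum>i\<le>m. of_nat (m choose i) * h i)"
    by (simp add: binomial_eq_0)
  moreover have "(\<Sum>i\<le>Suc m. of_nat (Suc m choose i) * h i)
      = h 0 + (\<Sum>i\<le>m. of_nat (Suc m choose Suc i) * h (Suc i))"
    by (subst sum.atMost_Suc_shift) simp
  ultimately show ?thesis
    by (simp add: algebra_simps sum.distrib)
qed

text \<open>The argument \<open>w\<close> need not be a linear combination of \<open>u\<close> and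
  \<open>v\<close>; it suffices that \<open>T\<close> treats it as one. With \<open>V\<close>
  variable, the same expansion serves complex forms on all matrices, real forms on Hermitian
  matrices, and the energy on the three functions u + v, u and v.\<close>

lemma sym_form_binomial:
  fixes T :: "'a list \<Rightarrow> 'b::comm_ring_1"
  assumes sym: "\<And>xs ys. mset xs = mset ys \<Longrightarrow> set xs \<subseteq> V \<Longrightarrow> length xs = p \<Longrightarrow> T xs = T ys"
    and add: "\<And>xs. set xs \<subseteq> V \<Longrightarrow> Suc (length xs) = p \<Longrightarrow> T (w # xs) = a * T (u # xs) + b * T (v # xs)"
    and V: "w \<in> V" "u \<in> V" "v \<in> V"
    and xs: "set xs \<subseteq> V" "length xs + m = p"
  shows "T (xs @ replicate m w) =
    (\<Sum>i\<le>m. of_nat (m choose i) * (a ^ i * b ^ (m - i) * T (xs @ replicate i u @ replicate (m - i) v)))"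
  using xs
proof (induction m arbitrary: xs)
  case 0
  then show ?case by simp
next
  case (Suc m)
  let ?h = "\<lambda>i. a ^ i * b ^ (Suc m - i) * T (xs @ replicate i u @ replicate (Suc m - i) v)"
  have "T (xs @ replicate (Suc m) w) = T (w # (xs @ replicate m w))"
    by (rule sym) (use Suc.prems V in auto)
  also have "\<dots> = a * T ((u # xs) @ replicate m w) + b * T ((v # xs) @ replicate m w)"
    by (subst add) (use Suc.prems V in auto)
  also have "T ((u # xs) @ replicate m w) =
     (\<Sum>i\<le>m. of_nat (m choose i) * (a ^ i * b ^ (m - i) * T ((u # xs) @ replicate i u @ replicate (m - i) v)))"
    by (rule Suc.IH) (use Suc.prems V in auto)
  also have "\<dots> = (\<Sum>i\<le>m. of_nat (m choose i) * (a ^ i * b ^ (m - i) * T (xs @ replicate (Suc i) u @ replicate (Suc m - Suc i) v)))"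
    by (intro sum.cong refl arg_cong2[where f="(*)"] sym) (use Suc.prems V in auto)
  also have "a * \<dots> = (\<Sum>i\<le>m. of_nat (m choose i) * ?h (Suc i))"
    by (simp add: sum_distrib_left algebra_simps)
  also have "T ((v # xs) @ replicate m w) =
     (\<Sum>i\<le>m. of_nat (m choose i) * (a ^ i * b ^ (m - i) * T ((v # xs) @ replicate i u @ replicate (m - i) v)))"
    by (rule Suc.IH) (use Suc.prems V in auto)
  also have "\<dots> = (\<Sum>i\<le>m. of_nat (m choose i) * (a ^ i * b ^ (m - i) * T (xs @ replicate i u @ replicate (Suc m - i) v)))"
    by (intro sum.cong refl arg_cong2[where f="(*)"] sym) (use Suc.prems V in \<open>auto simp: Suc_diff_le\<close>)
  also have "b * \<dots> = (\<Sum>i\<le>m. of_nat (m choose i) * ?h i)"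
    by (simp add: sum_distrib_left algebra_simps Suc_diff_le)
  finally show ?case
    by (simp only: pascal_sum)
qed

subsection \<open>Mixed discriminants\<close>

type_synonym 'n cmat = "complex ^ 'n ^ 'n"

text \<open>Complex scalars must act on matrices because the forms are evaluated at X + iY;
  \<open>*\<^sub>R\<close> provides the real ones only.\<close>

definition cscale :: "complex \<Rightarrow> ('n::finite) cmat \<Rightarrow> 'n cmat" where
  "cscale c A = (\<chi> i j. c * A $ i $ j)"

lemma cscale_nth [simp]: "cscale c A $ i $ j = c * A $ i $ j"
  by (simp add: cscale_def)

lemma cscale_row: "cscale c A $ i = c *s A $ i"
  by (simp add: vec_eq_iff)

lemma cscale_cscale [simp]: "cscale c (cscale d A) = cscale (c * d) A"
  by (simp add: vec_eq_iff)

lemma cscale_1 [simp]: "cscale 1 A = A"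
  by (simp add: vec_eq_iff)

lemma cscale_0 [simp]: "cscale 0 A = 0"
  by (simp add: vec_eq_iff)

lemma cscale_zero [simp]: "cscale c 0 = 0"
  by (simp add: vec_eq_iff)

lemma cscale_add: "cscale c (A + B) = cscale c A + cscale c B"
  by (simp add: vec_eq_iff algebra_simps)

lemma cscale_add_left: "cscale (c + d) A = cscale c A + cscale d A"
  by (simp add: vec_eq_iff algebra_simps)

lemma scaleR_eq_cscale: "r *\<^sub>R A = cscale (of_real r) A"
  unfolding vec_eq_iff by (auto simp: scaleR_conv_of_real[symmetric])

text \<open>The polarization of the determinant: row i is taken from the matrix in slot \<pi> i,
  averaged over all \<pi>. Slots are indexed by the row type itself, so that permutations act on
  slots and rows alike.\<close>

definition mixed_disc :: "('n::finite \<Rightarrow> 'n cmat) \<Rightarrow> complex" where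
  "mixed_disc A = (\<Sum>\<pi> | \<pi> permutes (UNIV :: 'n::finite set). det (\<chi> i. A (\<pi> i) $ i)) / fact CARD('n)"

lemma mixed_disc_const: "mixed_disc (\<lambda>_. A) = det (A :: 'n::finite cmat)"
proof -
  have "card {\<pi>. \<pi> permutes (UNIV :: 'n set)} = fact CARD('n)"
    by (intro card_permutations) auto
  then show ?thesis
    by (simp add: mixed_disc_def)
qed

lemma mixed_disc_permute:
  assumes "\<sigma> permutes (UNIV :: 'n::finite set)"
  shows "mixed_disc (A \<circ> \<sigma>) = mixed_disc (A :: 'n \<Rightarrow> 'n cmat)"
proof -
  have "(\<Sum>\<pi> | \<pi> permutes (UNIV :: 'n set). det (\<chi> i. A (\<pi> i) $ i))
      = (\<Sum>\<pi> | \<pi> permutes (UNIV :: 'n set). det (\<chi> i. A ((\<sigma> \<circ> \<pi>) i) $ i))"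
    using setum_permutations_compose_left[OF assms, of "\<lambda>\<pi>. det (\<chi> i. A (\<pi> i) $ i)"]
    by (simp add: o_def)
  then show ?thesis
    by (simp add: mixed_disc_def)
qed

text \<open>For each permutation exactly one row, the one with index \<open>inv \<pi> s\<close>,
  comes from slot \<open>s\<close>, so linearity of the determinant in that row is enough.\<close>

lemma mixed_disc_linear:
  fixes A :: "'n::finite \<Rightarrow> 'n cmat"
  shows "mixed_disc (A(s := cscale a X + cscale b Y)) = a * mixed_disc (A(s := X)) + b * mixed_disc (A(s := Y))"
proof -
  have "det (\<chi> i. (A(s := cscale a X + cscale b Y)) (\<pi> i) $ i) =
     a * det (\<chi> i. (A(s := X)) (\<pi> i) $ i) + b * det (\<chi> i. (A(s := Y)) (\<pi> i) $ i)"
    if "\<pi> permutes (UNIV :: 'n set)" for \<pi>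
  proof -
    have *: "\<pi> i = s \<longleftrightarrow> i = inv \<pi> s" for i
      using that by (metis permutes_inverses(1) permutes_inverses(2))
    have "(\<chi> i. (A(s := Z)) (\<pi> i) $ i) = (\<chi> i. if i = inv \<pi> s then Z $ i else A (\<pi> i) $ i)" for Z
      by (auto simp: vec_eq_iff * )
    moreover have "det (\<chi> i. if i = inv \<pi> s then (cscale a X + cscale b Y) $ i else A (\<pi> i) $ i) =
       a * det (\<chi> i. if i = inv \<pi> s then X $ i else A (\<pi> i) $ i) +
       b * det (\<chi> i. if i = inv \<pi> s then Y $ i else A (\<pi> i) $ i)"
      using det_row_add[of "inv \<pi> s" "\<lambda>i. a *s X $ i" "\<lambda>i. b *s Y $ i" "\<lambda>i. A (\<pi> i) $ i"]
      by (simp only: cscale_row det_row_mul vector_add_component)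
    ultimately show ?thesis by simp
  qed
  then show ?thesis
    unfolding mixed_disc_def times_divide_eq_right add_divide_distrib[symmetric] sum_distrib_left sum.distrib[symmetric]
    by (intro arg_cong2[where f="(/)"] sum.cong refl) simp
qed

definition ctrans :: "('n::finite) cmat \<Rightarrow> 'n cmat" where
  "ctrans A = (\<chi> i j. cnj (A $ j $ i))"

text \<open>The definition mixes rows. That mixing columns gives the same number is seen by
  replacing \<sigma> by its inverse in the Leibniz sum and then reindexing \<pi> and the product by
  \<sigma>.\<close>

lemma mixed_disc_ctrans:
  fixes A :: "'n::finite \<Rightarrow> 'n cmat"
  shows "mixed_disc (\<lambda>i. ctrans (A i)) = cnj (mixed_disc A)"
proof -
  let ?P = "{\<pi>. \<pi> permutes (UNIV :: 'n set)}"
  have inv_sum: "sum f ?P = (\<Sum>\<pi>\<in>?P. f (inv \<pi>))" for f :: "('n \<Rightarrow> 'n) \<Rightarrow> complex"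
    by (rule sum_permutations_inverse)
  have "(\<Sum>\<pi>\<in>?P. det (\<chi> i. ctrans (A (\<pi> i)) $ i))
      = (\<Sum>\<pi>\<in>?P. \<Sum>\<sigma>\<in>?P. of_int (sign \<sigma>) * (\<Prod>i\<in>UNIV. cnj (A (\<pi> i) $ \<sigma> i $ i)))"
    by (simp add: det_def ctrans_def)
  also have "\<dots> = (\<Sum>\<sigma>\<in>?P. \<Sum>\<pi>\<in>?P. of_int (sign \<sigma>) * (\<Prod>i\<in>UNIV. cnj (A (\<pi> i) $ \<sigma> i $ i)))"
    by (rule sum.swap)
  also have "\<dots> = (\<Sum>\<sigma>\<in>?P. \<Sum>\<pi>\<in>?P. of_int (sign (inv \<sigma>)) * (\<Prod>i\<in>UNIV. cnj (A (\<pi> i) $ inv \<sigma> i $ i)))"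
    by (rule inv_sum)
  also have "\<dots> = (\<Sum>\<sigma>\<in>?P. \<Sum>\<pi>\<in>?P. of_int (sign \<sigma>) * (\<Prod>i\<in>UNIV. cnj (A (\<pi> i) $ i $ \<sigma> i)))"
  proof (rule sum.cong[OF refl])
    fix \<sigma> assume "\<sigma> \<in> ?P"
    then have \<sigma>: "\<sigma> permutes UNIV" by simp
    have "(\<Sum>\<pi>\<in>?P. of_int (sign (inv \<sigma>)) * (\<Prod>i\<in>UNIV. cnj (A (\<pi> i) $ inv \<sigma> i $ i)))
        = (\<Sum>\<pi>\<in>?P. of_int (sign \<sigma>) * (\<Prod>i\<in>UNIV. cnj (A ((\<pi> \<circ> inv \<sigma>) i) $ inv \<sigma> i $ i)))"
      by (subst sum_permutations_compose_right[OF permutes_inv[OF \<sigma>]]) (simp add: sign_inverse permutes_imp_permutation[OF finite \<sigma>])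
    also have "\<dots> = (\<Sum>\<pi>\<in>?P. of_int (sign \<sigma>) * (\<Prod>i\<in>UNIV. cnj (A (\<pi> i) $ i $ \<sigma> i)))"
      by (subst prod.permute[OF \<sigma>]) (simp add: permutes_inverses[OF \<sigma>])
    finally show "(\<Sum>\<pi>\<in>?P. of_int (sign (inv \<sigma>)) * (\<Prod>i\<in>UNIV. cnj (A (\<pi> i) $ inv \<sigma> i $ i)))
      = (\<Sum>\<pi>\<in>?P. of_int (sign \<sigma>) * (\<Prod>i\<in>UNIV. cnj (A (\<pi> i) $ i $ \<sigma> i)))" .
  qed
  also have "\<dots> = (\<Sum>\<pi>\<in>?P. \<Sum>\<sigma>\<in>?P. of_int (sign \<sigma>) * (\<Prod>i\<in>UNIV. cnj (A (\<pi> i) $ i $ \<sigma> i)))"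
    by (rule sum.swap)
  also have "\<dots> = cnj (\<Sum>\<pi>\<in>?P. det (\<chi> i. A (\<pi> i) $ i))"
    by (simp add: det_def)
  finally show ?thesis
    by (simp add: mixed_disc_def)
qed

definition outer :: "complex ^ 'n::finite \<Rightarrow> complex ^ 'n \<Rightarrow> 'n cmat" where
  "outer x p = (\<chi> i j. x $ i * p $ j)"

text \<open>Exchanging the slots \<open>s\<close> and \<open>t\<close> changes nothing, by symmetry.
  Yet for every permutation the two rows involved are multiples of p and q before, and the same
  multiples of q and p after, so the determinant changes sign. This is the algebraic reason why the
  cofactors of the form are divergence free.\<close>

lemma mixed_disc_outer_eq_0:
  fixes A :: "'n::finite \<Rightarrow> 'n cmat"
  assumes st: "s \<noteq> t" and A: "A s = outer x p" "A t = outer x q"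
  shows "mixed_disc A = 0"
proof -
  let ?\<tau> = "Transposition.transpose s t"
  have "det (\<chi> i. (A \<circ> ?\<tau>) (\<pi> i) $ i) = - det (\<chi> i. A (\<pi> i) $ i)" if \<pi>: "\<pi> permutes (UNIV :: 'n set)" for \<pi>
  proof -
    define i0 where "i0 = inv \<pi> s"
    define i1 where "i1 = inv \<pi> t"
    have ne: "i0 \<noteq> i1" using st unfolding i0_def i1_def by (metis \<pi> permutes_inverses(1))
    have \<pi>s: "\<pi> i = s \<longleftrightarrow> i = i0" "\<pi> i = t \<longleftrightarrow> i = i1" for i
      unfolding i0_def i1_def using \<pi> by (metis permutes_inverses(1) permutes_inverses(2))+
    define B where "B = (\<lambda>p q. (\<chi> i. if i = i0 then p else if i = i1 then q else A (\<pi> i) $ i) :: 'n cmat)"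
    define c where "c = (\<lambda>i. if i = i0 \<or> i = i1 then x $ i else 1)"
    have "(\<chi> i. A (\<pi> i) $ i) = (\<chi> i. c i *s B p q $ i)"
      using ne st
      apply (auto simp: vec_eq_iff c_def B_def)
      subgoal using \<pi>s[of i0] A by (simp add: outer_def)
      subgoal using \<pi>s[of i1] A by (simp add: outer_def)
      done
    moreover have "(\<chi> i. (A \<circ> ?\<tau>) (\<pi> i) $ i) = (\<chi> i. c i *s B q p $ i)"
      using ne st
      apply (auto simp: vec_eq_iff c_def B_def)
      subgoal using \<pi>s[of i0] A by (simp add: outer_def)
      subgoal using \<pi>s[of i1] A by (simp add: outer_def)
      subgoal for i j using \<pi>s[of i] by (simp add: transpose_apply_other)
      done
    moreover have "det (B q p) = - det (B p q)"
    proof -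
      have perm: "Transposition.transpose i0 i1 permutes UNIV"
        by (rule permutes_swap_id) auto
      have "B q p = (\<chi> i. B p q $ Transposition.transpose i0 i1 i)"
        using ne by (auto simp: vec_eq_iff B_def Transposition.transpose_def)
      then show ?thesis
        using det_permute_rows[OF perm, of "B p q"] ne by (simp add: sign_swap_id)
    qed
    ultimately show ?thesis
      by (simp add: det_rows_mul vec_nth_inverse)
  qed
  then have "mixed_disc (A \<circ> ?\<tau>) = - mixed_disc A"
    by (simp add: mixed_disc_def sum_negf)
  moreover have "mixed_disc (A \<circ> ?\<tau>) = mixed_disc A"
    by (rule mixed_disc_permute) (auto intro: permutes_swap_id)
  ultimately show ?thesis by simp
qed

section \<open>Forms on lists of matrices\<close>

text \<open>An arbitrary enumeration of the index type, used to pass from slots to list positions;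
  symmetry makes the choice immaterial.\<close>

definition pos :: "'n::finite \<Rightarrow> nat" where
  "pos = (SOME f. bij_betw f UNIV {..<CARD('n)})"

lemma bij_betw_pos: "bij_betw (pos :: 'n \<Rightarrow> nat) UNIV {..<CARD('n::finite)}"
proof -
  have "\<exists>f :: 'n \<Rightarrow> nat. bij_betw f UNIV {..<CARD('n)}"
    using ex_bij_betw_finite_nat[of "UNIV :: 'n set"] by (simp add: lessThan_atLeast0)
  then show ?thesis
    unfolding pos_def by (rule someI_ex)
qed

definition polar_det :: "('n::finite) cmat list \<Rightarrow> complex" where
  "polar_det xs = mixed_disc (\<lambda>i. xs ! pos i)"

text \<open>Linearity is asked for at the head only; symmetry carries it to the other
  places.\<close>

definition cform :: "nat \<Rightarrow> (('n::finite) cmat list \<Rightarrow> complex) \<Rightarrow> bool" where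
  "cform m M \<longleftrightarrow>
     (\<forall>xs ys. length xs = m \<longrightarrow> mset xs = mset ys \<longrightarrow> M xs = M ys) \<and>
     (\<forall>a b X Y xs. Suc (length xs) = m \<longrightarrow>
        M ((cscale a X + cscale b Y) # xs) = a * M (X # xs) + b * M (Y # xs))"

lemma cform_sym: "cform m M \<Longrightarrow> mset xs = mset ys \<Longrightarrow> length xs = m \<Longrightarrow> M xs = M ys"
  by (auto simp: cform_def)

lemma cform_linear:
  "cform m M \<Longrightarrow> Suc (length xs) = m \<Longrightarrow>
    M ((cscale a X + cscale b Y) # xs) = a * M (X # xs) + b * M (Y # xs)"
  by (auto simp: cform_def)

lemma cform_append:
  assumes "cform n M" "n = m + length cs"
  shows "cform m (\<lambda>xs. M (xs @ cs))"
  unfolding cform_def using assms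
  by (auto intro!: cform_sym[OF assms(1)] cform_linear[OF assms(1)])

lemma cform_polar_det: "cform CARD('n) (polar_det :: ('n::finite) cmat list \<Rightarrow> complex)"
  unfolding cform_def
proof (intro conjI allI impI)
  fix xs ys :: "'n cmat list"
  assume len: "length xs = CARD('n)" and eq: "mset xs = mset ys"
  then have len': "length ys = CARD('n)" by (metis size_mset)
  obtain p where p: "p permutes {..<length ys}" "permute_list p ys = xs"
    using mset_eq_permutation[OF eq] by blast
  let ?ipos = "inv_into UNIV (pos :: 'n \<Rightarrow> nat)"
  \<comment> \<open>The permutation of list positions, transported to the index type by
    \<open>pos\<close>.\<close>
  define \<sigma> where "\<sigma> = ?ipos \<circ> p \<circ> (pos :: 'n \<Rightarrow> nat)"
  have p': "bij_betw p {..<CARD('n)} {..<CARD('n)}"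
    using p len' by (simp add: permutes_imp_bij)
  have "bij_betw \<sigma> UNIV UNIV"
    unfolding \<sigma>_def
    by (rule bij_betw_trans[OF bij_betw_pos bij_betw_trans[OF p' bij_betw_inv_into[OF bij_betw_pos]], unfolded comp_assoc[symmetric]])
  then have \<sigma>: "\<sigma> permutes UNIV"
    by (rule bij_imp_permutes) simp
  have posim: "pos (i::'n) < CARD('n)" for i
    using bij_betw_pos by (auto simp: bij_betw_def)
  have "xs ! pos i = ys ! pos (\<sigma> i)" for i
  proof -
    have "p (pos i) < CARD('n)" using posim p' by (auto simp: bij_betw_def)
    then have "pos (\<sigma> i) = p (pos i)"
      unfolding \<sigma>_def by (simp add: bij_betw_inv_into_right[OF bij_betw_pos])
    then show ?thesis
      using permute_list_nth[OF p(1), of "pos i"] p(2) posim[of i] len' by simp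
  qed
  then show "polar_det xs = polar_det ys"
    using mixed_disc_permute[OF \<sigma>, of "\<lambda>i. ys ! pos i"] by (simp add: polar_det_def o_def)
next
  fix a b and X Y :: "'n cmat" and xs :: "'n cmat list"
  assume len: "Suc (length xs) = CARD('n)"
  define s where "s = inv_into UNIV (pos :: 'n \<Rightarrow> nat) 0"
  have s: "pos i = 0 \<longleftrightarrow> i = s" for i
  proof -
    have "pos s = (0::nat)"
      unfolding s_def by (rule bij_betw_inv_into_right[OF bij_betw_pos]) simp
    then show ?thesis
      using bij_betw_imp_inj_on[OF bij_betw_pos[where 'n='n]] by (metis injD)
  qed
  have "(\<lambda>i. (Z # xs) ! pos i) = (\<lambda>i. (X # xs) ! pos i)(s := Z)" for Z
    using s by (auto simp: fun_eq_iff nth_Cons' )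
  then show "polar_det ((cscale a X + cscale b Y) # xs) = a * polar_det (X # xs) + b * polar_det (Y # xs)"
    unfolding polar_det_def by (metis mixed_disc_linear)
qed

lemma polar_det_replicate: "polar_det (replicate CARD('n) A) = det (A :: ('n::finite) cmat)"
proof -
  have "pos (i::'n) < CARD('n)" for i
    using bij_betw_pos by (auto simp: bij_betw_def)
  then show ?thesis
    by (simp add: polar_det_def mixed_disc_const)
qed

lemma polar_det_ctrans:
  assumes "length xs = CARD('n)"
  shows "polar_det (map ctrans xs) = cnj (polar_det (xs :: ('n::finite) cmat list))"
proof -
  have "pos (i::'n) < CARD('n)" for i
    using bij_betw_pos by (auto simp: bij_betw_def)
  then show ?thesis
    using assms mixed_disc_ctrans[of "\<lambda>i. xs ! pos i"] by (simp add: polar_det_def)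
qed

lemma polar_det_outer_eq_0:
  assumes "length xs + 2 = CARD('n)"
  shows "polar_det (outer x p # outer x q # (xs :: ('n::finite) cmat list)) = 0"
proof -
  have "0 \<in> range (pos :: 'n \<Rightarrow> nat)" "1 \<in> range (pos :: 'n \<Rightarrow> nat)"
    using bij_betw_imp_surj_on[OF bij_betw_pos[where 'n='n]] assms by auto
  then obtain s t :: 'n where st: "pos s = 0" "pos t = 1"
    by (metis imageE)
  then have "s \<noteq> t" by auto
  with st show ?thesis
    unfolding polar_det_def by (intro mixed_disc_outer_eq_0[of s t]) auto
qed

lemma cform_binomial:
  assumes "cform p M" "length xs + m = p"
  shows "M (xs @ replicate m (cscale a X + cscale b Y)) =
    (\<Sum>i\<le>m. of_nat (m choose i) * (a ^ i * b ^ (m - i) * M (xs @ replicate i X @ replicate (m - i) Y)))"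
  by (rule sym_form_binomial[where V=UNIV and p=p])
     (use assms in \<open>auto intro: cform_sym[OF assms(1)] cform_linear[OF assms(1)]\<close>)

lemma cform_scale:
  assumes "cform p M" "length xs + m = p"
  shows "M (xs @ replicate m (cscale a X)) = a ^ m * M (xs @ replicate m X)"
proof -
  \<comment> \<open>Scaling is the case b = 0 of the binomial expansion: only the term i = m
    survives, with 0 ^ 0 = 1.\<close>
  have "M (xs @ replicate m (cscale a X)) = M (xs @ replicate m (cscale a X + cscale 0 X))"
    by simp
  also have "\<dots> = (\<Sum>i\<le>m. of_nat (m choose i) * (a ^ i * 0 ^ (m - i) * M (xs @ replicate i X @ replicate (m - i) X)))"
    by (rule cform_binomial[OF assms])
  also have "\<dots> = (\<Sum>i\<in>{m}. of_nat (m choose i) * (a ^ i * 0 ^ (m - i) * M (xs @ replicate i X @ replicate (m - i) X)))"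
    by (rule sum.mono_neutral_right) (auto simp: power_0_left)
  finally show ?thesis by simp
qed

lemma cform_head_scale:
  assumes "cform p M" "Suc (length xs) = p"
  shows "M (cscale a X # xs) = a * M (X # xs)"
  using cform_linear[OF assms, of a X 0 X] by simp

lemma cform_head_add:
  assumes "cform p M" "Suc (length xs) = p"
  shows "M ((X + Y) # xs) = M (X # xs) + M (Y # xs)"
  using cform_linear[OF assms, of 1 X 1 Y] by simp

lemma cform_head_sum:
  assumes "cform p M" "Suc (length xs) = p"
  shows "M ((\<Sum>i\<in>S. f i) # xs) = (\<Sum>i\<in>S. M (f i # xs))"
proof (induction S rule: infinite_finite_induct)
  case (insert i S)
  then show ?case by (simp add: cform_head_add[OF assms])
next
  case empty
  show ?case using cform_head_scale[OF assms, of 0 0] by simp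
next
  case (infinite S)
  then show ?case using cform_head_scale[OF assms, of 0 0] by simp
qed

definition unit_cmat :: "'n::finite \<Rightarrow> 'n \<Rightarrow> 'n cmat" where
  "unit_cmat i j = outer (axis i 1) (axis j 1)"

text \<open>The numbers \<open>M (unit_cmat i j # xs)\<close> are the cofactors of the form, its
  partial derivatives in the entries of the head. Integration by parts works with these.\<close>

lemma cform_head_expand:
  fixes X :: "('n::finite) cmat"
  assumes "cform p M" "Suc (length xs) = p"
  shows "M (X # xs) = (\<Sum>i\<in>UNIV. \<Sum>j\<in>UNIV. X $ i $ j * M (unit_cmat i j # xs))"
proof -
  have "X = (\<Sum>i\<in>UNIV. \<Sum>j\<in>UNIV. cscale (X $ i $ j) (unit_cmat i j))"
  proof -
    have "(\<Sum>i\<in>UNIV. \<Sum>j\<in>UNIV. X $ i $ j * (axis i 1 $ a * axis j 1 $ b)) = X $ a $ b" for a b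
    proof -
      have "(\<Sum>j\<in>UNIV. X $ i $ j * (axis i 1 $ a * axis j 1 $ b)) = (if a = i then X $ i $ b else 0)" for i
      proof -
        have "X $ i $ j * (axis i 1 $ a * axis j 1 $ b) = (if b = j then if a = i then X $ i $ j else 0 else 0)" for j
          by (simp add: axis_def)
        then show ?thesis by simp
      qed
      then show ?thesis by simp
    qed
    then show ?thesis
      by (simp add: vec_eq_iff unit_cmat_def outer_def)
  qed
  then have "M (X # xs) = M ((\<Sum>i\<in>UNIV. \<Sum>j\<in>UNIV. cscale (X $ i $ j) (unit_cmat i j)) # xs)"
    by simp
  also have "\<dots> = (\<Sum>i\<in>UNIV. \<Sum>j\<in>UNIV. X $ i $ j * M (unit_cmat i j # xs))"
    by (simp only: cform_head_sum[OF assms] cform_head_scale[OF assms])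
  finally show ?thesis .
qed

lemma continuous_on_mixed_disc:
  fixes A :: "'n::finite \<Rightarrow> 'a::topological_space \<Rightarrow> 'n cmat"
  assumes "\<And>s i j. continuous_on S (\<lambda>x. A s x $ i $ j)"
  shows "continuous_on S (\<lambda>x. mixed_disc (\<lambda>s. A s x))"
  unfolding mixed_disc_def det_def by (simp, intro continuous_intros assms) auto

lemma continuous_on_polar_det:
  fixes F :: "('a::topological_space \<Rightarrow> ('n::finite) cmat) list"
  assumes "\<And>f i j. f \<in> set F \<Longrightarrow> continuous_on S (\<lambda>x. f x $ i $ j)" "length F = CARD('n)"
  shows "continuous_on S (\<lambda>x. polar_det (map (\<lambda>f. f x) F))"
proof -
  have pos: "pos (i::'n) < length F" for i
    using bij_betw_pos assms(2) by (auto simp: bij_betw_def)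
  have "continuous_on S (\<lambda>x. mixed_disc (\<lambda>s. (F ! pos s) x))"
    by (intro continuous_on_mixed_disc assms) (use pos in auto)
  then show ?thesis
    unfolding polar_det_def by (simp add: pos)
qed

section \<open>Hermitian matrices and their quadratic forms\<close>

lemma ctrans_eq_iff_hermitian: "A \<in> hermitian_matrices \<longleftrightarrow> ctrans A = A"
  unfolding hermitian_matrices_def ctrans_def vec_eq_iff by (simp, safe) metis+

lemma hermitian_nth:
  assumes "A \<in> hermitian_matrices"
  shows "cnj (A $ i $ j) = A $ j $ i"
proof -
  have "A $ j $ i = cnj (A $ i $ j)"
    using assms unfolding hermitian_matrices_def by blast
  then show ?thesis by (rule sym)
qed

lemma hermitianI: "(\<And>i j. cnj (A $ i $ j) = A $ j $ i) \<Longrightarrow> A \<in> hermitian_matrices"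
  unfolding hermitian_matrices_def by fastforce

lemma hermitian_add: "A \<in> hermitian_matrices \<Longrightarrow> B \<in> hermitian_matrices \<Longrightarrow> A + B \<in> hermitian_matrices"
  by (rule hermitianI) (simp add: hermitian_nth)

lemma hermitian_scale: "A \<in> hermitian_matrices \<Longrightarrow> cscale (of_real r) A \<in> hermitian_matrices"
  by (rule hermitianI) (simp add: hermitian_nth)

lemma hermitian_scaleR: "A \<in> hermitian_matrices \<Longrightarrow> r *\<^sub>R A \<in> hermitian_matrices"
  by (simp add: scaleR_eq_cscale hermitian_scale)

lemma hermitian_mat_1 [simp]: "mat 1 \<in> hermitian_matrices"
  by (rule hermitianI) (simp add: mat_def)

lemma hermitian_0 [simp]: "0 \<in> hermitian_matrices"
  by (rule hermitianI) simp

definition quad :: "('n::finite) cmat \<Rightarrow> complex ^ 'n \<Rightarrow> complex" where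
  "quad A v = (\<Sum>i\<in>UNIV. cnj (v $ i) * (A *v v) $ i)"

lemma quad_add: "quad (A + B) v = quad A v + quad B v"
  by (simp add: quad_def matrix_vector_mult_add_rdistrib algebra_simps sum.distrib)

lemma cscale_mult_vec: "cscale c A *v v = c *s (A *v v)"
  by (simp add: vec_eq_iff matrix_vector_mult_def sum_distrib_left mult_ac)

lemma quad_cscale: "quad (cscale c A) v = c * quad A v"
  by (simp add: quad_def cscale_mult_vec sum_distrib_left mult_ac)

lemma quad_hermitian_real:
  assumes "A \<in> hermitian_matrices"
  shows "quad A v \<in> \<real>"
proof -
  have h: "cnj (A $ i $ j) = A $ j $ i" for i j
    using assms by (rule hermitian_nth)
  have "cnj (quad A v) = (\<Sum>i\<in>UNIV. \<Sum>j\<in>UNIV. v $ i * (A $ j $ i * cnj (v $ j)))"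
    by (simp add: quad_def matrix_vector_mult_def sum_distrib_left h)
  also have "\<dots> = (\<Sum>j\<in>UNIV. \<Sum>i\<in>UNIV. v $ i * (A $ j $ i * cnj (v $ j)))"
    by (rule sum.swap)
  also have "\<dots> = quad A v"
    by (simp add: quad_def matrix_vector_mult_def sum_distrib_left mult_ac)
  finally show ?thesis
    by (simp add: Reals_cnj_iff)
qed

lemma quad_mat_1: "quad (mat 1) v = of_real ((norm v)\<^sup>2)"
proof -
  have "quad (mat 1) v = (\<Sum>i\<in>UNIV. of_real ((cmod (v $ i))\<^sup>2))"
    unfolding quad_def by (intro sum.cong refl) (simp add: complex_norm_square mult.commute del: of_real_power)
  then show ?thesis
    by (simp add: norm_vec_def L2_set_def sum_nonneg)
qed

lemma quad_outer_nonneg: "0 \<le> Re (quad (outer x (\<chi> i. cnj (x $ i))) v)"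
proof -
  have "quad (outer x (\<chi> i. cnj (x $ i))) v = (\<Sum>i\<in>UNIV. cnj (v $ i) * x $ i) * (\<Sum>j\<in>UNIV. cnj (x $ j) * v $ j)"
    by (simp add: quad_def outer_def matrix_vector_mult_def sum_product sum_distrib_left mult_ac)
  also have "(\<Sum>j\<in>UNIV. cnj (x $ j) * v $ j) = cnj (\<Sum>i\<in>UNIV. cnj (v $ i) * x $ i)"
    by (simp add: mult_ac)
  finally show ?thesis
    by (metis Re_complex_of_real complex_norm_square zero_le_power2)
qed

lemma det_nonzero_of_quad:
  assumes "\<And>v. v \<noteq> 0 \<Longrightarrow> quad A v \<noteq> 0"
  shows "det (A :: ('n::finite) cmat) \<noteq> 0"
proof -
  have "v = 0" if "A *v v = 0" for v
    using assms[of v] that by (force simp: quad_def)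
  then show ?thesis
    by (metis invertible_det_nz invertible_left_inverse matrix_left_invertible_ker)
qed

text \<open>The quadratic form of A is real, so that of A + z I has imaginary part Im z times the
  squared norm and no kernel vector exists. This is the hyperbolicity of the determinant in the
  direction of the identity.\<close>

lemma det_hermitian_shift_nonzero:
  assumes "A \<in> hermitian_matrices" "Im z \<noteq> 0"
  shows "det (A + cscale z (mat 1)) \<noteq> 0"
proof (rule det_nonzero_of_quad)
  fix v :: "complex ^ 'a"
  assume "v \<noteq> 0"
  then have "Im (quad (A + cscale z (mat 1)) v) \<noteq> 0"
    using quad_hermitian_real[OF assms(1), of v] assms(2)
    by (simp add: quad_add quad_cscale quad_mat_1 complex_is_Real_iff)
  then show "quad (A + cscale z (mat 1)) v \<noteq> 0" by auto
qed

subsection \<open>Eigenvalues\<close>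

text \<open>Multilinear expansion turns the coefficients of the characteristic polynomial into mixed
  discriminants of copies of A and of the identity; comparison with the product over the eigenvalues
  then yields the elementary symmetric functions.\<close>

lemma det_char_expand:
  fixes A :: "('n::finite) cmat"
  shows "det (mat x - A) = (\<Sum>i\<le>CARD('n).
    (of_nat (CARD('n) choose i) * (-1) ^ (CARD('n) - i) *
      polar_det (replicate (CARD('n) - i) A @ replicate i (mat 1))) * x ^ i)"
proof -
  have e: "mat x - A = cscale x (mat 1) + cscale (-1) A"
    by (simp add: vec_eq_iff mat_def)
  have "det (mat x - A) = polar_det ([] @ replicate CARD('n) (cscale x (mat 1) + cscale (-1) A))"
    by (simp add: polar_det_replicate e)
  also have "\<dots> = (\<Sum>i\<le>CARD('n). of_nat (CARD('n) choose i) * (x ^ i * (-1) ^ (CARD('n) - i) *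
      polar_det ([] @ replicate i (mat 1) @ replicate (CARD('n) - i) A)))"
    by (rule cform_binomial[OF cform_polar_det]) simp
  also have "\<dots> = (\<Sum>i\<le>CARD('n).
    (of_nat (CARD('n) choose i) * (-1) ^ (CARD('n) - i) *
      polar_det (replicate (CARD('n) - i) A @ replicate i (mat 1))) * x ^ i)"
  proof (intro sum.cong refl)
    fix i assume "i \<in> {..CARD('n)}"
    then have "polar_det ([] @ replicate i (mat 1) @ replicate (CARD('n) - i) A) =
        polar_det (replicate (CARD('n) - i) A @ replicate i (mat 1))"
      by (intro cform_sym[OF cform_polar_det]) auto
    then show "of_nat (CARD('n) choose i) * (x ^ i * (-1) ^ (CARD('n) - i) *
      polar_det ([] @ replicate i (mat 1) @ replicate (CARD('n) - i) A)) =
      (of_nat (CARD('n) choose i) * (-1) ^ (CARD('n) - i) *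
      polar_det (replicate (CARD('n) - i) A @ replicate i (mat 1))) * x ^ i"
      by simp
  qed
  finally show ?thesis .
qed

text \<open>\<open>eigenvalue_vector\<close> is a choice, so existence has to be supplied: the
  characteristic polynomial is monic of degree n and splits, and a non-real root would contradict
  \<open>det_hermitian_shift_nonzero\<close>.\<close>

lemma hermitian_real_eigenvalues:
  fixes A :: "('n::finite) cmat"
  assumes A: "A \<in> hermitian_matrices"
  shows "\<exists>l :: real ^ 'n. \<forall>x. det (mat x - A) = (\<Prod>i\<in>UNIV. x - complex_of_real (l $ i))"
proof -
  define c where "c = (\<lambda>i. of_nat (CARD('n) choose i) * (-1) ^ (CARD('n) - i) *
      polar_det (replicate (CARD('n) - i) A @ replicate i (mat 1)))"
  define p where "p = (\<Sum>i\<le>CARD('n). monom (c i) i)"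
  have det: "det (mat x - A) = poly p x" for x
    by (simp add: det_char_expand p_def poly_sum poly_monom c_def)
  have coeff: "coeff p i = (if i \<le> CARD('n) then c i else 0)" for i
    by (simp add: p_def coeff_sum)
  have "c CARD('n) = 1"
    using polar_det_replicate[of "mat 1 :: 'n cmat"] by (simp add: c_def)
  then have "coeff p CARD('n) = 1"
    by (simp add: coeff)
  then have deg: "degree p = CARD('n)"
    by (intro antisym degree_le le_degree) (auto simp: coeff)
  then have lead: "lead_coeff p = 1"
    using \<open>coeff p CARD('n) = 1\<close> by simp
  obtain r where r: "smult (lead_coeff p) (\<Prod>i<degree p. [:- r i, 1:]) = p"
    using complex_poly_decompose' by blast
  have pr: "poly p x = (\<Prod>i<CARD('n). x - r i)" for x
    using arg_cong[OF r, of "\<lambda>q. poly q x"] by (simp add: poly_prod deg del: lead_coeff_pCons) (use \<open>coeff p CARD('n) = 1\<close> in simp)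
  have real: "Im (r i) = 0" if "i < CARD('n)" for i
  proof (rule ccontr)
    assume im: "Im (r i) \<noteq> 0"
    have "det (mat (r i) - A) = 0"
      using that by (auto simp: det pr)
    moreover have "mat (r i) - A = cscale (-1) A + cscale (r i) (mat 1)"
      by (simp add: vec_eq_iff mat_def)
    ultimately show False
      using det_hermitian_shift_nonzero[OF hermitian_scale[OF A, of "-1"], of "r i"] im by simp
  qed
  define l :: "real ^ 'n" where "l = (\<chi> i. Re (r (pos i)))"
  have "(\<Prod>i\<in>UNIV. x - complex_of_real (l $ i)) = (\<Prod>i<CARD('n). x - r i)" for x
  proof (rule prod.reindex_bij_betw[OF bij_betw_pos, of "\<lambda>i. x - r i", symmetric, THEN trans, symmetric])
    show "(\<Prod>i\<in>UNIV. x - r (pos (i::'n))) = (\<Prod>i\<in>UNIV. x - complex_of_real (l $ i))"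
    proof (intro prod.cong refl)
      fix i :: 'n
      have "pos i < CARD('n)" using bij_betw_pos by (auto simp: bij_betw_def)
      then show "x - r (pos i) = x - complex_of_real (l $ i)"
        using real by (simp add: l_def complex_eq_iff)
    qed
  qed
  then show ?thesis
    using det pr by metis
qed

lemma prod_diff_expand:
  fixes l :: "'n::finite \<Rightarrow> complex"
  shows "(\<Prod>i\<in>UNIV. x - l i) =
    (\<Sum>j\<le>CARD('n). ((-1) ^ (CARD('n) - j) * (\<Sum>I | card I = CARD('n) - j. \<Prod>i\<in>I. l i)) * x ^ j)"
proof -
  have "(\<Prod>i\<in>UNIV. x - l i) = (\<Prod>i\<in>UNIV. - l i + x)" by simp
  also have "\<dots> = (\<Sum>I\<in>Pow UNIV. (\<Prod>i\<in>I. - l i) * (\<Prod>i\<in>UNIV - I. x))"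
    by (rule prod_add) simp
  also have "\<dots> = (\<Sum>I\<in>UNIV. (-1) ^ card I * (\<Prod>i\<in>I. l i) * x ^ (CARD('n) - card I))"
    by (intro sum.cong) (auto simp: prod_uminus card_Diff_subset)
  also have "\<dots> = (\<Sum>j\<le>CARD('n). \<Sum>I | I \<in> UNIV \<and> CARD('n) - card I = j. (-1) ^ card I * (\<Prod>i\<in>I. l i) * x ^ (CARD('n) - card I))"
    by (rule sum.group[symmetric]) auto
  also have "\<dots> = (\<Sum>j\<le>CARD('n). ((-1) ^ (CARD('n) - j) * (\<Sum>I | card I = CARD('n) - j. \<Prod>i\<in>I. l i)) * x ^ j)"
  proof (intro sum.cong refl)
    fix j assume j: "j \<in> {..CARD('n)}"
    have "CARD('n) - card I = j \<longleftrightarrow> card I = CARD('n) - j" for I :: "'n set"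
      using j card_mono[of UNIV I] by auto
    then have "(\<Sum>I | I \<in> UNIV \<and> CARD('n) - card I = j. (-1) ^ card I * (\<Prod>i\<in>I. l i) * x ^ (CARD('n) - card I))
        = (\<Sum>I | card I = CARD('n) - j. ((-1) ^ (CARD('n) - j) * (\<Prod>i\<in>I. l i)) * x ^ j)"
      using j by (intro sum.cong) auto
    then show "(\<Sum>I | I \<in> UNIV \<and> CARD('n) - card I = j. (-1) ^ card I * (\<Prod>i\<in>I. l i) * x ^ (CARD('n) - card I))
      = ((-1) ^ (CARD('n) - j) * (\<Sum>I | card I = CARD('n) - j. \<Prod>i\<in>I. l i)) * x ^ j"
      by (simp add: sum_distrib_left sum_distrib_right)
  qed
  finally show ?thesis .
qed

section \<open>The polarization of \<open>S_k\<close> as a padded mixed discriminant\<close>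

definition polar_S :: "('n::finite) cmat list \<Rightarrow> complex" where
  "polar_S xs = polar_det (xs @ replicate (CARD('n) - length xs) (mat 1))"

text \<open>Coefficients of x^(n-k) are compared in the two expansions of the characteristic
  polynomial. The binomial coefficient left over is exactly the normalization in
  \<open>elem_sym\<close>.\<close>

lemma polar_S_replicate:
  fixes A :: "('n::finite) cmat"
  assumes A: "A \<in> hermitian_matrices" and k: "k \<le> CARD('n)"
  shows "polar_S (replicate k A) = of_real (S_mat k A)"
proof -
  let ?n = "CARD('n)"
  define l where "l = eigenvalue_vector A"
  have l: "det (mat x - A) = (\<Prod>i\<in>UNIV. x - complex_of_real (l $ i))" for x
    using someI_ex[OF hermitian_real_eigenvalues[OF A]] unfolding l_def eigenvalue_vector_def by blast
  have "\<forall>x. (\<Sum>i\<le>?n. (of_nat (?n choose i) * (-1) ^ (?n - i) *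
      polar_det (replicate (?n - i) A @ replicate i (mat 1))) * x ^ i) =
    (\<Sum>j\<le>?n. ((-1) ^ (?n - j) * (\<Sum>I | card I = ?n - j. \<Prod>i\<in>I. complex_of_real (l $ i))) * x ^ j)"
    using l unfolding det_char_expand prod_diff_expand by simp
  then have "\<forall>i\<le>?n. of_nat (?n choose i) * (-1) ^ (?n - i) *
      polar_det (replicate (?n - i) A @ replicate i (mat 1)) =
    (-1) ^ (?n - i) * (\<Sum>I | card I = ?n - i. \<Prod>i\<in>I. complex_of_real (l $ i))"
    by (rule polyfun_eq_coeffs[THEN iffD1])
  then have "of_nat (?n choose (?n - k)) * (-1) ^ (?n - (?n - k)) *
      polar_det (replicate (?n - (?n - k)) A @ replicate (?n - k) (mat 1)) =
     (-1) ^ (?n - (?n - k)) * (\<Sum>I | card I = ?n - (?n - k). \<Prod>i\<in>I. complex_of_real (l $ i))"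
    by (elim allE[of _ "?n - k"]) simp
  then have "of_nat (?n choose k) * polar_S (replicate k A) = (\<Sum>I | card I = k. \<Prod>i\<in>I. complex_of_real (l $ i))"
    using k by (simp add: polar_S_def binomial_symmetric[symmetric] mult.assoc)
  also have "\<dots> = of_real (\<Sum>I | I \<subseteq> UNIV \<and> card I = k. \<Prod>i\<in>I. l $ i)"
    by simp
  finally show ?thesis
    using k by (simp add: S_mat_def elem_sym_def l_def[symmetric] binomial_fact field_simps)
qed

lemma cform_polar_S:
  assumes "k \<le> CARD('n::finite)"
  shows "cform k (\<lambda>xs :: 'n cmat list. polar_det (xs @ replicate (CARD('n) - k) (mat 1)))"
  by (rule cform_append[OF cform_polar_det]) (use assms in simp)

lemma polar_det_hermitian_real:
  assumes "length xs = CARD('n)" "set xs \<subseteq> hermitian_matrices"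
  shows "polar_det (xs :: ('n::finite) cmat list) \<in> \<real>"
proof -
  have "map ctrans xs = xs"
    using assms(2) by (intro map_idI) (auto simp: ctrans_eq_iff_hermitian)
  then show ?thesis
    using polar_det_ctrans[OF assms(1)] by (simp add: Reals_cnj_iff)
qed

text \<open>A symmetric multilinear form is determined by its diagonal: expanding the form on
  \<open>A + t B\<close> in powers of \<open>t\<close>, the linear coefficient frees one argument at a time.\<close>

lemma symmetric_multilinear_eq_0:
  fixes T :: "'a::real_vector list \<Rightarrow> real"
  assumes V: "\<And>x y a. x \<in> V \<Longrightarrow> y \<in> V \<Longrightarrow> x + y \<in> V" "\<And>a x. x \<in> V \<Longrightarrow> a *\<^sub>R x \<in> V"
    and sym: "\<And>xs ys. mset xs = mset ys \<Longrightarrow> set xs \<subseteq> V \<Longrightarrow> length xs = k \<Longrightarrow> T xs = T ys"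
    and lin: "\<And>xs x y a b. set xs \<subseteq> V \<Longrightarrow> x \<in> V \<Longrightarrow> y \<in> V \<Longrightarrow> Suc (length xs) = k \<Longrightarrow>
       T ((a *\<^sub>R x + b *\<^sub>R y) # xs) = a * T (x # xs) + b * T (y # xs)"
    and diag: "\<And>x. x \<in> V \<Longrightarrow> T (replicate k x) = 0"
    and xs: "set xs \<subseteq> V" "length xs + m = k" "x \<in> V"
  shows "T (xs @ replicate m x) = 0"
  using xs
proof (induction xs arbitrary: m x)
  case Nil
  then show ?case using diag by simp
next
  case (Cons y xs)
  have "(\<Sum>i\<le>Suc m. (of_nat (Suc m choose i) * T (xs @ replicate i y @ replicate (Suc m - i) x)) * t ^ i) = 0" for t
  proof -
    have "T (xs @ replicate (Suc m) (t *\<^sub>R y + 1 *\<^sub>R x)) =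
      (\<Sum>i\<le>Suc m. of_nat (Suc m choose i) * (t ^ i * 1 ^ (Suc m - i) * T (xs @ replicate i y @ replicate (Suc m - i) x)))"
    proof (rule sym_form_binomial[where V=V and p=k])
      show "t *\<^sub>R y + 1 *\<^sub>R x \<in> V" by (intro V) (use Cons.prems in auto)
    qed (use Cons.prems in \<open>auto intro: sym lin[of _ y x t 1, unfolded mult_1] simp del: scaleR_one\<close>)
    moreover have "T (xs @ replicate (Suc m) (t *\<^sub>R y + 1 *\<^sub>R x)) = 0"
      by (rule Cons.IH) (use Cons.prems V in auto)
    ultimately show ?thesis by (simp add: mult_ac)
  qed
  then have "of_nat (Suc m choose 1) * T (xs @ replicate 1 y @ replicate (Suc m - 1) x) = 0"
    using polyfun_eq_0[of "\<lambda>i. of_nat (Suc m choose i) * T (xs @ replicate i y @ replicate (Suc m - i) x)" "Suc m"] by auto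
  then have "T (xs @ replicate 1 y @ replicate (Suc m - 1) x) = 0"
    by simp
  moreover have "T ((y # xs) @ replicate m x) = T (xs @ replicate 1 y @ replicate (Suc m - 1) x)"
    by (rule sym) (use Cons.prems in auto)
  ultimately show ?case by simp
qed

text \<open>\<open>S_polar\<close> is a choice as well. The real part of the padded mixed
  discriminant shows that a polarization exists, and any two polarizations agree on Hermitian lists
  because their difference vanishes on the diagonal.\<close>

lemma S_polar_eq:
  fixes xs :: "('n::finite) cmat list"
  assumes k: "k \<le> CARD('n)" and xs: "set xs \<subseteq> hermitian_matrices" "length xs = k"
  shows "S_polar k xs = Re (polar_S xs)"
proof -
  let ?M = "\<lambda>xs :: 'n cmat list. polar_det (xs @ replicate (CARD('n) - k) (mat 1))"
  let ?H = "hermitian_matrices :: 'n cmat set"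
  let ?P = "\<lambda>T. symmetric_multilinear_on ?H k T \<and> (\<forall>A\<in>?H. T (replicate k A) = S_mat k A)"
  note form = cform_polar_S[OF k]
  have "?P (\<lambda>xs. Re (?M xs))"
    unfolding symmetric_multilinear_on_def
  proof (intro conjI allI impI ballI)
    fix xs ys :: "'n cmat list" assume "length xs = k \<and> set xs \<subseteq> ?H \<and> mset xs = mset ys"
    then show "Re (?M xs) = Re (?M ys)"
      using cform_sym[OF form] by metis
  next
    fix xs :: "'n cmat list" and i a b x y
    assume xi: "length xs = k \<and> set xs \<subseteq> ?H \<and> i < k"
    \<comment> \<open>Symmetry brings position \<open>i\<close> to the head, where the form is known
      to be linear.\<close>
    define zs where "zs = take i xs @ drop (Suc i) xs"
    have len: "Suc (length zs) = k" using xi by (simp add: zs_def)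
    have "?M (xs[i := z]) = ?M (z # zs)" for z
      by (rule cform_sym[OF form]) (use xi in \<open>auto simp: upd_conv_take_nth_drop zs_def\<close>)
    then show "Re (?M (xs[i := a *\<^sub>R x + b *\<^sub>R y])) = a * Re (?M (xs[i := x])) + b * Re (?M (xs[i := y]))"
      using cform_linear[OF form len, of "of_real a" x "of_real b" y] by (simp add: scaleR_eq_cscale)
  next
    fix A assume "A \<in> ?H"
    then show "Re (?M (replicate k A)) = S_mat k A"
      using polar_S_replicate[of A k] k by (simp add: polar_S_def)
  qed
  then have P: "?P (S_polar k)"
    unfolding S_polar_def by (rule someI[where P="?P"])
  have lin: "S_polar k ((a *\<^sub>R x + b *\<^sub>R y) # zs) = a * S_polar k (x # zs) + b * S_polar k (y # zs)"
    if "set zs \<subseteq> ?H" "x \<in> ?H" "y \<in> ?H" "Suc (length zs) = k" for a b x y zs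
  proof -
    have "length (x # zs) = k \<and> set (x # zs) \<subseteq> ?H \<and> 0 < k" using that by auto
    then have "S_polar k ((x # zs)[0 := a *\<^sub>R x + b *\<^sub>R y]) = a * S_polar k ((x # zs)[0 := x]) + b * S_polar k ((x # zs)[0 := y])"
      using P that unfolding symmetric_multilinear_on_def by blast
    then show ?thesis by simp
  qed
  \<comment> \<open>The empty block \<open>replicate 0\<close> matches the shape of
    \<open>symmetric_multilinear_eq_0\<close>, whose xs is here the whole list.\<close>
  have "S_polar k (xs @ replicate 0 (mat 1)) - Re (?M (xs @ replicate 0 (mat 1))) = 0"
  proof (rule symmetric_multilinear_eq_0[where V="?H" and k=k and T="\<lambda>xs. S_polar k xs - Re (?M xs)"])
    fix xs ys :: "'n cmat list" assume "mset xs = mset ys" "set xs \<subseteq> ?H" "length xs = k"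
    then show "S_polar k xs - Re (?M xs) = S_polar k ys - Re (?M ys)"
      using cform_sym[OF form, of xs ys] P unfolding symmetric_multilinear_on_def by metis
  next
    fix zs x y a b assume *: "set zs \<subseteq> ?H" "x \<in> ?H" "y \<in> ?H" "Suc (length zs) = k"
    show "S_polar k ((a *\<^sub>R x + b *\<^sub>R y) # zs) - Re (?M ((a *\<^sub>R x + b *\<^sub>R y) # zs)) =
      a * (S_polar k (x # zs) - Re (?M (x # zs))) + b * (S_polar k (y # zs) - Re (?M (y # zs)))"
      using lin[OF *] cform_linear[OF form *(4), of "of_real a" x "of_real b" y]
      by (simp add: scaleR_eq_cscale algebra_simps)
  next
    fix x assume "x \<in> ?H"
    then show "S_polar k (replicate k x) - Re (?M (replicate k x)) = 0"
      using polar_S_replicate[of x k] k P by (simp add: polar_S_def)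
  qed (use xs in \<open>auto intro: hermitian_add hermitian_scaleR\<close>)
  then show ?thesis
    by (simp add: polar_S_def xs)
qed

lemma polar_S_nonneg_of_Gamma:
  fixes A :: "('n::finite) cmat"
  assumes "A \<in> hermitian_matrices" "eigenvalue_vector A \<in> Gamma_cone k" "j \<le> k" "k \<le> CARD('n)"
  shows "0 \<le> Re (polar_S (replicate j A))"
proof (cases "j = 0")
  case True
  have "polar_S ([] :: 'n cmat list) = 1"
    using polar_det_replicate[of "mat 1 :: 'n cmat"] by (simp add: polar_S_def)
  then show ?thesis using True by simp
next
  case False
  then show ?thesis
    using assms polar_S_replicate[of A j] by (auto simp: Gamma_cone_def S_mat_def)
qed

section \<open>Continuity of complex scaling, and roots of complex polynomials\<close>

lemma norm_cscale: "norm (cscale c A) = cmod c * norm A"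
proof -
  have row: "norm (cscale c A $ i) = cmod c * norm (A $ i)" for i
    by (simp add: norm_vec_def norm_mult L2_set_right_distrib)
  show ?thesis
    unfolding norm_vec_def[of "cscale c A"] norm_vec_def[of A] row by (simp add: L2_set_right_distrib)
qed

lemma continuous_on_cscale [continuous_intros]:
  "continuous_on S f \<Longrightarrow> continuous_on S g \<Longrightarrow> continuous_on S (\<lambda>x. cscale (f x) (g x))"
  unfolding cscale_def by (intro continuous_intros)

lemma poly_root_distance:
  assumes "degree p \<le> m" "\<And>z. poly p z = 0 \<Longrightarrow> r \<le> cmod (s - z)" "0 \<le> r" "coeff p m \<noteq> 0"
  shows "cmod (coeff p m) * r ^ m \<le> cmod (poly p s)"
proof -
  have deg: "degree p = m" using assms by (simp add: antisym le_degree)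
  obtain root where root: "smult (lead_coeff p) (\<Prod>i<degree p. [:- root i, 1:]) = p"
    using complex_poly_decompose' by blast
  have eval: "poly p z = lead_coeff p * (\<Prod>i<m. z - root i)" for z
    using arg_cong[OF root, of "\<lambda>q. poly q z"] by (simp add: poly_prod deg)
  have "r ^ m = (\<Prod>i<m. r)" by simp
  also have "\<dots> \<le> (\<Prod>i<m. cmod (s - root i))"
    by (intro prod_mono conjI assms) (auto simp: eval)
  finally show ?thesis
    by (simp add: eval deg norm_mult prod_norm mult_left_mono)
qed

text \<open>Takes the place of Rouche's theorem: if the value at s is small compared with the
  leading coefficient, the factorization into roots forces one of them to lie near s.\<close>

lemma poly_root_near:
  assumes "degree p \<le> m" "0 \<le> r" "cmod (poly p s) < cmod (coeff p m) * r ^ m"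
  obtains z where "poly p z = 0" "cmod (s - z) < r"
proof -
  have "coeff p m \<noteq> 0"
    using assms(3) by (metis mult_zero_left norm_ge_zero norm_zero not_less)
  then show ?thesis
    using poly_root_distance[of p m r s] assms that by (meson not_le)
qed

text \<open>Gauss--Lucas at the origin: the logarithmic derivative of a polynomial with all roots in the
  open lower half-plane has negative imaginary part at \<open>0\<close>.\<close>

lemma coeff_1_nonzero_of_roots_Im_neg:
  assumes "0 < degree p" "\<And>z. poly p z = 0 \<Longrightarrow> Im z < 0"
  shows "coeff p 1 \<noteq> 0"
proof -
  obtain root where root: "smult (lead_coeff p) (\<Prod>i<degree p. [:- root i, 1:]) = p"
    using complex_poly_decompose' by blast
  have eval: "poly p z = lead_coeff p * (\<Prod>i<degree p. z - root i)" for z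
    using arg_cong[OF root, of "\<lambda>q. poly q z"] by (simp add: poly_prod)
  have Im_root: "Im (root i) < 0" if "i < degree p" for i
  proof -
    have "(\<Prod>j<degree p. root i - root j) = 0"
      using that by (intro prod_zero) auto
    then have "poly p (root i) = 0"
      unfolding eval by (metis mult_zero_right)
    then show ?thesis by (rule assms)
  qed
  have im: "Im (1 / z) > 0" if "Im z < 0" for z
  proof -
    have "0 < (Re z)\<^sup>2 + (Im z)\<^sup>2"
      using that by (simp add: add_nonneg_pos)
    then show ?thesis
      using that by (simp add: Im_divide divide_neg_pos)
  qed
  define q where "q = (\<lambda>I. \<Prod>i\<in>I. [:- root i, 1:])"
  \<comment> \<open>The quotient of the first two coefficients is minus the sum of the reciprocals
    of the roots, and each reciprocal has positive imaginary part.\<close>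
  have *: "coeff (q I) 0 \<noteq> 0 \<and> Im (coeff (q I) 1 / coeff (q I) 0) < 0"
    if "finite I" "I \<noteq> {}" "\<forall>i\<in>I. Im (root i) < 0" for I :: "nat set"
    using that
  proof (induction I rule: finite_ne_induct)
    case (singleton i)
    then have "root i \<noteq> 0" by auto
    then show ?case
      using singleton im[of "root i"] by (simp add: q_def)
  next
    case (insert i I)
    have i: "Im (root i) < 0" "root i \<noteq> 0" using insert.prems by auto
    have IH: "coeff (q I) 0 \<noteq> 0" "Im (coeff (q I) 1 / coeff (q I) 0) < 0"
      using insert by auto
    have "q (insert i I) = [:- root i, 1:] * q I"
      using insert by (simp add: q_def)
    then have c: "coeff (q (insert i I)) 0 = - root i * coeff (q I) 0"
      "coeff (q (insert i I)) 1 = coeff (q I) 0 - root i * coeff (q I) 1"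
      by (auto simp: coeff_pCons)
    have "(coeff (q I) 0 - root i * coeff (q I) 1) / (- root i * coeff (q I) 0) = coeff (q I) 1 / coeff (q I) 0 - 1 / root i"
      using i IH by (simp add: field_simps)
    then show ?case
      unfolding c using i IH im[of "root i"] by simp
  qed
  have "coeff (q {..<degree p}) 1 \<noteq> 0"
    using *[of "{..<degree p}"] assms(1) Im_root by fastforce
  moreover have "coeff p 1 = lead_coeff p * coeff (q {..<degree p}) 1"
    using arg_cong[OF root, of "\<lambda>q. coeff q 1"] by (simp add: q_def)
  ultimately show ?thesis
    using assms(1) by auto
qed

section \<open>Garding's theory for hyperbolic symmetric forms\<close>

text \<open>\<open>hyp\<close> speaks of shifts on the positive imaginary axis only: real shifts are
  absorbed by \<open>X\<close>, and the lower half-plane follows by homogeneity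
  (\<open>hyp_Im\<close>).\<close>

locale hyperbolic_form =
  fixes M :: "('n::finite) cmat list \<Rightarrow> complex" and m :: nat
  assumes form: "cform m M"
    and cont: "continuous_on UNIV (\<lambda>Z. M (replicate m Z))"
    and hyp: "\<And>X d. X \<in> hermitian_matrices \<Longrightarrow> 0 < d \<Longrightarrow>
      M (replicate m (X + cscale (\<i> * of_real d) (mat 1))) \<noteq> 0"
begin

abbreviation P :: "'n cmat \<Rightarrow> complex" where
  "P Z \<equiv> M (replicate m Z)"

text \<open>Garding's open cone. By hyperbolicity the roots t of P(b + t I) are all real; membership
  says that none of them is nonnegative. Describing the cone by rays avoids speaking of the
  connected component of the identity.\<close>

definition cone :: "'n cmat set" where
  "cone = {b \<in> hermitian_matrices. \<forall>t\<ge>0. P (b + cscale (of_real t) (mat 1)) \<noteq> 0}"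

lemma P_scale: "P (cscale c Z) = c ^ m * P Z"
  using cform_scale[OF form, of "[]" m c Z] by simp

lemma continuous_on_P [continuous_intros]: "continuous_on S f \<Longrightarrow> continuous_on S (\<lambda>x. P (f x))"
  using continuous_on_compose2[OF cont] by auto

lemma line_poly:
  assumes "length bs + j = m"
  shows "\<exists>p. (\<forall>s. poly p s = M (bs @ replicate j (Z + cscale s b))) \<and>
    (\<forall>i. coeff p i = (if i \<le> j then of_nat (j choose i) * M (bs @ replicate i b @ replicate (j - i) Z) else 0))"
proof (intro exI conjI allI)
  let ?c = "\<lambda>i. of_nat (j choose i) * M (bs @ replicate i b @ replicate (j - i) Z)"
  let ?p = "\<Sum>i\<le>j. monom (?c i) i"
  show "coeff ?p i = (if i \<le> j then ?c i else 0)" for i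
    by (simp add: coeff_sum)
  show "poly ?p s = M (bs @ replicate j (Z + cscale s b))" for s
  proof -
    have "M (bs @ replicate j (cscale s b + cscale 1 Z)) =
      (\<Sum>i\<le>j. of_nat (j choose i) * (s ^ i * 1 ^ (j - i) * M (bs @ replicate i b @ replicate (j - i) Z)))"
      by (rule cform_binomial[OF form assms])
    then show ?thesis
      by (simp add: poly_sum poly_monom mult_ac add.commute)
  qed
qed

lemma line_poly_degree:
  "\<exists>p. (\<forall>s. poly p s = P (Z + cscale s b)) \<and> degree p \<le> m \<and> coeff p m = P b"
proof -
  have "length [] + m = m" by simp
  from line_poly[OF this] obtain p where p: "\<forall>s. poly p s = M ([] @ replicate m (Z + cscale s b))"
    "\<forall>i. coeff p i = (if i \<le> m then of_nat (m choose i) * M ([] @ replicate i b @ replicate (m - i) Z) else 0)"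
    by blast
  have "degree p \<le> m"
    by (rule degree_le) (simp add: p(2))
  then show ?thesis
    by (intro exI[of _ p]) (simp add: p)
qed

lemma hyp_Im:
  assumes "X \<in> hermitian_matrices" "Im z \<noteq> 0"
  shows "P (X + cscale z (mat 1)) \<noteq> 0"
proof -
  have pos: "P (Y + cscale w (mat 1)) \<noteq> 0" if "Y \<in> hermitian_matrices" "Im w > 0" for Y w
  proof -
    have "Y + cscale w (mat 1) = (Y + cscale (of_real (Re w)) (mat 1)) + cscale (\<i> * of_real (Im w)) (mat 1)"
      by (subst complex_eq[of w]) (simp only: cscale_add_left add.assoc)
    then show ?thesis
      using hyp[of "Y + cscale (of_real (Re w)) (mat 1)" "Im w"] that
      by (simp add: hermitian_add hermitian_scale add.assoc)
  qed
  show ?thesis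
  proof (cases "Im z > 0")
    case False
    have "X + cscale z (mat 1) = cscale (-1) (cscale (of_real (-1)) X + cscale (- z) (mat 1))"
      by (simp add: vec_eq_iff)
    then show ?thesis
      using pos[of "cscale (of_real (-1)) X" "-z"] hermitian_scale[OF assms(1), of "-1"] False assms(2)
      by (simp only: P_scale) simp
  qed (use pos assms in auto)
qed

lemma P_cone_nonzero: "b \<in> cone \<Longrightarrow> P b \<noteq> 0"
  unfolding cone_def by (auto dest!: spec[of _ 0])

lemma cone_hermitian: "b \<in> cone \<Longrightarrow> b \<in> hermitian_matrices"
  by (simp add: cone_def)

text \<open>Non-vanishing for all imaginary parts \<open>Y\<close> plus a positive multiple of the
  identity. The positive shift makes \<open>Y = 0\<close> a legitimate start, where the condition is
  \<open>hyp\<close>; elements of the cone are then added one at a time.\<close>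

definition tube :: "'n cmat \<Rightarrow> bool" where
  "tube Y \<longleftrightarrow> (\<forall>X\<in>hermitian_matrices. \<forall>d>0. P (X + cscale \<i> (Y + cscale (of_real d) (mat 1))) \<noteq> 0)"

text \<open>Dividing by s leaves b + (i d / s) I. A non-real shift is excluded by hyperbolicity; a
  real one is nonnegative because Im s >= 0, and then membership of \<open>b\<close> in the cone
  applies.\<close>

lemma P_initial_nonzero:
  assumes b: "b \<in> cone" and d: "0 < d" and s: "0 \<le> Im s"
  shows "P (cscale (\<i> * of_real d) (mat 1) + cscale s b) \<noteq> 0"
proof (cases "s = 0")
  case True
  then show ?thesis using hyp[of 0 d] d by simp
next
  case False
  define w where "w = \<i> * of_real d / s"
  have "cscale (\<i> * of_real d) (mat 1) + cscale s b = cscale s (b + cscale w (mat 1))"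
    using False by (simp add: vec_eq_iff w_def field_simps)
  moreover have "P (b + cscale w (mat 1)) \<noteq> 0"
  proof (cases "Im w = 0")
    case True
    have "Im (w * cnj s * s) = Im (\<i> * of_real d * cnj s)" "Re (w * cnj s * s) = Re (\<i> * of_real d * cnj s)"
      using \<open>s \<noteq> 0\<close> by (simp_all add: w_def)
    then have "Re w * (cmod s)\<^sup>2 = d * Im s"
      using True by (simp add: mult.assoc[of w] mult.commute[of "cnj s"] complex_norm_square[symmetric])
    then have "0 \<le> Re w"
      using d s \<open>s \<noteq> 0\<close> by (metis less_eq_real_def mult_nonneg_nonneg not_le mult_neg_pos zero_less_norm_iff zero_less_power)
    moreover have "w = of_real (Re w)"
      using True by (simp add: complex_eq_iff)
    ultimately show ?thesis
      using b unfolding cone_def by (metis (mono_tags, lifting) mem_Collect_eq)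
  next
    case False
    then show ?thesis using hyp_Im b by (simp add: cone_hermitian)
  qed
  ultimately show ?thesis
    using False by (simp add: P_scale)
qed

text \<open>The number of roots in the upper half-plane of \<open>s \<mapsto> P (\<mu> X + \<i> (\<mu> Y + d) + s b)\<close> cannot
  change as \<open>\<mu>\<close> moves from \<open>0\<close> to \<open>1\<close>, since no root crosses the real line.\<close>

lemma tube_step:
  assumes Y: "tube Y" "Y \<in> hermitian_matrices" and b: "b \<in> cone" and X: "X \<in> hermitian_matrices"
    and d: "0 < d" and s: "0 \<le> Im s"
  shows "P (X + cscale \<i> (Y + cscale (of_real d) (mat 1)) + cscale s b) \<noteq> 0"
proof -
  define C where "C = (\<lambda>\<mu>::real. cscale (of_real \<mu>) X + cscale \<i> (cscale (of_real \<mu>) Y + cscale (of_real d) (mat 1)))"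
  define f where "f = (\<lambda>\<mu> s. P (C \<mu> + cscale s b))"
  have contC: "continuous_on S C" for S
    unfolding C_def by (intro continuous_intros)
  have contf: "continuous_on S (\<lambda>z. f (g z) (h z))" if "continuous_on S g" "continuous_on S h"
    for S :: "'c::topological_space set" and g h
    unfolding f_def using that by (intro continuous_intros continuous_on_compose2[OF contC[of UNIV]]) auto
  have real: "f \<mu> s \<noteq> 0" if "0 \<le> \<mu>" "Im s = 0" for \<mu> s
  proof (cases "\<mu> = 0")
    case True
    have "s = of_real (Re s)" using that by (simp add: complex_eq_iff)
    then have "cscale s b \<in> hermitian_matrices"
      using b by (metis cone_hermitian hermitian_scale)
    then show ?thesis
      using hyp[of "cscale s b" d] d True by (simp add: f_def C_def add.commute)
  next
    case False
    then have \<mu>: "\<mu> > 0" using that by simp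
    \<comment> \<open>Dividing by \<mu> puts the real multiple of \<open>b\<close> into the
      Hermitian part and replaces d by d / \<mu>, which \<open>tube Y\<close> permits.\<close>
    have "C \<mu> + cscale s b = cscale (of_real \<mu>)
       ((X + cscale (of_real (Re s / \<mu>)) b) + cscale \<i> (Y + cscale (of_real (d / \<mu>)) (mat 1)))"
      using \<mu> that by (simp add: C_def vec_eq_iff field_simps complex_eq_iff)
    moreover have "P ((X + cscale (of_real (Re s / \<mu>)) b) + cscale \<i> (Y + cscale (of_real (d / \<mu>)) (mat 1))) \<noteq> 0"
      using Y X b \<mu> d by (simp add: tube_def hermitian_add hermitian_scale cone_hermitian del: of_real_divide)
    ultimately show ?thesis
      using \<mu> by (simp add: f_def P_scale)
  qed
  \<comment> \<open>Only the existence of a root in the upper half-plane is tracked, not the number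
    of roots: the parameters that have one form a clopen subset of the unit interval, and 0 is not
    among them.\<close>
  define K where "K = {(\<mu>, s). \<mu> \<in> {0..1} \<and> 0 \<le> Im s \<and> f \<mu> s = 0}"
  define S where "S = fst ` K"
  \<comment> \<open>For large s, dividing by s leaves a small perturbation of \<open>b\<close>, and
    \<open>P\<close> does not vanish near \<open>b\<close>.\<close>
  have "bounded K"
  proof -
    have "isCont P b"
      using cont by (simp add: continuous_on_eq_continuous_at)
    then obtain r where r: "r > 0" "\<And>Z. dist Z b < r \<Longrightarrow> P Z \<noteq> 0"
      using continuous_at_avoid[of b P 0] P_cone_nonzero[OF b] by (auto simp: dist_commute)
    have "bounded (C ` {0..1})"
      by (intro compact_imp_bounded compact_continuous_image contC) auto
    then obtain B where B: "\<And>\<mu>. \<mu> \<in> {0..1} \<Longrightarrow> norm (C \<mu>) \<le> B"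
      unfolding bounded_iff by blast
    have "cmod s \<le> B / r" if "(\<mu>, s) \<in> K" for \<mu> s
    proof (rule ccontr)
      assume "\<not> cmod s \<le> B / r"
      then have big: "B < r * cmod s" using r by (simp add: field_simps)
      have \<mu>: "\<mu> \<in> {0..1}" "f \<mu> s = 0" using that by (auto simp: K_def)
      have "0 \<le> B" using B[OF \<mu>(1)] norm_ge_zero order_trans by blast
      then have s0: "s \<noteq> 0" using big r by auto
      have "C \<mu> + cscale s b = cscale s (b + cscale (1 / s) (C \<mu>))"
        using s0 by (simp add: vec_eq_iff field_simps)
      then have "P (b + cscale (1 / s) (C \<mu>)) = 0"
        using \<mu>(2) s0 by (simp add: f_def P_scale)
      moreover have "dist (b + cscale (1 / s) (C \<mu>)) b < r"
        using B[OF \<mu>(1)] big s0 by (simp add: dist_norm norm_cscale norm_divide field_simps)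
      ultimately show False using r by blast
    qed
    then have "K \<subseteq> {0..1} \<times> cball 0 (B / r)"
      by (auto simp: K_def)
    then show ?thesis
      by (rule bounded_subset[rotated]) (intro bounded_Times bounded_cball bounded_closed_interval)
  qed
  moreover have "closed K"
  proof -
    have "K = ({0..1} \<times> UNIV) \<inter> {z. 0 \<le> Im (snd z)} \<inter> {z. f (fst z) (snd z) = 0}"
      by (auto simp: K_def)
    moreover have "closed ({0..1} \<times> UNIV :: (real \<times> complex) set)"
      by (intro closed_Times closed_UNIV closed_atLeastAtMost)
    moreover have "closed {z::real \<times> complex. 0 \<le> Im (snd z)}"
      by (intro closed_Collect_le continuous_intros)
    moreover have "closed {z. f (fst z) (snd z) = 0}"
      by (intro closed_Collect_eq contf continuous_intros)
    ultimately show ?thesis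
      by (simp only: closed_Int)
  qed
  ultimately have "compact K" by (simp add: compact_eq_bounded_closed)
  then have "compact S"
    unfolding S_def by (intro compact_continuous_image continuous_intros)
  have sub: "S \<subseteq> {0..1}" by (auto simp: S_def K_def)
  have closed: "closedin (top_of_set {0..1}) S"
    using sub \<open>compact S\<close> by (simp add: closed_subset compact_imp_closed)
  have open_S: "\<exists>e>0. \<forall>\<mu>\<in>{0..1}. dist \<mu> \<mu>0 < e \<longrightarrow> \<mu> \<in> S" if \<mu>0: "\<mu>0 \<in> S" for \<mu>0
  proof -
    obtain s0 where s0: "\<mu>0 \<in> {0..1}" "0 \<le> Im s0" "f \<mu>0 s0 = 0"
      using \<mu>0 unfolding S_def K_def by force
    then have im: "Im s0 > 0" using real[of \<mu>0 s0] by (auto simp: less_le)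
    have "isCont (\<lambda>\<mu>. f \<mu> s0) \<mu>0"
      using contf[of UNIV "\<lambda>x. x" "\<lambda>_. s0"] by (simp add: continuous_on_eq_continuous_at)
    \<comment> \<open>The radius Im s0 keeps the root found nearby in the closed upper half-plane.
      The leading coefficient \<open>P b\<close> does not depend on \<mu>.\<close>
    moreover have "cmod (P b) * Im s0 ^ m > 0"
      using P_cone_nonzero[OF b] im by simp
    ultimately obtain e where e: "e > 0" "\<And>\<mu>. dist \<mu> \<mu>0 < e \<Longrightarrow> dist (f \<mu> s0) (f \<mu>0 s0) < cmod (P b) * Im s0 ^ m"
      unfolding continuous_at_eps_delta by (metis dist_norm)
    have near: "\<mu> \<in> S" if \<mu>: "\<mu> \<in> {0..1}" "dist \<mu> \<mu>0 < e" for \<mu>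
    proof -
      obtain p where p: "\<forall>s. poly p s = P (C \<mu> + cscale s b)" and deg: "degree p \<le> m" and pm: "coeff p m = P b"
        using line_poly_degree[of "C \<mu>" b] by blast
      have "poly p s0 = f \<mu> s0"
        by (simp only: p f_def)
      then have lt: "cmod (poly p s0) < cmod (coeff p m) * Im s0 ^ m"
        using e(2)[OF \<mu>(2)] s0(3) by (simp only: pm dist_0_norm dist_commute[of _ 0])
      obtain z where z: "poly p z = 0" "cmod (s0 - z) < Im s0"
        by (rule poly_root_near[OF deg less_imp_le[OF im] lt])
      have "Im z \<ge> 0"
        using z(2) abs_Im_le_cmod[of "s0 - z"] by simp
      then have "(\<mu>, z) \<in> K"
        using \<mu>(1) z(1) p by (simp add: K_def f_def)
      then show ?thesis by (force simp: S_def)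
    qed
    show ?thesis
      by (intro exI[of _ e] conjI ballI impI e(1)) (rule near)
  qed
  have "openin (top_of_set {0..1}) S"
    unfolding openin_euclidean_subtopology_iff by (intro conjI ballI sub open_S)
  have "S = {} \<or> S = {0..1}"
  proof -
    have "connected {0..1::real}" by (rule connected_Icc)
    then show ?thesis
      using closed \<open>openin (top_of_set {0..1}) S\<close> unfolding connected_clopen by blast
  qed
  moreover have "0 \<notin> S"
    using P_initial_nonzero[OF b d] by (auto simp: S_def K_def f_def C_def)
  ultimately have "S = {}" by auto
  then have "f 1 s \<noteq> 0"
    using s by (force simp: S_def K_def)
  then show ?thesis by (simp add: f_def C_def)
qed

lemma tube_add:
  assumes Y: "tube Y" "Y \<in> hermitian_matrices" and b: "b \<in> cone"
  shows "tube (Y + b)"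
  unfolding tube_def
proof (intro ballI allI impI)
  fix X :: "'n cmat" and d :: real
  assume "X \<in> hermitian_matrices" "0 < d"
  then have "P (X + cscale \<i> (Y + cscale (of_real d) (mat 1)) + cscale \<i> b) \<noteq> 0"
    by (intro tube_step assms) auto
  then show "P (X + cscale \<i> (Y + b + cscale (of_real d) (mat 1))) \<noteq> 0"
    by (simp add: cscale_add algebra_simps)
qed

lemma tube_0: "tube 0"
  using hyp by (simp add: tube_def)

lemma cone_scale:
  assumes b: "b \<in> cone" and r: "0 < r"
  shows "cscale (of_real r) b \<in> cone"
  unfolding cone_def
proof (intro CollectI conjI allI impI)
  fix t :: real assume t: "0 \<le> t"
  have "cscale (of_real r) b + cscale (of_real t) (mat 1) = cscale (of_real r) (b + cscale (of_real (t / r)) (mat 1))"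
    using r by (simp add: vec_eq_iff field_simps)
  moreover have "P (b + cscale (of_real (t / r)) (mat 1)) \<noteq> 0"
    using b t r unfolding cone_def by (auto simp del: of_real_divide)
  ultimately show "P (cscale (of_real r) b + cscale (of_real t) (mat 1)) \<noteq> 0"
    using r by (simp add: P_scale)
qed (use b in \<open>simp add: cone_hermitian hermitian_scale\<close>)

lemma mat_1_in_cone: "mat 1 \<in> cone"
proof -
  have nz: "P (mat 1) \<noteq> 0"
    using hyp[of 0 1] P_scale[of \<i> "mat 1"] by simp
  have "P (mat 1 + cscale (of_real t) (mat 1)) \<noteq> 0" if "t \<ge> 0" for t
  proof -
    have "mat 1 + cscale (of_real t) (mat 1) = cscale (of_real (1 + t)) (mat 1 :: 'n cmat)"
      by (simp add: vec_eq_iff algebra_simps)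
    then have "P (mat 1 + cscale (of_real t) (mat 1)) = of_real (1 + t) ^ m * P (mat 1)"
      by (simp only: P_scale)
    moreover have "complex_of_real (1 + t) \<noteq> 0"
      using that by (simp only: of_real_eq_0_iff)
    ultimately show ?thesis using nz by simp
  qed
  then show ?thesis
    by (simp add: cone_def)
qed

lemma cone_open:
  assumes b: "b \<in> cone"
  obtains e where "0 < e" "b + cscale (of_real (- e)) (mat 1) \<in> cone"
proof -
  let ?g = "\<lambda>t. P (b + cscale (of_real t) (mat 1))"
  have "continuous_on UNIV ?g" by (intro continuous_intros)
  then have "isCont ?g 0" by (simp add: continuous_on_eq_continuous_at)
  moreover have "?g 0 \<noteq> 0" using P_cone_nonzero[OF b] by simp
  ultimately obtain e where e: "e > 0" "\<And>t. dist 0 t < e \<Longrightarrow> ?g t \<noteq> 0"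
    using continuous_at_avoid[of 0 ?g 0] by metis
  have "?g t \<noteq> 0" if "t \<ge> - (e / 2)" for t
  proof (cases "t \<ge> 0")
    case True
    then show ?thesis using b by (simp add: cone_def)
  next
    case False
    then show ?thesis using e that by (simp add: dist_real_def)
  qed
  from this[of "t - e / 2" for t]
  have "P (b + cscale (of_real (- (e / 2))) (mat 1) + cscale (of_real t) (mat 1)) \<noteq> 0" if "t \<ge> 0" for t
    using that by (simp add: add.assoc cscale_add_left[symmetric])
  then have "b + cscale (of_real (- (e / 2))) (mat 1) \<in> cone"
    using b hermitian_scale[OF hermitian_mat_1, of "- (e / 2)"]
    unfolding cone_def by (auto intro!: hermitian_add)
  then show ?thesis using that[of "e / 2"] e by simp
qed

text \<open>By openness a small multiple e of the identity can be taken off \<open>b\<close> within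
  the cone. The tube condition holds for the reduced \<open>b\<close> plus \<open>c\<close>, and the
  part taken off pays for the positive shift it requires. Homogeneity then removes the factor
  i.\<close>

lemma cone_add:
  assumes b: "b \<in> cone" and c: "c \<in> cone"
  shows "b + c \<in> cone"
proof -
  obtain e where e: "0 < e" "b + cscale (of_real (- e)) (mat 1) \<in> cone"
    using cone_open[OF b] by blast
  let ?b = "b + cscale (of_real (- e)) (mat 1)"
  have "tube (0 + ?b)" by (intro tube_add tube_0 e) simp
  then have t: "tube (?b + c)"
    using tube_add[OF _ _ c, of ?b] e by (simp add: cone_hermitian)
  show ?thesis
    unfolding cone_def
  proof (intro CollectI conjI allI impI)
    fix t :: real assume "0 \<le> t"
    then have "P (0 + cscale \<i> (?b + c + cscale (of_real (e + t)) (mat 1))) \<noteq> 0"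
      using t e(1) by (simp only: tube_def) (metis add_pos_nonneg hermitian_0)
    moreover have "?b + c + cscale (of_real (e + t)) (mat 1) = b + c + cscale (of_real t) (mat 1)"
      by (simp add: vec_eq_iff algebra_simps)
    ultimately show "P (b + c + cscale (of_real t) (mat 1)) \<noteq> 0"
      by (simp only: add_0 P_scale) simp
  qed (use b c in \<open>simp add: cone_hermitian hermitian_add\<close>)
qed

lemma P_tube_nonzero:
  assumes X: "X \<in> hermitian_matrices" and Y: "Y \<in> cone"
  shows "P (X + cscale \<i> Y) \<noteq> 0"
proof -
  obtain e where e: "0 < e" "Y + cscale (of_real (- e)) (mat 1) \<in> cone"
    using cone_open[OF Y] by blast
  let ?Y = "Y + cscale (of_real (- e)) (mat 1)"
  have "tube (0 + ?Y)" by (intro tube_add tube_0 e) simp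
  moreover have "?Y + cscale (of_real e) (mat 1) = Y"
    by (simp add: vec_eq_iff)
  ultimately show ?thesis
    using e X unfolding tube_def by (metis add_0)
qed

text \<open>Putting \<open>b\<close> into one place is differentiation in the direction b. As a
  polynomial in s, the form at Z + s b has no root with Im s >= 0, because the imaginary part of the
  argument stays in the cone; by Gauss-Lucas its linear coefficient, a multiple of the value with
  one \<open>b\<close> inserted, is not 0.\<close>

lemma mixed_nonzero_tube:
  assumes "set bs \<subseteq> cone" "length bs + j = m" "X \<in> hermitian_matrices" "Y \<in> cone"
  shows "M (bs @ replicate j (X + cscale \<i> Y)) \<noteq> 0"
  using assms
proof (induction bs arbitrary: j X Y)
  case Nil
  then show ?case using P_tube_nonzero by simp
next
  case (Cons b bs)
  let ?Z = "X + cscale \<i> Y"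
  have len: "length bs + Suc j = m" and b: "b \<in> cone" and bs: "set bs \<subseteq> cone" using Cons.prems by auto
  obtain p where p: "\<forall>s. poly p s = M (bs @ replicate (Suc j) (?Z + cscale s b))"
    "\<forall>i. coeff p i = (if i \<le> Suc j then of_nat (Suc j choose i) * M (bs @ replicate i b @ replicate (Suc j - i) ?Z) else 0)"
    using line_poly[OF len] by blast
  \<comment> \<open>The leading coefficient, up to a power of i the value of the form at i b, is
    nonzero by the induction hypothesis; so the polynomial is not constant.\<close>
  have "M (bs @ replicate (Suc j) (0 + cscale \<i> b)) \<noteq> 0"
    by (rule Cons.IH[OF bs len _ b]) simp
  then have "coeff p (Suc j) \<noteq> 0"
    using cform_scale[OF form len, of \<i> b] by (simp add: p(2) del: replicate_Suc)
  then have "0 < degree p"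
    using le_degree by fastforce
  moreover have "Im s < 0" if "poly p s = 0" for s
  proof (rule ccontr)
    assume s: "\<not> Im s < 0"
    have "?Z + cscale s b = (X + cscale (of_real (Re s)) b) + cscale \<i> (Y + cscale (of_real (Im s)) b)"
      by (subst complex_eq[of s]) (simp add: vec_eq_iff algebra_simps)
    moreover have "Y + cscale (of_real (Im s)) b \<in> cone"
    proof (cases "Im s = 0")
      case True
      then show ?thesis using Cons.prems(4) by simp
    next
      case False
      then have "0 < Im s" using s by simp
      then show ?thesis
        by (intro cone_add cone_scale Cons.prems(4) b)
    qed
    ultimately have "M (bs @ replicate (Suc j) (?Z + cscale s b)) \<noteq> 0"
      using Cons.IH[OF bs len, of "X + cscale (of_real (Re s)) b"] Cons.prems b
      by (simp only:) (simp add: hermitian_add hermitian_scale cone_hermitian)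
    then show False using that p(1) by simp
  qed
  ultimately have "coeff p 1 \<noteq> 0"
    by (rule coeff_1_nonzero_of_roots_Im_neg)
  then have "M (bs @ b # replicate j ?Z) \<noteq> 0"
    by (simp add: p(2))
  moreover have "M ((b # bs) @ replicate j ?Z) = M (bs @ b # replicate j ?Z)"
    by (rule cform_sym[OF form]) (use len in auto)
  ultimately show ?case by simp
qed

lemma mixed_nonzero:
  assumes "set bs \<subseteq> cone" "length bs = m"
  shows "M bs \<noteq> 0"
  using mixed_nonzero_tube[OF assms(1), of 0 0 "mat 1"] assms mat_1_in_cone by simp

end

locale real_hyperbolic_form = hyperbolic_form +
  assumes real: "\<And>xs. set xs \<subseteq> hermitian_matrices \<Longrightarrow> length xs = m \<Longrightarrow> M xs \<in> \<real>"
    and unit: "M (replicate m (mat 1)) = 1"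
begin

text \<open>Positivity comes from non-vanishing. The value at the identity is positive by induction;
  were the value at \<open>b\<close> not positive, weighting each of the two matrices by the
  absolute value at the other would give an element of the cone at which the form vanishes.\<close>

lemma mixed_pos_aux:
  assumes "set bs \<subseteq> cone" "length bs + j = m"
  shows "Re (M (bs @ replicate j (mat 1))) > 0"
  using assms
proof (induction bs arbitrary: j)
  case Nil
  then show ?case using unit by simp
next
  case (Cons b bs)
  let ?r = "bs @ replicate j (mat 1)"
  have len: "Suc (length ?r) = m" and b: "b \<in> cone" and bs: "set bs \<subseteq> cone" using Cons.prems by auto
  have herm: "set bs \<subseteq> hermitian_matrices" using bs cone_hermitian by auto
  have "Re (M (bs @ replicate (Suc j) (mat 1))) > 0"
    by (rule Cons.IH) (use Cons.prems in auto)
  also have "M (bs @ replicate (Suc j) (mat 1)) = M (mat 1 # ?r)"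
    by (rule cform_sym[OF form]) (use len in auto)
  finally have \<beta>: "Re (M (mat 1 # ?r)) > 0" .
  show ?case
  proof (rule ccontr)
    assume "\<not> Re (M ((b # bs) @ replicate j (mat 1))) > 0"
    then have \<alpha>: "Re (M (b # ?r)) \<le> 0" by simp
    let ?a = "- Re (M (b # ?r))" and ?b = "Re (M (mat 1 # ?r))"
    have "M (b # ?r) \<in> \<real>" "M (mat 1 # ?r) \<in> \<real>"
      by (rule real; use len herm b in \<open>auto simp: cone_hermitian\<close>)+
    then have "M ((cscale (of_real ?b) b + cscale (of_real ?a) (mat 1)) # ?r) = 0"
      by (subst cform_linear[OF form len]) (auto simp: complex_is_Real_iff complex_eq_iff)
    moreover have "cscale (of_real ?b) b + cscale (of_real ?a) (mat 1) \<in> cone"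
    proof (cases "?a = 0")
      case True
      then show ?thesis using \<beta> b by (simp only: True) (simp add: cone_scale)
    next
      case False
      then show ?thesis using \<alpha> \<beta> b mat_1_in_cone by (intro cone_add cone_scale) auto
    qed
    ultimately show False
      using mixed_nonzero[of "(cscale (of_real ?b) b + cscale (of_real ?a) (mat 1)) # ?r"] len bs mat_1_in_cone
      by (auto simp: subset_iff split: if_splits)
  qed
qed

definition closed_cone :: "'a cmat set" where
  "closed_cone = {A \<in> hermitian_matrices. \<forall>e>0. A + cscale (of_real e) (mat 1) \<in> cone}"

text \<open>The arguments pass one at a time from the open cone to its closure: the form at A + e I
  is affine in e and nonnegative for e > 0.\<close>

lemma mixed_nonneg_aux:
  assumes "set As \<subseteq> closed_cone" "set bs \<subseteq> cone" "length As + length bs = m"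
  shows "Re (M (As @ bs)) \<ge> 0"
  using assms
proof (induction As arbitrary: bs)
  case Nil
  then show ?case using mixed_pos_aux[of bs 0] by simp
next
  case (Cons A As)
  let ?r = "As @ bs"
  have len: "Suc (length ?r) = m" using Cons.prems by simp
  have le: "0 \<le> Re (M (A # ?r)) + e * Re (M (mat 1 # ?r))" if "e > 0" for e
  proof -
    have "0 \<le> Re (M (As @ (A + cscale (of_real e) (mat 1)) # bs))"
      by (rule Cons.IH) (use Cons.prems that in \<open>auto simp: closed_cone_def\<close>)
    also have "M (As @ (A + cscale (of_real e) (mat 1)) # bs) = M ((cscale 1 A + cscale (of_real e) (mat 1)) # ?r)"
      by (rule cform_sym[OF form]) (use len in auto)
    also have "\<dots> = M (A # ?r) + of_real e * M (mat 1 # ?r)"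
      by (subst cform_linear[OF form len]) simp
    finally show ?thesis by simp
  qed
  have "((\<lambda>e. Re (M (A # ?r)) + e * Re (M (mat 1 # ?r))) \<longlongrightarrow> Re (M (A # ?r)) + 0 * Re (M (mat 1 # ?r))) (at_right 0)"
    by (intro tendsto_intros)
  then have "0 \<le> Re (M (A # ?r)) + 0 * Re (M (mat 1 # ?r))"
    by (rule tendsto_lowerbound) (auto simp: eventually_at_right_less intro!: eventually_at_rightI[of 0 1] le)
  then show ?case by simp
qed

lemma mixed_nonneg:
  assumes "set As \<subseteq> closed_cone" "length As = m"
  shows "Re (M As) \<ge> 0"
  using mixed_nonneg_aux[of As "[]"] assms by simp

end

section \<open>Hyperbolicity of the polarized \<open>S_k\<close> and its positivity on rank one
  forms\<close>

lemma continuous_on_polar_det_replicate: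
  "continuous_on UNIV (\<lambda>Z. polar_det (replicate k Z @ replicate (CARD('n) - k) (mat 1 :: ('n::finite) cmat)))"
  if "k \<le> CARD('n)"
proof -
  have "continuous_on UNIV (\<lambda>Z. polar_det (map (\<lambda>f. f Z) (replicate k (\<lambda>Z. Z) @ replicate (CARD('n) - k) (\<lambda>_. mat 1 :: 'n cmat))))"
    by (rule continuous_on_polar_det) (use that in \<open>auto intro!: continuous_intros\<close>)
  then show ?thesis by simp
qed

lemma polar_det_real_hyperbolic:
  "real_hyperbolic_form (polar_det :: ('n::finite) cmat list \<Rightarrow> complex) CARD('n)"
proof
  show "cform CARD('n) (polar_det :: 'n cmat list \<Rightarrow> complex)" by (rule cform_polar_det)
  show "continuous_on UNIV (\<lambda>Z :: 'n cmat. polar_det (replicate CARD('n) Z))"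
    using continuous_on_polar_det_replicate[where 'n='n, OF order_refl] by simp
next
  fix X :: "'n cmat" and d :: real assume "X \<in> hermitian_matrices" "0 < d"
  then show "polar_det (replicate CARD('n) (X + cscale (\<i> * complex_of_real d) (mat 1))) \<noteq> 0"
    unfolding polar_det_replicate by (intro det_hermitian_shift_nonzero) auto
next
  show "polar_det (replicate CARD('n) (mat 1 :: 'n cmat)) = 1"
    by (simp add: polar_det_replicate)
qed (use polar_det_hermitian_real in blast)

interpretation D: real_hyperbolic_form "polar_det :: ('n::finite) cmat list \<Rightarrow> complex" "CARD('n)"
  by (rule polar_det_real_hyperbolic)

text \<open>Hyperbolicity is inherited from the determinant: the identity lies in its Garding cone,
  so n - k places may be filled with it without creating zeros on the tube.\<close>

lemma polar_S_real_hyperbolic: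
  assumes k: "k \<le> CARD('n::finite)"
  shows "real_hyperbolic_form (\<lambda>xs :: 'n cmat list. polar_det (xs @ replicate (CARD('n) - k) (mat 1))) k"
proof
  show "cform k (\<lambda>xs :: 'n cmat list. polar_det (xs @ replicate (CARD('n) - k) (mat 1)))"
    by (rule cform_polar_S[OF k])
  show "continuous_on UNIV (\<lambda>Z :: 'n cmat. polar_det (replicate k Z @ replicate (CARD('n) - k) (mat 1)))"
    by (rule continuous_on_polar_det_replicate[OF k])
next
  fix X :: "'n cmat" and d :: real assume X: "X \<in> hermitian_matrices" and d: "0 < d"
  have "cscale (of_real d) (mat 1) \<in> (D.cone :: 'n cmat set)"
    by (intro D.cone_scale D.mat_1_in_cone d)
  then have "polar_det (replicate (CARD('n) - k) (mat 1) @ replicate k (X + cscale \<i> (cscale (of_real d) (mat 1)))) \<noteq> 0"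
    by (intro D.mixed_nonzero_tube X) (use D.mat_1_in_cone k in auto)
  also have "polar_det (replicate (CARD('n) - k) (mat 1) @ replicate k (X + cscale \<i> (cscale (of_real d) (mat 1)))) =
      polar_det (replicate k (X + cscale (\<i> * complex_of_real d) (mat 1)) @ replicate (CARD('n) - k) (mat 1))"
    by (rule cform_sym[OF cform_polar_det]) (use k in auto)
  finally show "polar_det (replicate k (X + cscale (\<i> * complex_of_real d) (mat 1)) @ replicate (CARD('n) - k) (mat 1)) \<noteq> 0" .
next
  show "polar_det (replicate k (mat 1) @ replicate (CARD('n) - k) (mat 1 :: 'n cmat)) = 1"
    using polar_det_replicate[of "mat 1 :: 'n cmat"] k by (simp add: replicate_add[symmetric])
next
  fix xs :: "'n cmat list" assume "set xs \<subseteq> hermitian_matrices" "length xs = k"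
  then show "polar_det (xs @ replicate (CARD('n) - k) (mat 1)) \<in> \<real>"
    by (intro polar_det_hermitian_real) (use k in \<open>auto split: if_splits\<close>)
qed

text \<open>All arguments lie in the closed Garding cone of \<open>S_k\<close>. The rank one form
  does because adding e I makes it positive definite. For A with eigenvalues in
  \<open>Gamma_cone k\<close>, the expansion of \<open>S_k\<close> at A + t I has nonnegative terms,
  among them t^k, so it cannot vanish for t > 0.\<close>

lemma polar_S_outer_nonneg:
  fixes x :: "complex ^ 'n::finite"
  assumes k: "k \<le> CARD('n)" and len: "Suc (length As) = k"
    and As: "\<And>A. A \<in> set As \<Longrightarrow> A \<in> hermitian_matrices \<and> eigenvalue_vector A \<in> Gamma_cone k"
  shows "0 \<le> Re (polar_S (outer x (\<chi> i. cnj (x $ i)) # As))"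
proof -
  let ?M = "\<lambda>xs :: 'n cmat list. polar_det (xs @ replicate (CARD('n) - k) (mat 1))"
  interpret S: real_hyperbolic_form ?M k
    by (rule polar_S_real_hyperbolic[OF k])
  let ?x = "outer x (\<chi> i. cnj (x $ i))"
  have xH: "?x \<in> hermitian_matrices"
    by (rule hermitianI) (simp add: outer_def)
  have D: "?x + cscale (of_real e) (mat 1) \<in> D.cone" if e: "0 < e" for e
    unfolding D.cone_def
  proof (intro CollectI conjI allI impI)
    fix t :: real assume t: "0 \<le> t"
    have "Re (quad (?x + cscale (of_real e) (mat 1) + cscale (of_real t) (mat 1)) v) > 0" if "v \<noteq> 0" for v
      using quad_outer_nonneg[of x v] that e t
      by (simp add: quad_add quad_cscale quad_mat_1 add_nonneg_pos add_pos_nonneg)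
    then show "polar_det (replicate CARD('n) (?x + cscale (of_real e) (mat 1) + cscale (of_real t) (mat 1))) \<noteq> 0"
      unfolding polar_det_replicate by (intro det_nonzero_of_quad) force
  qed (use xH in \<open>simp add: hermitian_add hermitian_scale\<close>)
  have "?x + cscale (of_real e) (mat 1) \<in> S.cone" if e: "0 < e" for e
    unfolding S.cone_def
  proof (intro CollectI conjI allI impI)
    fix t :: real assume t: "0 \<le> t"
    have "?x + cscale (of_real e) (mat 1) + cscale (of_real t) (mat 1) = ?x + cscale (of_real (e + t)) (mat 1)"
      by (simp add: vec_eq_iff algebra_simps)
    moreover have "?x + cscale (of_real (e + t)) (mat 1) \<in> D.cone"
      using D[of "e + t"] e t by simp
    ultimately have "?x + cscale (of_real e) (mat 1) + cscale (of_real t) (mat 1) \<in> D.cone"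
      by (simp only:)
    then show "?M (replicate k (?x + cscale (of_real e) (mat 1) + cscale (of_real t) (mat 1))) \<noteq> 0"
      by (intro D.mixed_nonzero) (use k D.mat_1_in_cone in \<open>auto split: if_splits\<close>)
  qed (use xH in \<open>simp add: hermitian_add hermitian_scale\<close>)
  then have x: "?x \<in> S.closed_cone"
    using xH by (simp add: S.closed_cone_def)
  have A: "A \<in> S.closed_cone" if "A \<in> set As" for A
  proof -
    have AH: "A \<in> hermitian_matrices" and AG: "eigenvalue_vector A \<in> Gamma_cone k"
      using As[OF that] by auto
    have nz: "?M (replicate k (A + cscale (of_real t) (mat 1))) \<noteq> 0" if t: "0 < t" for t
    proof -
      have "?M ([] @ replicate k (cscale 1 A + cscale (of_real t) (mat 1))) =
        (\<Sum>i\<le>k. of_nat (k choose i) * (1 ^ i * of_real t ^ (k - i) * ?M ([] @ replicate i A @ replicate (k - i) (mat 1))))"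
        by (rule cform_binomial[OF S.form]) simp
      also have "\<dots> = (\<Sum>i\<le>k. of_nat (k choose i) * (of_real (t ^ (k - i)) * polar_S (replicate i A)))"
        using k by (intro sum.cong refl) (simp add: polar_S_def replicate_add[symmetric])
      finally have "Re (?M (replicate k (A + cscale (of_real t) (mat 1)))) =
          (\<Sum>i\<le>k. of_nat (k choose i) * (t ^ (k - i) * Re (polar_S (replicate i A))))"
        by simp
      also have "\<dots> \<ge> (\<Sum>i\<in>{0}. of_nat (k choose i) * (t ^ (k - i) * Re (polar_S (replicate i A))))"
        using polar_S_nonneg_of_Gamma[OF AH AG _ k] t by (intro sum_mono2) auto
      moreover have "polar_S ([] :: 'n cmat list) = 1"
        using polar_det_replicate[of "mat 1 :: 'n cmat"] by (simp add: polar_S_def)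
      ultimately have "Re (?M (replicate k (A + cscale (of_real t) (mat 1)))) \<ge> t ^ k"
        by simp
      then show ?thesis using t by (metis zero_complex.sel(1) not_le zero_less_power)
    qed
    have "A + cscale (of_real e) (mat 1) \<in> S.cone" if e: "0 < e" for e
      unfolding S.cone_def
    proof (intro CollectI conjI allI impI)
      fix t :: real assume t: "0 \<le> t"
      have "A + cscale (of_real e) (mat 1) + cscale (of_real t) (mat 1) = A + cscale (of_real (e + t)) (mat 1)"
        by (simp add: vec_eq_iff algebra_simps)
      moreover have "0 < e + t" using e t by simp
      ultimately show "?M (replicate k (A + cscale (of_real e) (mat 1) + cscale (of_real t) (mat 1))) \<noteq> 0"
        using nz[of "e + t"] by (simp only:) simp
    qed (use AH in \<open>simp add: hermitian_add hermitian_scale\<close>)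
    then show ?thesis using AH by (simp add: S.closed_cone_def)
  qed
  have "0 \<le> Re (?M (?x # As))"
    by (rule S.mixed_nonneg) (use x A len in auto)
  then show ?thesis
    using len by (simp add: polar_S_def)
qed

subsection \<open>Line derivatives\<close>

text \<open>The analysis uses derivatives along lines only. Continuity of all of them is easy to
  carry through products, convolutions and gluing, which is all that integration by parts asks
  for.\<close>

definition lderiv :: "'a::real_normed_vector \<Rightarrow> ('a \<Rightarrow> complex) \<Rightarrow> 'a \<Rightarrow> complex" where
  "lderiv v f x = vector_derivative (\<lambda>t. f (x + t *\<^sub>R v)) (at 0)"

abbreviation has_lderiv :: "'a::real_normed_vector \<Rightarrow> ('a \<Rightarrow> complex) \<Rightarrow> complex \<Rightarrow> 'a \<Rightarrow> bool" where
  "has_lderiv v f d x \<equiv> ((\<lambda>t. f (x + t *\<^sub>R v)) has_vector_derivative d) (at 0)"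

lemma lderiv_eq: "has_lderiv v f d x \<Longrightarrow> lderiv v f x = d"
  unfolding lderiv_def by (rule vector_derivative_at)

lemma has_lderiv_shift:
  assumes "has_lderiv v f d (x + t *\<^sub>R v)"
  shows "((\<lambda>s. f (x + s *\<^sub>R v)) has_vector_derivative d) (at t)"
proof -
  have "((\<lambda>s. s - t) has_vector_derivative 1) (at t)"
    by (auto intro!: derivative_eq_intros)
  moreover have "((\<lambda>s. f (x + t *\<^sub>R v + s *\<^sub>R v)) has_vector_derivative d) (at (t - t))"
    using assms by simp
  ultimately have "((\<lambda>s. f (x + t *\<^sub>R v + s *\<^sub>R v)) \<circ> (\<lambda>s. s - t) has_vector_derivative 1 *\<^sub>R d) (at t)"
    by (rule vector_diff_chain_at)
  then show ?thesis
    by (simp add: o_def algebra_simps)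
qed

lemma has_lderiv_transform:
  assumes "has_lderiv v f d x" "open S" "x \<in> S" "\<And>y. y \<in> S \<Longrightarrow> f y = g y"
  shows "has_lderiv v g d x"
proof (rule has_vector_derivative_transform_within_open[OF assms(1)])
  show "open ((\<lambda>t. x + t *\<^sub>R v) -` S)"
    by (intro open_vimage assms continuous_intros)
qed (use assms in auto)

lemma has_lderiv_mult:
  "has_lderiv v f d x \<Longrightarrow> has_lderiv v g e x \<Longrightarrow> has_lderiv v (\<lambda>y. f y * g y) (d * g x + f x * e) x"
  using has_vector_derivative_mult[of "\<lambda>t. f (x + t *\<^sub>R v)" d 0 UNIV "\<lambda>t. g (x + t *\<^sub>R v)" e]
  by (simp add: add.commute)

definition C1on :: "'a::real_normed_vector set \<Rightarrow> ('a \<Rightarrow> complex) \<Rightarrow> bool" where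
  "C1on S f \<longleftrightarrow> continuous_on S f \<and>
     (\<forall>v. continuous_on S (lderiv v f) \<and> (\<forall>x\<in>S. has_lderiv v f (lderiv v f x) x))"

lemma C1onD:
  assumes "C1on S f"
  shows "continuous_on S f" "continuous_on S (lderiv v f)" "x \<in> S \<Longrightarrow> has_lderiv v f (lderiv v f x) x"
  using assms by (auto simp: C1on_def)

lemma C1onI:
  assumes "continuous_on S f" "\<And>v. continuous_on S (g v)" "\<And>v x. x \<in> S \<Longrightarrow> has_lderiv v f (g v x) x"
  shows "C1on S f"
proof -
  have "lderiv v f x = g v x" if "x \<in> S" for v x
    by (rule lderiv_eq) (rule assms(3)[OF that])
  moreover from this have "continuous_on S (lderiv v f)" for v
    using continuous_on_cong[OF refl, of S "lderiv v f" "g v"] assms(2) by simp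
  ultimately show ?thesis
    using assms by (simp add: C1on_def)
qed

lemma C1on_cong_open:
  assumes "C1on S f" "open S" "\<And>x. x \<in> S \<Longrightarrow> f x = g x"
  shows "C1on S g" "\<And>v x. x \<in> S \<Longrightarrow> lderiv v g x = lderiv v f x"
proof -
  have d: "has_lderiv v g (lderiv v f x) x" if "x \<in> S" for v x
    by (rule has_lderiv_transform[where f=f and S=S]) (use assms that C1onD in auto)
  show "C1on S g"
    by (rule C1onI[where g="\<lambda>v. lderiv v f"])
      (use d C1onD[OF assms(1)] assms(3) continuous_on_cong[OF refl, of S f g] in auto)
  show "\<And>v x. x \<in> S \<Longrightarrow> lderiv v g x = lderiv v f x"
    by (rule lderiv_eq) (rule d)
qed

lemma C1on_subset: "C1on S f \<Longrightarrow> T \<subseteq> S \<Longrightarrow> C1on T f"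
  unfolding C1on_def by (meson continuous_on_subset subsetD)

lemma C1on_Un:
  assumes "C1on S f" "C1on T f" "open S" "open T"
  shows "C1on (S \<union> T) f"
  using assms unfolding C1on_def by (auto intro: continuous_on_open_Un)

lemma C1on_const: "C1on S (\<lambda>_. c)"
  by (rule C1onI[where g="\<lambda>_ _. 0"]) auto

lemma C1on_mult:
  assumes "C1on S f" "C1on S g"
  shows "C1on S (\<lambda>x. f x * g x)"
    "\<And>v x. x \<in> S \<Longrightarrow> lderiv v (\<lambda>x. f x * g x) x = lderiv v f x * g x + f x * lderiv v g x"
proof -
  have d: "has_lderiv v (\<lambda>x. f x * g x) (lderiv v f x * g x + f x * lderiv v g x) x" if "x \<in> S" for v x
    by (rule has_lderiv_mult) (use assms that C1onD in auto)
  show "C1on S (\<lambda>x. f x * g x)"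
    by (rule C1onI[where g="\<lambda>v x. lderiv v f x * g x + f x * lderiv v g x"])
      (auto intro!: continuous_intros C1onD(1,2)[OF assms(1)] C1onD(1,2)[OF assms(2)] d)
  show "\<And>v x. x \<in> S \<Longrightarrow> lderiv v (\<lambda>x. f x * g x) x = lderiv v f x * g x + f x * lderiv v g x"
    by (rule lderiv_eq) (rule d)
qed

lemma C1on_lincomb:
  assumes "C1on S f" "C1on S g"
  shows "C1on S (\<lambda>x. a * f x + b * g x)"
    "\<And>v x. x \<in> S \<Longrightarrow> lderiv v (\<lambda>x. a * f x + b * g x) x = a * lderiv v f x + b * lderiv v g x"
proof -
  have d: "has_lderiv v (\<lambda>x. a * f x + b * g x) (a * lderiv v f x + b * lderiv v g x) x" if "x \<in> S" for v x
    using that by (intro has_vector_derivative_add has_vector_derivative_mult_right C1onD[OF assms(1)] C1onD[OF assms(2)])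
  show "C1on S (\<lambda>x. a * f x + b * g x)"
    by (rule C1onI[where g="\<lambda>v x. a * lderiv v f x + b * lderiv v g x"])
      (auto intro!: continuous_intros C1onD(1,2)[OF assms(1)] C1onD(1,2)[OF assms(2)] d)
  show "\<And>v x. x \<in> S \<Longrightarrow> lderiv v (\<lambda>x. a * f x + b * g x) x = a * lderiv v f x + b * lderiv v g x"
    by (rule lderiv_eq) (rule d)
qed

definition C1c :: "'a::real_normed_vector set \<Rightarrow> ('a \<Rightarrow> complex) \<Rightarrow> bool" where
  "C1c K f \<longleftrightarrow> C1on UNIV f \<and> (\<forall>x. x \<notin> K \<longrightarrow> f x = 0)"

lemma C1c_lderiv_eq_0:
  assumes "C1c K f" "closed K" "x \<notin> K"
  shows "lderiv v f x = 0"
proof -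
  have "has_lderiv v f 0 x"
    by (rule has_lderiv_transform[where f="\<lambda>_. 0" and S="- K"]) (use assms in \<open>auto simp: C1c_def\<close>)
  then show ?thesis by (rule lderiv_eq)
qed

lemma C1cD:
  assumes "C1c K f"
  shows "continuous_on S f" "continuous_on S (lderiv v f)" "has_lderiv v f (lderiv v f x) x"
    "x \<notin> K \<Longrightarrow> f x = 0"
  using assms continuous_on_subset by (auto simp: C1on_def C1c_def)

text \<open>\<open>S\<close> and the complement of \<open>K\<close> are open and cover the space; on
  the latter the product is 0 whatever \<open>h\<close> is there.\<close>

lemma continuous_on_cutoff_mult:
  fixes f h :: "'a::t2_space \<Rightarrow> complex"
  assumes "continuous_on UNIV f" "\<And>x. x \<notin> K \<Longrightarrow> f x = 0" "closed K" "K \<subseteq> S" "open S" "continuous_on S h"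
  shows "continuous_on UNIV (\<lambda>x. f x * h x)"
proof -
  have "continuous_on S (\<lambda>x. f x * h x)"
    using assms by (intro continuous_intros continuous_on_subset[OF assms(1)]) auto
  moreover have "continuous_on (- K) (\<lambda>x. f x * h x) \<longleftrightarrow> continuous_on (- K) (\<lambda>_. 0 :: complex)"
    by (rule continuous_on_cong) (use assms in auto)
  ultimately have "continuous_on (S \<union> - K) (\<lambda>x. f x * h x)"
    using assms by (intro continuous_on_open_Un) auto
  moreover have "S \<union> - K = UNIV" using assms by auto
  ultimately show ?thesis by simp
qed

text \<open>The product rule holds at every point: off \<open>S\<close> both \<open>f\<close> and
  its derivative are 0, so the unspecified value of \<open>lderiv v h\<close> is multiplied by
  0.\<close>

lemma C1c_mult:
  assumes f: "C1c K f" and h: "C1on S h" and K: "closed K" "K \<subseteq> S" "open S"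
  shows "C1c K (\<lambda>x. f x * h x)"
    "\<And>v x. lderiv v (\<lambda>x. f x * h x) x = lderiv v f x * h x + f x * lderiv v h x"
proof -
  let ?g = "\<lambda>v x. lderiv v f x * h x + f x * lderiv v h x"
  have d: "has_lderiv v (\<lambda>x. f x * h x) (?g v x) x" for v x
  proof (cases "x \<in> S")
    case True
    then show ?thesis
      by (intro has_lderiv_mult) (use f h C1cD C1onD in auto)
  next
    case False
    then have x: "x \<in> - K" using K by auto
    have "has_lderiv v (\<lambda>x. f x * h x) 0 x"
      by (rule has_lderiv_transform[where f="\<lambda>_. 0" and S="- K"]) (use x f K in \<open>auto simp: C1c_def\<close>)
    moreover have "?g v x = 0"
      using x f K by (simp add: C1c_lderiv_eq_0 C1cD)
    ultimately show ?thesis by (simp only:)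
  qed
  have "C1on UNIV (\<lambda>x. f x * h x)"
  proof (rule C1onI[where g="?g"])
    show "continuous_on UNIV (\<lambda>x. f x * h x)"
      by (rule continuous_on_cutoff_mult[of f K S]) (use f h K in \<open>auto simp: C1cD C1onD\<close>)
    show "continuous_on UNIV (?g v)" for v
      by (intro continuous_on_add continuous_on_cutoff_mult[of _ K S])
        (use f h K in \<open>auto simp: C1cD C1onD C1c_lderiv_eq_0\<close>)
  qed (rule d)
  then show "C1c K (\<lambda>x. f x * h x)"
    using f by (auto simp: C1c_def)
  show "\<And>v x. lderiv v (\<lambda>x. f x * h x) x = ?g v x"
    by (rule lderiv_eq) (rule d)
qed

subsection \<open>Integration of compactly supported functions\<close>

lemma integrable_compact_support:
  fixes f :: "'a::euclidean_space \<Rightarrow> complex"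
  assumes "continuous_on UNIV f" "compact K" "\<And>x. x \<notin> K \<Longrightarrow> f x = 0"
  shows "integrable lborel f"
proof -
  have "integrable lborel (\<lambda>x. indicator K x *\<^sub>R f x)"
    using assms by (intro borel_integrable_compact continuous_on_subset[OF assms(1)]) auto
  moreover have "(\<lambda>x. indicator K x *\<^sub>R f x) = f"
    using assms(3) by (auto simp: fun_eq_iff indicator_def)
  ultimately show ?thesis by simp
qed

lemma lborel_integral_eq_cbox:
  fixes f :: "'a::euclidean_space \<Rightarrow> complex"
  assumes "continuous_on UNIV f" "\<And>x. x \<notin> cbox a b \<Longrightarrow> f x = 0"
  shows "(LINT x|lborel. f x) = integral (cbox a b) f"
proof -
  have "(LINT x|lborel. f x) = integral UNIV f"
    by (rule integral_lborel[symmetric], rule integrable_compact_support[OF assms(1) compact_cbox assms(2)])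
  moreover have "(\<lambda>x. if x \<in> cbox a b then f x else 0) = f"
    using assms(2) by auto
  ultimately show ?thesis
    using integral_restrict_UNIV[of "cbox a b" f] by simp
qed

text \<open>A common box containing all supports for |t| <= 1 reduces differentiation under the
  integral to the Leibniz rule on that box.\<close>

lemma has_vector_derivative_lborel_integral:
  fixes f :: "real \<Rightarrow> 'a::euclidean_space \<Rightarrow> complex"
  assumes d: "\<And>t y. ((\<lambda>t. f t y) has_vector_derivative f' t y) (at t)"
    and cont: "\<And>t. continuous_on UNIV (f t)" "continuous_on UNIV (\<lambda>(t, y). f' t y)"
    and supp: "\<And>t y. t \<in> {-1..1} \<Longrightarrow> y \<notin> cbox a b \<Longrightarrow> f t y = 0"
      "\<And>t y. t \<in> {-1..1} \<Longrightarrow> y \<notin> cbox a b \<Longrightarrow> f' t y = 0"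
  shows "((\<lambda>t. LINT y|lborel. f t y) has_vector_derivative (LINT y|lborel. f' 0 y)) (at 0)"
proof -
  have "((\<lambda>t. integral (cbox a b) (f t)) has_vector_derivative integral (cbox a b) (f' 0)) (at 0 within {-1..1})"
  proof (rule leibniz_rule_vector_derivative)
    show "continuous_on ({-1..1} \<times> cbox a b) (\<lambda>(t, y). f' t y)"
      by (rule continuous_on_subset[OF cont(2) subset_UNIV])
    show "f t integrable_on cbox a b" for t
      by (rule integrable_continuous) (rule continuous_on_subset[OF cont(1) subset_UNIV])
    show "((\<lambda>t. f t y) has_vector_derivative f' t y) (at t within {-1..1})" for t y
      by (rule has_vector_derivative_at_within[OF d])
  qed auto
  then have "((\<lambda>t. integral (cbox a b) (f t)) has_vector_derivative integral (cbox a b) (f' 0)) (at 0)"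
    by (simp add: at_within_Icc_at)
  then have "((\<lambda>t. LINT y|lborel. f t y) has_vector_derivative integral (cbox a b) (f' 0)) (at 0)"
  proof (rule has_vector_derivative_transform_within_open[where S="{-1<..<1}"])
    show "integral (cbox a b) (f t) = (LINT y|lborel. f t y)" if "t \<in> {-1<..<1}" for t
      by (rule lborel_integral_eq_cbox[OF cont(1) supp(1), symmetric]) (use that in auto)
  qed auto
  moreover have "continuous_on UNIV (f' 0)"
  proof -
    have "continuous_on UNIV ((\<lambda>(t, y). f' t y) \<circ> (\<lambda>y. (0, y)))"
      by (rule continuous_on_compose)
        (intro continuous_intros, rule continuous_on_subset[OF cont(2) subset_UNIV])
    then show ?thesis by (simp add: o_def)
  qed
  then have "(LINT y|lborel. f' 0 y) = integral (cbox a b) (f' 0)"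
    by (rule lborel_integral_eq_cbox) (use supp(2) in auto)
  ultimately show ?thesis by simp
qed

lemma lborel_integral_shift:
  fixes f :: "'a::euclidean_space \<Rightarrow> complex"
  assumes "f \<in> borel_measurable borel"
  shows "(LINT y|lborel. f (y + c)) = (LINT y|lborel. f y)"
proof -
  have "(LINT y|lborel. f y) = (LINT y|distr lborel borel ((+) c). f y)"
    by (simp only: lborel_distr_plus)
  also have "\<dots> = (LINT y|lborel. f (c + y))"
    by (rule integral_distr) (use assms in auto)
  finally show ?thesis by (simp add: add.commute)
qed

lemma lborel_integral_reflect:
  fixes f :: "'a::euclidean_space \<Rightarrow> complex"
  assumes "f \<in> borel_measurable borel"
  shows "(LINT y|lborel. f (c - y)) = (LINT y|lborel. f y)"
proof -
  have 1: "(lborel :: 'a measure) = density (distr lborel borel (\<lambda>x. c + (-1) *\<^sub>R x)) (\<lambda>_. ennreal (\<bar>-1\<bar> ^ DIM('a)))"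
    by (rule lborel_affine) simp
  have 2: "density (distr lborel borel (\<lambda>x. c + (-1) *\<^sub>R x)) (\<lambda>_. ennreal (\<bar>-1\<bar> ^ DIM('a))) = distr lborel borel (\<lambda>x::'a. c - x)"
    by (simp add: density_1)
  have "(LINT y|lborel. f y) = (LINT y|distr lborel borel (\<lambda>x. c - x). f y)"
    by (rule arg_cong[where f="\<lambda>M. integral\<^sup>L M f", OF trans[OF 1 2]])
  also have "\<dots> = (LINT y|lborel. f (c - y))"
    by (rule integral_distr) (use assms in auto)
  finally show ?thesis by simp
qed

lemma bounded_compact_shift:
  assumes "compact (K :: 'a::euclidean_space set)"
  obtains a b where "\<And>t y. t \<in> {-1..1} \<Longrightarrow> y + t *\<^sub>R v \<in> K \<Longrightarrow> y \<in> cbox a (b :: 'a)"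
proof -
  obtain B where B: "\<And>x. x \<in> K \<Longrightarrow> norm x \<le> B"
    using compact_imp_bounded[OF assms] unfolding bounded_iff by blast
  obtain a :: 'a where ab: "cball 0 (B + norm v) \<subseteq> cbox (- a) a"
    using bounded_subset_cbox_symmetric[OF bounded_cball] by blast
  have "y \<in> cbox (- a) a" if "t \<in> {-1..1}" "y + t *\<^sub>R v \<in> K" for t y
  proof -
    have "norm y \<le> norm (y + t *\<^sub>R v) + norm (t *\<^sub>R v)"
      by (metis add_diff_cancel norm_triangle_ineq4)
    also have "\<dots> \<le> B + 1 * norm v"
    proof (rule add_mono[OF B[OF that(2)]])
      show "norm (t *\<^sub>R v) \<le> 1 * norm v"
        unfolding norm_scaleR by (rule mult_right_mono) (use that(1) in auto)
    qed
    finally show ?thesis using ab by auto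
  qed
  then show ?thesis using that by blast
qed

text \<open>The integral of f(y + t v) over y does not depend on t; it is differentiated at t = 0
  under the integral sign.\<close>

lemma integral_lderiv_eq_0:
  fixes f :: "'a::euclidean_space \<Rightarrow> complex"
  assumes f: "C1c K f" and K: "compact K"
  shows "(LINT x|lborel. lderiv v f x) = 0"
proof -
  obtain a b where ab: "\<And>t y. t \<in> {-1..1} \<Longrightarrow> y + t *\<^sub>R v \<in> K \<Longrightarrow> y \<in> cbox a b"
    using bounded_compact_shift[OF K] by blast
  have "((\<lambda>t. LINT y|lborel. f (y + t *\<^sub>R v)) has_vector_derivative (LINT y|lborel. lderiv v f (y + 0 *\<^sub>R v))) (at 0)"
  proof (rule has_vector_derivative_lborel_integral)
    show "((\<lambda>t. f (y + t *\<^sub>R v)) has_vector_derivative lderiv v f (y + t *\<^sub>R v)) (at t)" for t y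
      by (rule has_lderiv_shift) (rule C1cD[OF f])
    show "continuous_on UNIV (\<lambda>y. f (y + t *\<^sub>R v))" for t
      by (rule continuous_on_compose2[OF C1cD(1)[OF f, of UNIV]]) (auto intro!: continuous_intros)
    show "continuous_on UNIV (\<lambda>(t, y). lderiv v f (y + t *\<^sub>R v))"
      unfolding case_prod_unfold
      by (rule continuous_on_compose2[OF C1cD(2)[OF f, of UNIV]]) (auto intro!: continuous_intros)
    show "f (y + t *\<^sub>R v) = 0" if "t \<in> {-1..1}" "y \<notin> cbox a b" for t y
      using ab that f by (auto simp: C1c_def)
    show "lderiv v f (y + t *\<^sub>R v) = 0" if "t \<in> {-1..1}" "y \<notin> cbox a b" for t y
      using ab that by (intro C1c_lderiv_eq_0[OF f] compact_imp_closed[OF K]) auto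
  qed
  moreover have "(LINT y|lborel. f (y + t *\<^sub>R v)) = (LINT y|lborel. f y)" for t
    by (rule lborel_integral_shift) (rule borel_measurable_continuous_onI, rule C1cD[OF f])
  ultimately have "((\<lambda>t. LINT y|lborel. f y) has_vector_derivative (LINT y|lborel. lderiv v f y)) (at (0::real))"
    by simp
  then show ?thesis
    using vector_derivative_unique_at[OF _ has_vector_derivative_const] by blast
qed

subsection \<open>Mollification\<close>

definition conv :: "('a::euclidean_space \<Rightarrow> complex) \<Rightarrow> ('a \<Rightarrow> complex) \<Rightarrow> 'a \<Rightarrow> complex" where
  "conv f g x = (LINT y|lborel. f (x - y) * g y)"

lemma conv_commute:
  fixes f g :: "'a::euclidean_space \<Rightarrow> complex"
  assumes "continuous_on UNIV f" "continuous_on UNIV g"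
  shows "conv f g = conv g f"
proof
  fix x
  have "(LINT y|lborel. (\<lambda>y. f (x - y) * g y) (x - y)) = (LINT y|lborel. f (x - y) * g y)"
    by (rule lborel_integral_reflect, rule borel_measurable_continuous_onI)
      (intro continuous_intros continuous_on_compose2[OF assms(1)] continuous_on_compose2[OF assms(2)], auto)
  then show "conv f g x = conv g f x"
    by (simp add: conv_def mult.commute)
qed

lemma conv_eq_0:
  assumes "\<And>x. x \<notin> K \<Longrightarrow> f x = 0" "\<And>x. x \<notin> L \<Longrightarrow> g x = 0" "x \<notin> {a + b |a b. a \<in> K \<and> b \<in> L}"
  shows "conv f g x = 0"
proof -
  have "f (x - y) * g y = 0" for y
    using assms(1)[of "x - y"] assms(2)[of y] assms(3) by (metis (mono_tags, lifting) diff_add_cancel mem_Collect_eq mult_eq_0_iff)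
  then have "(\<lambda>y. f (x - y) * g y) = (\<lambda>_. 0)" by (rule ext)
  then show ?thesis by (simp only: conv_def) simp
qed

lemma continuous_on_conv:
  fixes f g :: "'a::euclidean_space \<Rightarrow> complex"
  assumes f: "continuous_on UNIV f" and g: "continuous_on UNIV g" and L: "compact L" "\<And>x. x \<notin> L \<Longrightarrow> g x = 0"
  shows "continuous_on UNIV (conv f g)"
proof -
  obtain a where ab: "L \<subseteq> cbox (- a) a"
    using bounded_subset_cbox_symmetric[OF compact_imp_bounded[OF L(1)]] by blast
  have c: "continuous_on UNIV (\<lambda>(x, y). f (x - y) * g y)"
    unfolding case_prod_unfold
    by (intro continuous_intros continuous_on_compose2[OF f] continuous_on_compose2[OF g]) auto
  have "conv f g = (\<lambda>x. integral (cbox (- a) a) (\<lambda>y. f (x - y) * g y))"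
    unfolding conv_def
  proof (rule ext, rule lborel_integral_eq_cbox)
    show "continuous_on UNIV (\<lambda>y. f (x - y) * g y)" for x
      by (intro continuous_intros continuous_on_compose2[OF f] continuous_on_compose2[OF g]) auto
  qed (use ab L in auto)
  moreover have "continuous_on UNIV (\<lambda>x. integral (cbox (- a) a) (\<lambda>y. f (x - y) * g y))"
    by (rule integral_continuous_on_param) (rule continuous_on_subset[OF c subset_UNIV])
  ultimately show ?thesis by (simp only:)
qed

lemma has_lderiv_conv:
  fixes f g :: "'a::euclidean_space \<Rightarrow> complex"
  assumes f: "C1c K f" and g: "continuous_on UNIV g" and L: "compact L" "\<And>x. x \<notin> L \<Longrightarrow> g x = 0"
  shows "has_lderiv v (conv f g) (conv (lderiv v f) g x) x"
proof -
  obtain a where ab: "L \<subseteq> cbox (- a) a"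
    using bounded_subset_cbox_symmetric[OF compact_imp_bounded[OF L(1)]] by blast
  have "((\<lambda>t. LINT y|lborel. f ((x - y) + t *\<^sub>R v) * g y) has_vector_derivative
     (LINT y|lborel. lderiv v f ((x - y) + 0 *\<^sub>R v) * g y)) (at 0)"
  proof (rule has_vector_derivative_lborel_integral[where f="\<lambda>t y. f ((x - y) + t *\<^sub>R v) * g y"
      and f'="\<lambda>t y. lderiv v f ((x - y) + t *\<^sub>R v) * g y" and a="- a" and b=a])
    show "((\<lambda>t. f ((x - y) + t *\<^sub>R v) * g y) has_vector_derivative lderiv v f ((x - y) + t *\<^sub>R v) * g y) (at t)" for t y
      by (rule has_vector_derivative_mult_left, rule has_lderiv_shift, rule C1cD(3)[OF f])
    show "continuous_on UNIV (\<lambda>y. f ((x - y) + t *\<^sub>R v) * g y)" for t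
      by (intro continuous_on_mult continuous_on_compose2[OF C1cD(1)[OF f, of UNIV] _ subset_UNIV] g continuous_intros)
    show "continuous_on UNIV (\<lambda>(t, y). lderiv v f ((x - y) + t *\<^sub>R v) * g y)"
      unfolding case_prod_unfold
      by (intro continuous_on_mult continuous_on_compose2[OF C1cD(2)[OF f, of UNIV] _ subset_UNIV]
        continuous_on_compose2[OF g _ subset_UNIV] continuous_intros)
  qed (use ab L in auto)
  then show ?thesis
    by (simp add: conv_def diff_add_eq)
qed

lemma lderiv_conv:
  assumes "C1c K f" "continuous_on UNIV g" "compact L" "\<And>x. x \<notin> L \<Longrightarrow> g x = 0"
  shows "lderiv v (conv f g) = conv (lderiv v f) g"
  using lderiv_eq[OF has_lderiv_conv[OF assms]] by blast

lemma C1c_conv: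
  fixes f g :: "'a::euclidean_space \<Rightarrow> complex"
  assumes f: "C1c K f" and g: "continuous_on UNIV g" and L: "compact L" "\<And>x. x \<notin> L \<Longrightarrow> g x = 0"
  shows "C1c {a + b |a b. a \<in> K \<and> b \<in> L} (conv f g)"
proof -
  have "C1on UNIV (conv f g)"
  proof (rule C1onI[where g="\<lambda>v. conv (lderiv v f) g"])
    show "continuous_on UNIV (conv f g)"
      by (rule continuous_on_conv[OF C1cD(1)[OF f] g L])
    show "continuous_on UNIV (conv (lderiv v f) g)" for v
      by (rule continuous_on_conv[OF C1cD(2)[OF f] g L])
    show "has_lderiv v (conv f g) (conv (lderiv v f) g x) x" for v x
      by (rule has_lderiv_conv[OF f g L])
  qed
  moreover have "conv f g x = 0" if "x \<notin> {a + b |a b. a \<in> K \<and> b \<in> L}" for x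
    by (rule conv_eq_0[OF C1cD(4)[OF f] L(2) that])
  ultimately show ?thesis
    unfolding C1c_def by blast
qed

lemma max_0_power2_deriv: "((\<lambda>s::real. (max 0 s)\<^sup>2) has_real_derivative 2 * max 0 s) (at s)"
proof (cases "s = 0")
  case True
  have bound: "norm (((max 0 (0 + h))\<^sup>2 - (max 0 0)\<^sup>2) / h) \<le> \<bar>h\<bar>" for h :: real
    by (cases "h \<le> 0") (simp_all add: power2_eq_square)
  have "((\<lambda>h::real. ((max 0 (0 + h))\<^sup>2 - (max 0 0)\<^sup>2) / h) \<longlongrightarrow> 0) (at 0)"
  proof (rule Lim_null_comparison)
    show "\<forall>\<^sub>F h in at 0. norm (((max 0 (0 + h))\<^sup>2 - (max 0 0)\<^sup>2) / h) \<le> \<bar>h\<bar>"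
      by (intro always_eventually allI bound)
    show "((\<lambda>h::real. \<bar>h\<bar>) \<longlongrightarrow> 0) (at 0)"
      by (intro tendsto_rabs_zero tendsto_ident_at)
  qed
  then show ?thesis
    using True by (simp add: DERIV_def)
next
  case False
  show ?thesis
  proof (cases "s > 0")
    case True
    have "((\<lambda>s::real. s\<^sup>2) has_real_derivative 2 * s) (at s)"
      by (auto intro!: derivative_eq_intros)
    then have "((\<lambda>s::real. (max 0 s)\<^sup>2) has_real_derivative 2 * s) (at s)"
      by (rule has_field_derivative_transform_within_open[where S="{0<..}"]) (use True in auto)
    then show ?thesis using True by simp
  next
    case neg: False
    have "((\<lambda>s::real. 0) has_real_derivative 0) (at s)"
      by simp
    then have "((\<lambda>s::real. (max 0 s)\<^sup>2) has_real_derivative 0) (at s)"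
      by (rule has_field_derivative_transform_within_open[where S="{..<0}"]) (use neg False in auto)
    then show ?thesis using neg by simp
  qed
qed

text \<open>The square of the positive part is of class C^1. This suffices for a mollifier here,
  since the mollified functions are C^1 themselves and share the two derivatives with it.\<close>

definition bump :: "real \<Rightarrow> 'a::euclidean_space \<Rightarrow> complex" where
  "bump h x = of_real ((max 0 (h\<^sup>2 - x \<bullet> x))\<^sup>2)"

lemma C1c_bump: "0 < h \<Longrightarrow> C1c (cball 0 h) (bump h :: 'a::euclidean_space \<Rightarrow> complex)"
  unfolding C1c_def
proof (intro conjI allI impI)
  show "C1on UNIV (bump h :: 'a \<Rightarrow> complex)"
  proof (rule C1onI[where g="\<lambda>v x. of_real (2 * max 0 (h\<^sup>2 - x \<bullet> x) * (- 2 * (x \<bullet> v)))"])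
    fix v x :: 'a
    have "((\<lambda>t. h\<^sup>2 - (x + t *\<^sub>R v) \<bullet> (x + t *\<^sub>R v)) has_real_derivative (- 2 * (x \<bullet> v))) (at 0)"
      by (auto intro!: derivative_eq_intros simp: inner_add_left inner_add_right inner_commute)
    from DERIV_chain2[OF max_0_power2_deriv this]
    have "((\<lambda>t. (max 0 (h\<^sup>2 - (x + t *\<^sub>R v) \<bullet> (x + t *\<^sub>R v)))\<^sup>2) has_vector_derivative
        2 * max 0 (h\<^sup>2 - x \<bullet> x) * (- 2 * (x \<bullet> v))) (at 0)"
      by (simp add: has_real_derivative_iff_has_vector_derivative)
    then show "has_lderiv v (bump h) (of_real (2 * max 0 (h\<^sup>2 - x \<bullet> x) * (- 2 * (x \<bullet> v)))) x"
      unfolding bump_def by (rule bounded_linear.has_vector_derivative[OF bounded_linear_of_real])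
  qed (auto simp: bump_def intro!: continuous_intros)
next
  fix x :: 'a assume h: "0 < h" and "x \<notin> cball 0 h"
  then have "h\<^sup>2 \<le> (norm x)\<^sup>2"
    by (intro power_mono) auto
  then show "bump h x = 0"
    by (simp add: bump_def power2_norm_eq_inner)
qed

lemma bump_integral_pos:
  assumes h: "0 < h"
  obtains N where "0 < N" "(LINT x|lborel. bump h (x::'a::euclidean_space)) = of_real N"
proof -
  let ?r = "\<lambda>x::'a. (max 0 (h\<^sup>2 - x \<bullet> x))\<^sup>2"
  have bi: "integrable lborel (bump h :: 'a \<Rightarrow> complex)"
    by (rule integrable_compact_support[of _ "cball 0 h"])
       (simp_all add: C1cD[OF C1c_bump[OF h]] del: mem_cball)
  then have ri: "integrable lborel ?r"
    using integrable_Re[OF bi] by (simp add: bump_def)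
  \<comment> \<open>On the ball of radius h / 2 the difference h^2 - |x|^2 is at least h^2 / 2,
    which bounds the integral away from 0.\<close>
  have "(LINT x|lborel. (h\<^sup>2 / 2)\<^sup>2 * indicator (ball 0 (h/2)) (x :: 'a)) \<le> (LINT x|lborel. ?r x)"
  proof (rule Bochner_Integration.integral_mono)
    show "integrable lborel (\<lambda>x::'a. (h\<^sup>2 / 2)\<^sup>2 * indicator (ball 0 (h/2)) x)"
      by (intro integrable_mult_right integrable_real_indicator emeasure_bounded_finite) auto
    fix x :: 'a
    have "(h\<^sup>2 / 2)\<^sup>2 \<le> ?r x" if "x \<in> ball 0 (h/2)"
    proof (rule power_mono)
      have "(norm x)\<^sup>2 \<le> (h/2)\<^sup>2" using that by (intro power_mono) auto
      then have "x \<bullet> x \<le> h\<^sup>2 / 4"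
        by (simp add: power2_norm_eq_inner power_divide)
      then have "h\<^sup>2 / 2 \<le> h\<^sup>2 - x \<bullet> x"
        using zero_le_power2[of h] by linarith
      then show "h\<^sup>2 / 2 \<le> max 0 (h\<^sup>2 - x \<bullet> x)"
        by (rule max.coboundedI2)
    qed simp
    then show "(h\<^sup>2 / 2)\<^sup>2 * indicator (ball 0 (h/2)) x \<le> ?r x"
      by (auto simp: indicator_def)
  qed (rule ri)
  moreover have "0 < measure lborel (ball 0 (h/2) :: 'a set)"
    using h content_ball_pos[of "h/2" "0::'a"] by simp
  ultimately have "0 < (LINT x|lborel. ?r x)"
    using h by (simp add: mult_pos_pos less_le_trans[rotated])
  moreover have "(LINT x|lborel. bump h (x::'a)) = of_real (LINT x|lborel. ?r x)"
    unfolding bump_def by (rule integral_of_real) (rule ri)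
  ultimately show ?thesis using that by blast
qed

lemma mollifier_kernel:
  assumes h: "0 < h"
  obtains \<rho> :: "'a::euclidean_space \<Rightarrow> complex"
  where "C1c (cball 0 h) \<rho>" "(LINT x|lborel. \<rho> x) = 1" "(LINT x|lborel. norm (\<rho> x)) = 1"
proof -
  obtain N where N: "0 < N" "(LINT x|lborel. bump h (x::'a)) = of_real N"
    using bump_integral_pos[OF h] by blast
  \<comment> \<open>The zero summand only gives the function the shape of
    \<open>C1on_lincomb\<close>.\<close>
  define \<rho> :: "'a \<Rightarrow> complex" where "\<rho> = (\<lambda>x. of_real (1 / N) * bump h x + 0 * bump h x)"
  have b: "C1c (cball 0 h) (bump h :: 'a \<Rightarrow> complex)" by (rule C1c_bump[OF h])
  then have "C1on UNIV \<rho>"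
    unfolding \<rho>_def C1c_def by (intro C1on_lincomb) auto
  moreover have "\<rho> x = 0" if "x \<notin> cball 0 h" for x
    using C1cD(4)[OF b that] by (simp add: \<rho>_def)
  ultimately have 1: "C1c (cball 0 h) \<rho>"
    by (simp add: C1c_def)
  have 2: "(LINT x|lborel. \<rho> x) = 1"
    using N by (simp add: \<rho>_def)
  have "norm (\<rho> x) = Re (\<rho> x)" for x
    using N by (simp add: \<rho>_def bump_def norm_mult norm_divide norm_power)
  moreover have "integrable lborel \<rho>"
    by (rule integrable_compact_support[OF C1cD(1)[OF 1] compact_cball C1cD(4)[OF 1]])
  ultimately have 3: "(LINT x|lborel. norm (\<rho> x)) = 1"
    using 2 by simp
  show ?thesis by (rule that[OF 1 2 3])
qed

lemma compact_support_uniformly_continuous: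
  fixes f :: "'a::euclidean_space \<Rightarrow> complex"
  assumes f: "continuous_on UNIV f" and K: "compact K" "\<And>x. x \<notin> K \<Longrightarrow> f x = 0" and e: "0 < e"
  obtains d where "0 < d" "\<And>x y. norm y \<le> d \<Longrightarrow> cmod (f (x - y) - f x) \<le> e"
proof -
  define L where "L = {a + b |a b. a \<in> K \<and> b \<in> cball (0::'a) 1}"
  have L: "compact L"
    unfolding L_def by (intro compact_sums K compact_cball)
  have KL: "x + y \<in> L" if "x \<in> K" "norm y \<le> 1" for x y
    using that by (auto simp: L_def)
  have "uniformly_continuous_on L f"
    by (rule compact_uniformly_continuous[OF continuous_on_subset[OF f subset_UNIV] L])
  then have "\<exists>d>0. \<forall>x\<in>L. \<forall>y\<in>L. dist y x < d \<longrightarrow> dist (f y) (f x) < e"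
    using e by (simp add: uniformly_continuous_on_def)
  then obtain d where d: "0 < d" "\<forall>x\<in>L. \<forall>y\<in>L. dist y x < d \<longrightarrow> dist (f y) (f x) < e"
    by (elim exE conjE)
  have "cmod (f (x - y) - f x) \<le> e" if y: "norm y \<le> min (d / 2) 1" for x y
  proof (cases "x \<in> K \<or> x - y \<in> K")
    case True
    have "x \<in> L \<and> x - y \<in> L"
    proof (cases "x \<in> K")
      case True
      then show ?thesis using KL[of x 0] KL[of x "- y"] y by simp
    next
      case False
      then have "x - y \<in> K" using \<open>x \<in> K \<or> x - y \<in> K\<close> by simp
      then show ?thesis using KL[of "x - y" y] KL[of "x - y" 0] y by simp
    qed
    moreover have "dist (x - y) x < d"
      using y d(1) by (simp add: dist_norm)
    ultimately show ?thesis
      using d(2) by (simp add: dist_norm less_imp_le)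
  next
    case False
    then show ?thesis using K e by simp
  qed
  then show ?thesis
    using that[of "min (d / 2) 1"] d(1) by simp
qed

lemma conv_approx:
  fixes f \<rho> :: "'a::euclidean_space \<Rightarrow> complex"
  assumes f: "continuous_on UNIV f"
    and close: "\<And>y. norm y \<le> h \<Longrightarrow> cmod (f (x - y) - f x) \<le> e"
    and \<rho>: "C1c (cball 0 h) \<rho>" "(LINT x|lborel. \<rho> x) = 1" "(LINT x|lborel. norm (\<rho> x)) = 1"
  shows "cmod (conv f \<rho> x - f x) \<le> e"
proof -
  have cf: "continuous_on UNIV (\<lambda>y. f (x - y))"
    by (rule continuous_on_compose2[OF f]) (auto intro!: continuous_intros)
  have i1: "integrable lborel (\<lambda>y. f (x - y) * \<rho> y)"
    by (rule integrable_compact_support[OF _ compact_cball[of 0 h]])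
      (use C1cD[OF \<rho>(1)] in \<open>auto intro!: continuous_intros cf simp del: mem_cball\<close>)
  have i2: "integrable lborel \<rho>"
    by (rule integrable_compact_support[OF C1cD(1)[OF \<rho>(1)] compact_cball C1cD(4)[OF \<rho>(1)]])
  have "conv f \<rho> x - f x = (LINT y|lborel. f (x - y) * \<rho> y) - (LINT y|lborel. f x * \<rho> y)"
    by (simp add: conv_def \<rho>(2))
  also have "\<dots> = (LINT y|lborel. f (x - y) * \<rho> y - f x * \<rho> y)"
    by (rule Bochner_Integration.integral_diff[symmetric, OF i1 integrable_mult_right[OF i2]])
  finally have "cmod (conv f \<rho> x - f x) \<le> (LINT y|lborel. cmod (f (x - y) * \<rho> y - f x * \<rho> y))"
    by (simp only:) (rule integral_norm_bound)
  also have "\<dots> \<le> (LINT y|lborel. e * norm (\<rho> y))"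
  proof (rule Bochner_Integration.integral_mono)
    show "integrable lborel (\<lambda>y. cmod (f (x - y) * \<rho> y - f x * \<rho> y))"
      by (intro integrable_norm Bochner_Integration.integrable_diff i1 integrable_mult_right i2)
    show "integrable lborel (\<lambda>y. e * norm (\<rho> y))"
      by (intro integrable_mult_right integrable_norm i2)
    fix y
    show "cmod (f (x - y) * \<rho> y - f x * \<rho> y) \<le> e * norm (\<rho> y)"
    proof (cases "y \<in> cball 0 h")
      case True
      then have "cmod (f (x - y) - f x) * norm (\<rho> y) \<le> e * norm (\<rho> y)"
        by (intro mult_right_mono close) auto
      then show ?thesis
        by (simp add: left_diff_distrib[symmetric] norm_mult)
    next
      case False
      then show ?thesis using C1cD(4)[OF \<rho>(1) False] by simp
    qed
  qed
  finally show ?thesis by (simp add: \<rho>(3))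
qed

text \<open>Symmetry of the second derivatives is made part of the class: test fields have to supply
  it, and convolutions provide it directly.\<close>

definition C2c :: "'a::real_normed_vector set \<Rightarrow> ('a \<Rightarrow> complex) \<Rightarrow> bool" where
  "C2c K g \<longleftrightarrow> C1c K g \<and> (\<forall>v. C1c K (lderiv v g)) \<and> (\<forall>v w. lderiv v (lderiv w g) = lderiv w (lderiv v g))"

lemma C1c_mono: "C1c K f \<Longrightarrow> K \<subseteq> L \<Longrightarrow> C1c L f"
  by (auto simp: C1c_def)

text \<open>Two C^1 functions have a C^2 convolution because one derivative can be put on each
  factor. Either factor may take either derivative, and this freedom gives the symmetry of the
  second derivatives.\<close>

lemma C2c_conv:
  fixes f \<rho> :: "'a::euclidean_space \<Rightarrow> complex"
  assumes f: "C1c K f" and \<rho>: "C1c L \<rho>" and K: "compact K" and L: "compact L"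
  shows "C2c {a + b |a b. a \<in> K \<and> b \<in> L} (conv f \<rho>)"
    "lderiv v (conv f \<rho>) = conv (lderiv v f) \<rho>"
proof -
  have d1: "lderiv v (conv f \<rho>) = conv (lderiv v f) \<rho>" for v
    by (rule lderiv_conv[OF f C1cD(1)[OF \<rho>] L C1cD(4)[OF \<rho>]])
  have fz: "lderiv v f x = 0" if "x \<notin> K" for v x
    by (rule C1c_lderiv_eq_0[OF f compact_imp_closed[OF K] that])
  have \<rho>z: "lderiv v \<rho> x = 0" if "x \<notin> L" for v x
    by (rule C1c_lderiv_eq_0[OF \<rho> compact_imp_closed[OF L] that])
  have d1': "lderiv v (conv f \<rho>) = conv \<rho> (lderiv v f)" for v
    unfolding d1 by (rule conv_commute[OF C1cD(2)[OF f] C1cD(1)[OF \<rho>]])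
  have d2: "lderiv w (lderiv v (conv f \<rho>)) = conv (lderiv w \<rho>) (lderiv v f)" for v w
    unfolding d1' by (rule lderiv_conv[OF \<rho> C1cD(2)[OF f] K fz])
  have d1'': "lderiv v (conv f \<rho>) = conv f (lderiv v \<rho>)" for v
  proof -
    have "lderiv v (conv f \<rho>) = lderiv v (conv \<rho> f)"
      by (rule arg_cong[OF conv_commute[OF C1cD(1)[OF f] C1cD(1)[OF \<rho>]]])
    also have "\<dots> = conv (lderiv v \<rho>) f"
      by (rule lderiv_conv[OF \<rho> C1cD(1)[OF f] K C1cD(4)[OF f]])
    also have "\<dots> = conv f (lderiv v \<rho>)"
      by (rule conv_commute[OF C1cD(2)[OF \<rho>] C1cD(1)[OF f]])
    finally show ?thesis .
  qed
  have d2': "lderiv w (lderiv v (conv f \<rho>)) = conv (lderiv v \<rho>) (lderiv w f)" for v w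
  proof -
    have "lderiv w (lderiv v (conv f \<rho>)) = conv (lderiv w f) (lderiv v \<rho>)"
      unfolding d1'' by (rule lderiv_conv[OF f C1cD(2)[OF \<rho>] L \<rho>z])
    also have "\<dots> = conv (lderiv v \<rho>) (lderiv w f)"
      by (rule conv_commute[OF C1cD(2)[OF f] C1cD(2)[OF \<rho>]])
    finally show ?thesis .
  qed
  have eq: "{a + b |a b. a \<in> L \<and> b \<in> K} = {a + b |a b. a \<in> K \<and> b \<in> L}"
    using add.commute by blast
  have "C1c {a + b |a b. a \<in> K \<and> b \<in> L} (lderiv v (conv f \<rho>))" for v
    unfolding d1' using C1c_conv[OF \<rho> C1cD(2)[OF f] K fz] unfolding eq .
  moreover have "C1c {a + b |a b. a \<in> K \<and> b \<in> L} (conv f \<rho>)"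
    by (rule C1c_conv[OF f C1cD(1)[OF \<rho>] L C1cD(4)[OF \<rho>]])
  moreover have "lderiv v (lderiv w (conv f \<rho>)) = lderiv w (lderiv v (conv f \<rho>))" for v w
    unfolding d2[of v w] d2'[of w v] ..
  ultimately show "C2c {a + b |a b. a \<in> K \<and> b \<in> L} (conv f \<rho>)"
    unfolding C2c_def by blast
  show "lderiv v (conv f \<rho>) = conv (lderiv v f) \<rho>" by (rule d1)
qed

text \<open>Finitely many directions are approximated at once, by taking the kernel radius to be the
  least of their moduli of uniform continuity and of \<open>r\<close>, the permitted growth of the
  support.\<close>

lemma C2c_approx:
  fixes f :: "'a::euclidean_space \<Rightarrow> complex"
  assumes f: "C1c K f" and K: "compact K" and r: "0 < r" and e: "0 < e" and V: "finite V"
  obtains g where "C2c {a + b |a b. a \<in> K \<and> b \<in> cball 0 r} g"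
    "\<And>v x. v \<in> V \<Longrightarrow> cmod (lderiv v g x - lderiv v f x) \<le> e"
proof -
  have "\<exists>d>0. \<forall>x y. norm y \<le> d \<longrightarrow> cmod (lderiv v f (x - y) - lderiv v f x) \<le> e" for v
    by (rule compact_support_uniformly_continuous[OF C1cD(2)[OF f, where v=v] K
        C1c_lderiv_eq_0[OF f compact_imp_closed[OF K]] e]) blast+
  then obtain d where d: "\<And>v. 0 < d v" "\<And>v x y. norm y \<le> d v \<Longrightarrow> cmod (lderiv v f (x - y) - lderiv v f x) \<le> e"
    by metis
  define h where "h = Min (insert r (d ` V))"
  have h: "0 < h" "h \<le> r" "\<And>v. v \<in> V \<Longrightarrow> h \<le> d v"
    using V d(1) r by (auto simp: h_def)
  obtain \<rho> :: "'a \<Rightarrow> complex" where \<rho>: "C1c (cball 0 h) \<rho>" "(LINT x|lborel. \<rho> x) = 1" "(LINT x|lborel. norm (\<rho> x)) = 1"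
    using mollifier_kernel[OF h(1)] by blast
  have "C1c (cball 0 r) \<rho>"
    by (rule C1c_mono[OF \<rho>(1)]) (use h in auto)
  then have g: "C2c {a + b |a b. a \<in> K \<and> b \<in> cball 0 r} (conv f \<rho>)"
    by (rule C2c_conv[OF f _ K compact_cball])
  have "cmod (lderiv v (conv f \<rho>) x - lderiv v f x) \<le> e" if "v \<in> V" for v x
  proof -
    have "cmod (conv (lderiv v f) \<rho> x - lderiv v f x) \<le> e"
      by (rule conv_approx[OF C1cD(2)[OF f] _ \<rho>]) (use d(2) h(3)[OF that] in force)
    then show ?thesis
      by (simp only: C2c_conv(2)[OF f \<rho>(1) K compact_cball])
  qed
  then show ?thesis by (rule that[OF g])
qed

subsection \<open>Wirtinger derivatives\<close>

definition dz :: "'n::finite \<Rightarrow> (complex ^ 'n \<Rightarrow> complex) \<Rightarrow> complex ^ 'n \<Rightarrow> complex" where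
  "dz i f = (\<lambda>x. (1 / 2) * lderiv (axis i 1) f x + (- \<i> / 2) * lderiv (axis i \<i>) f x)"

definition dzb :: "'n::finite \<Rightarrow> (complex ^ 'n \<Rightarrow> complex) \<Rightarrow> complex ^ 'n \<Rightarrow> complex" where
  "dzb i f = (\<lambda>x. (1 / 2) * lderiv (axis i 1) f x + (\<i> / 2) * lderiv (axis i \<i>) f x)"

definition C2on :: "'a::real_normed_vector set \<Rightarrow> ('a \<Rightarrow> complex) \<Rightarrow> bool" where
  "C2on S f \<longleftrightarrow> C1on S f \<and> (\<forall>v. C1on S (lderiv v f))"

lemma C2on_imp_C1on: "C2on S f \<Longrightarrow> C1on S f" and C2on_lderiv: "C2on S f \<Longrightarrow> C1on S (lderiv v f)"
  by (auto simp: C2on_def)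

lemma continuous_on_dz: "C1on S f \<Longrightarrow> continuous_on S (dz i f)"
  unfolding dz_def by (intro continuous_on_add continuous_on_mult continuous_on_const C1onD(2))

lemma continuous_on_dzb: "C1on S f \<Longrightarrow> continuous_on S (dzb i f)"
  unfolding dzb_def by (intro continuous_on_add continuous_on_mult continuous_on_const C1onD(2))

lemma C1on_dz: "C2on S f \<Longrightarrow> C1on S (dz i f)"
  unfolding dz_def by (intro C1on_lincomb(1) C2on_lderiv)

lemma C1on_dzb: "C2on S f \<Longrightarrow> C1on S (dzb i f)"
  unfolding dzb_def by (intro C1on_lincomb(1) C2on_lderiv)

lemma C1c_dz_eq_0: "C1c K f \<Longrightarrow> closed K \<Longrightarrow> x \<notin> K \<Longrightarrow> dz i f x = 0"
  by (simp add: dz_def C1c_lderiv_eq_0)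

lemma C1c_dzb_eq_0: "C1c K f \<Longrightarrow> closed K \<Longrightarrow> x \<notin> K \<Longrightarrow> dzb i f x = 0"
  by (simp add: dzb_def C1c_lderiv_eq_0)

lemma C1c_imp_C1on: "C1c K f \<Longrightarrow> C1on S f"
  unfolding C1c_def using C1on_subset by blast

lemma C1c_dz:
  assumes "C1c K f" "\<And>v. C1c K (lderiv v f)" "closed K"
  shows "C1c K (dz i f)" "C1c K (dzb i f)"
  unfolding C1c_def
  using C1on_dz[of UNIV f i] C1on_dzb[of UNIV f i] C1c_dz_eq_0[OF assms(1,3)] C1c_dzb_eq_0[OF assms(1,3)]
    C1c_imp_C1on[OF assms(1)] C1c_imp_C1on[OF assms(2)]
  by (auto simp: C2on_def)

lemma dz_mult_C1c:
  assumes "C1c K f" "C1on S h" "closed K" "K \<subseteq> S" "open S"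
  shows "dz i (\<lambda>x. f x * h x) x = dz i f x * h x + f x * dz i h x"
  by (simp add: dz_def C1c_mult(2)[OF assms] algebra_simps)

lemma dz_commute:
  assumes "C2c K g"
  shows "dz a (dz i g) = dz i (dz a g)"
proof -
  have c: "C1on UNIV (lderiv v g)" for v
    using assms C1c_imp_C1on by (auto simp: C2c_def)
  have 1: "lderiv v (dz i g) x = (1 / 2) * lderiv v (lderiv (axis i 1) g) x + (- \<i> / 2) * lderiv v (lderiv (axis i \<i>) g) x" for v i x
    unfolding dz_def by (rule C1on_lincomb(2)[OF c c]) simp
  have 2: "lderiv v (lderiv w g) = lderiv w (lderiv v g)" for v w
    using assms unfolding C2c_def by blast
  have 3: "dz a h x = (1 / 2) * lderiv (axis a 1) h x + (- \<i> / 2) * lderiv (axis a \<i>) h x" for a :: 'a and h x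
    by (simp add: dz_def)
  have "dz a (dz i g) x = (1 / 4) * lderiv (axis a 1) (lderiv (axis i 1) g) x
      + (- \<i> / 4) * (lderiv (axis a 1) (lderiv (axis i \<i>) g) x + lderiv (axis i 1) (lderiv (axis a \<i>) g) x)
      + (- 1 / 4) * lderiv (axis a \<i>) (lderiv (axis i \<i>) g) x" for a i x
    unfolding 3[of a "dz i g"] 1 2[of "axis i 1" "axis a \<i>"] by (simp add: field_simps)
  then show ?thesis
    unfolding fun_eq_iff using 2[of "axis a 1" "axis i 1"] 2[of "axis a \<i>" "axis i \<i>"]
    by (simp only: add.commute[of "lderiv (axis a 1) (lderiv (axis i \<i>) g) x" for x]) simp
qed

lemma integrable_cutoff_mult:
  fixes f h :: "'a::euclidean_space \<Rightarrow> complex"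
  assumes "continuous_on UNIV f" "\<And>x. x \<notin> K \<Longrightarrow> f x = 0" "compact K" "K \<subseteq> S" "open S" "continuous_on S h"
  shows "integrable lborel (\<lambda>x. f x * h x)"
  by (rule integrable_compact_support[OF continuous_on_cutoff_mult[OF assms(1,2) compact_imp_closed[OF assms(3)] assms(4-6)] assms(3)])
    (use assms(2) in auto)

lemma C1c_integrable_dz_mult:
  assumes "C1c K f" "compact K" "K \<subseteq> S" "open S" "continuous_on S h"
  shows "integrable lborel (\<lambda>x. dz i f x * h x)"
  by (rule integrable_cutoff_mult[OF continuous_on_dz[OF C1c_imp_C1on[OF assms(1)]]
        C1c_dz_eq_0[OF assms(1) compact_imp_closed[OF assms(2)]] assms(2-5)])

lemma integral_dz_eq_0:
  assumes f: "C1c K f" and K: "compact K"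
  shows "(LINT x|lborel. dz i f x) = 0"
proof -
  have i: "integrable lborel (lderiv v f)" for v
    by (rule integrable_compact_support[OF C1cD(2)[OF f] K C1c_lderiv_eq_0[OF f compact_imp_closed[OF K]]])
  show ?thesis
    unfolding dz_def
    by (subst Bochner_Integration.integral_add) (simp_all add: i integral_lderiv_eq_0[OF f K])
qed

definition lhess :: "(complex ^ 'n::finite \<Rightarrow> complex) \<Rightarrow> complex ^ 'n \<Rightarrow> 'n cmat" where
  "lhess f x = (\<chi> i j. dz i (dzb j f) x)"

lemma continuous_on_lhess: "C2on S f \<Longrightarrow> continuous_on S (\<lambda>x. lhess f x $ i $ j)"
  unfolding lhess_def by (simp add: continuous_on_dz[OF C1on_dzb])

lemma continuous_on_polar_lhess:
  fixes A :: "complex ^ 'n::finite \<Rightarrow> 'n cmat"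
  assumes "\<And>i j. continuous_on S (\<lambda>x. A x $ i $ j)" "\<And>w. w \<in> set ws \<Longrightarrow> C2on S w"
    "Suc (length ws + length cs) = CARD('n)"
  shows "continuous_on S (\<lambda>x. polar_det (A x # map (\<lambda>w. lhess w x) ws @ cs))"
proof -
  have "continuous_on S (\<lambda>x. polar_det (map (\<lambda>f. f x) (A # map lhess ws @ map (\<lambda>c _. c) cs)))"
    by (rule continuous_on_polar_det) (use assms in \<open>auto intro: continuous_on_lhess\<close>)
  then show ?thesis by (simp add: o_def)
qed

subsection \<open>The weak divergence identity\<close>

lemma outer_add_left: "outer (x + y) p = outer x p + outer y p"
  by (simp add: outer_def vec_eq_iff algebra_simps)

text \<open>With p and q fixed, the form is bilinear in the two left vectors and vanishes when they
  coincide, hence it is alternating in them.\<close>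

lemma polar_det_unit_swap:
  assumes "Suc (Suc (length xs)) = CARD('n)"
  shows "polar_det (unit_cmat a b # unit_cmat i j # (xs :: ('n::finite) cmat list)) =
    - polar_det (unit_cmat i b # unit_cmat a j # xs)"
proof -
  have len: "length xs + 2 = CARD('n)" using assms by simp
  have len': "Suc (length (Z # xs)) = CARD('n)" for Z using assms by simp
  let ?x = "axis a 1 :: complex ^ 'n" and ?y = "axis i 1 :: complex ^ 'n"
  let ?p = "axis b 1 :: complex ^ 'n" and ?q = "axis j 1 :: complex ^ 'n"
  let ?D = "\<lambda>u w. polar_det (outer u ?p # outer w ?q # xs)"
  have add1: "?D (u + u') w = ?D u w + ?D u' w" for u u' w
    unfolding outer_add_left by (rule cform_head_add[OF cform_polar_det len'])
  have flip: "polar_det (X # Y # xs) = polar_det (Y # X # xs)" for X Y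
    by (rule cform_sym[OF cform_polar_det]) (use assms in auto)
  have add2: "?D u (w + w') = ?D u w + ?D u w'" for u w w'
    unfolding flip[of "outer u ?p"] outer_add_left by (rule cform_head_add[OF cform_polar_det len'])
  have "?D (?x + ?y) (?x + ?y) = 0" "?D ?x ?x = 0" "?D ?y ?y = 0"
    by (rule polar_det_outer_eq_0[OF len])+
  then have "?D ?x ?y + ?D ?y ?x = 0"
    by (simp add: add1 add2 add.commute)
  then show ?thesis
    unfolding unit_cmat_def by (rule eq_neg_iff_add_eq_0[THEN iffD2])
qed

text \<open>A vanishing integral for all test fields g says that, for every j, the sum over i of the
  derivatives d_i of T_ij is 0 in the weak sense.\<close>

definition wdiv :: "('n::finite \<Rightarrow> 'n \<Rightarrow> complex ^ 'n \<Rightarrow> complex) \<Rightarrow> ('n \<Rightarrow> complex ^ 'n \<Rightarrow> complex) \<Rightarrow> complex ^ 'n \<Rightarrow> complex" where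
  "wdiv T g x = (\<Sum>i\<in>UNIV. \<Sum>j\<in>UNIV. dz i (g j) x * T i j x)"

lemma integrable_wdiv:
  assumes "\<And>j. C1c K (g j)" "compact K" "K \<subseteq> S" "open S" "\<And>i j. continuous_on S (T i j)"
  shows "integrable lborel (wdiv T g)"
  unfolding wdiv_def by (intro Bochner_Integration.integrable_sum C1c_integrable_dz_mult[OF assms])

text \<open>Second derivatives are going to fall on the test field, so C^2 fields are treated first.
  Mollifying within a slightly larger compact subset \<open>K'\<close> of \<open>S\<close> costs at
  most e times the integral of the absolute values of T over \<open>K'\<close>.\<close>

lemma weak_div_density:
  fixes T :: "'n::finite \<Rightarrow> 'n \<Rightarrow> complex ^ 'n \<Rightarrow> complex"
  assumes K: "compact K" "K \<subseteq> S" "open S" and T: "\<And>i j. continuous_on S (T i j)"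
    and H: "\<And>K' g. compact K' \<Longrightarrow> K' \<subseteq> S \<Longrightarrow> (\<And>j. C2c K' (g j)) \<Longrightarrow> (LINT x|lborel. wdiv T g x) = 0"
    and g: "\<And>j. C1c K (g j)"
  shows "(LINT x|lborel. wdiv T g x) = 0"
proof -
  obtain r where r: "0 < r" "(\<Union>x\<in>K. ball x r) \<subseteq> S"
    using compact_subset_open_imp_ball_epsilon_subset[OF K(1,3,2)] by blast
  define K' where "K' = {a + b |a b. a \<in> K \<and> b \<in> cball (0 :: complex ^ 'n) (r / 2)}"
  have K': "compact K'"
    unfolding K'_def by (intro compact_sums K compact_cball)
  have K'S: "K' \<subseteq> S"
  proof
    fix x assume "x \<in> K'"
    then obtain a b where ab: "x = a + b" "a \<in> K" "norm b \<le> r / 2" by (auto simp: K'_def)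
    then have "x \<in> ball a r" using r(1) by (simp add: dist_norm)
    then show "x \<in> S" using r(2) ab(2) by blast
  qed
  have KK': "K \<subseteq> K'"
  proof
    fix x assume "x \<in> K"
    then show "x \<in> K'" using r(1) unfolding K'_def by (intro CollectI exI[of _ x] exI[of _ 0]) auto
  qed
  define b where "b = (\<lambda>x. \<Sum>i\<in>UNIV. \<Sum>j\<in>UNIV. norm (indicator K' x *\<^sub>R T i j x))"
  have b_int: "integrable lborel b"
    unfolding b_def
    by (intro Bochner_Integration.integrable_sum integrable_norm borel_integrable_compact K' continuous_on_subset[OF T K'S])
  define B where "B = (LINT x|lborel. b x)"
  have B: "0 \<le> B"
    unfolding B_def b_def by (intro Bochner_Integration.integral_nonneg sum_nonneg norm_ge_zero)
  have est: "cmod (LINT x|lborel. wdiv T g x) \<le> e * B" if e: "0 < e" for e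
  proof -
    \<comment> \<open>The directions that occur in \<open>dz\<close>.\<close>
    define V where "V = range (\<lambda>i::'n. axis i (1::complex)) \<union> range (\<lambda>i. axis i \<i>)"
    have "\<exists>h. C2c K' h \<and> (\<forall>v\<in>V. \<forall>x. cmod (lderiv v h x - lderiv v (g j) x) \<le> e)" for j
    proof -
      have fin: "finite V" by (simp add: V_def)
      have r2: "0 < r / 2" using r(1) by simp
      show ?thesis
      proof (rule C2c_approx[OF g[of j] K(1) r2 e fin])
        fix h assume 1: "C2c {a + b |a b. a \<in> K \<and> b \<in> cball 0 (r / 2)} h"
          and 2: "\<And>v x. v \<in> V \<Longrightarrow> cmod (lderiv v h x - lderiv v (g j) x) \<le> e"
        show ?thesis
          by (intro exI[of _ h] conjI ballI allI 2) (simp_all only: K'_def 1)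
      qed
    qed
    then have "\<forall>j. \<exists>h. C2c K' h \<and> (\<forall>v\<in>V. \<forall>x. cmod (lderiv v h x - lderiv v (g j) x) \<le> e)"
      by (rule allI)
    from choice[OF this] obtain h where h': "\<forall>j. C2c K' (h j) \<and> (\<forall>v\<in>V. \<forall>x. cmod (lderiv v (h j) x - lderiv v (g j) x) \<le> e)"
      by (elim exE)
    have h: "C2c K' (h j)" "v \<in> V \<Longrightarrow> cmod (lderiv v (h j) x - lderiv v (g j) x) \<le> e" for j v x
      using h' by simp_all
    have h1: "C1c K' (h j)" for j using h(1) by (simp add: C2c_def)
    have g1: "C1c K' (g j)" for j by (rule C1c_mono[OF g KK'])
    have dzd: "cmod (dz i (g j) x - dz i (h j) x) \<le> e" for i j x
    proof -
      have "dz i (g j) x - dz i (h j) x = (1 / 2) * (lderiv (axis i 1) (g j) x - lderiv (axis i 1) (h j) x)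
        + (- \<i> / 2) * (lderiv (axis i \<i>) (g j) x - lderiv (axis i \<i>) (h j) x)"
        by (simp add: dz_def algebra_simps)
      then have "cmod (dz i (g j) x - dz i (h j) x) \<le> (1 / 2) * cmod (lderiv (axis i 1) (g j) x - lderiv (axis i 1) (h j) x)
        + (1 / 2) * cmod (lderiv (axis i \<i>) (g j) x - lderiv (axis i \<i>) (h j) x)"
        by (simp only:) (rule order_trans[OF norm_triangle_ineq], simp add: norm_mult norm_divide)
      also have "\<dots> \<le> (1 / 2) * e + (1 / 2) * e"
        using h(2)[of "axis i 1" j x] h(2)[of "axis i \<i>" j x]
        by (intro add_mono mult_left_mono) (auto simp: V_def norm_minus_commute)
      finally show ?thesis by simp
    qed
    have point: "cmod (wdiv T g x - wdiv T h x) \<le> e * b x" for x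
    proof -
      have "wdiv T g x - wdiv T h x = (\<Sum>i\<in>UNIV. \<Sum>j\<in>UNIV. (dz i (g j) x - dz i (h j) x) * T i j x)"
        by (simp add: wdiv_def sum_subtractf left_diff_distrib)
      also have "cmod \<dots> \<le> (\<Sum>i\<in>UNIV. \<Sum>j\<in>UNIV. cmod ((dz i (g j) x - dz i (h j) x) * T i j x))"
        by (rule order_trans[OF norm_sum]) (intro sum_mono norm_sum)
      also have "\<dots> \<le> (\<Sum>i\<in>UNIV. \<Sum>j\<in>UNIV. e * norm (indicator K' x *\<^sub>R T i j x))"
      proof (intro sum_mono)
        fix i j
        show "cmod ((dz i (g j) x - dz i (h j) x) * T i j x) \<le> e * norm (indicator K' x *\<^sub>R T i j x)"
        proof (cases "x \<in> K'")
          case True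
          then show ?thesis by (simp add: norm_mult mult_right_mono dzd)
        next
          case False
          then show ?thesis
            by (simp add: C1c_dz_eq_0[OF g1 compact_imp_closed[OF K']] C1c_dz_eq_0[OF h1 compact_imp_closed[OF K']])
        qed
      qed
      finally show ?thesis unfolding b_def sum_distrib_left .
    qed
    have ig: "integrable lborel (wdiv T g)" by (rule integrable_wdiv[OF g1 K' K'S K(3) T])
    have ih: "integrable lborel (wdiv T h)" by (rule integrable_wdiv[OF h1 K' K'S K(3) T])
    have "(LINT x|lborel. wdiv T h x) = 0"
      by (rule H[OF K' K'S h(1)])
    then have "(LINT x|lborel. wdiv T g x) = (LINT x|lborel. wdiv T g x - wdiv T h x)"
      by (simp add: Bochner_Integration.integral_diff[OF ig ih])
    also have "cmod \<dots> \<le> (LINT x|lborel. cmod (wdiv T g x - wdiv T h x))"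
      by (rule integral_norm_bound)
    also have "\<dots> \<le> (LINT x|lborel. e * b x)"
      by (rule Bochner_Integration.integral_mono)
        (auto intro!: integrable_norm Bochner_Integration.integrable_diff ig ih b_int point)
    finally show ?thesis by (simp add: B_def)
  qed
  have "cmod (LINT x|lborel. wdiv T g x) \<le> 0 + e" if "0 < e" for e
  proof -
    \<comment> \<open>\<open>B\<close> may be 0, so the division is by \<open>B + 1\<close>.\<close>
    have "cmod (LINT x|lborel. wdiv T g x) \<le> e / (B + 1) * B"
      by (rule est) (use that B in simp)
    also have "\<dots> = e * (B / (B + 1))" by simp
    also have "\<dots> \<le> e * 1"
      using that B by (intro mult_left_mono) auto
    finally show ?thesis by simp
  qed
  then have "cmod (LINT x|lborel. wdiv T g x) \<le> 0"
    by (rule field_le_epsilon)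
  then show ?thesis by simp
qed

text \<open>The rows of the linearized operator are divergence free. Since the functions are only of
  class \<open>C\<^sup>2\<close>, this is stated weakly and proved by moving one derivative at a time off the Hessians
  onto the test field, where the antisymmetry of the mixed discriminant kills the second
  derivatives.\<close>

lemma weak_div_polar:
  fixes g :: "'n::finite \<Rightarrow> complex ^ 'n \<Rightarrow> complex"
  assumes "open S" "Suc (length ws + length cs) = CARD('n)" "\<And>w. w \<in> set ws \<Longrightarrow> C2on S w"
    "compact K" "K \<subseteq> S" "\<And>j. C1c K (g j)"
  shows "(LINT x|lborel. wdiv (\<lambda>i j x. polar_det (unit_cmat i j # map (\<lambda>w. lhess w x) ws @ cs)) g x) = 0"
  using assms(2-)
proof (induction ws arbitrary: cs K g)
  case Nil
  have i: "integrable lborel (\<lambda>x. dz i (g j) x * c)" for i j c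
    by (rule C1c_integrable_dz_mult[OF Nil(5,3,4) assms(1)]) simp
  show ?case
    unfolding wdiv_def
    by (simp add: Bochner_Integration.integral_sum Bochner_Integration.integrable_sum i integral_dz_eq_0[OF Nil(5,3)])
next
  case (Cons w ws)
  let ?T = "\<lambda>i j x. polar_det (unit_cmat i j # map (\<lambda>w. lhess w x) (w # ws) @ cs)"
  have len: "Suc (length (w # ws) + length cs) = CARD('n)" by (rule Cons.prems(1))
  have w: "C2on S w" and ws: "\<And>w. w \<in> set ws \<Longrightarrow> C2on S w"
    using Cons.prems(2) by auto
  have T: "continuous_on S (?T i j)" for i j
    by (rule continuous_on_polar_lhess[OF _ Cons.prems(2) len]) auto
  show ?case
  proof (rule weak_div_density[OF Cons.prems(3,4) assms(1) T _ Cons.prems(5)])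
    fix K' and h :: "'n \<Rightarrow> complex ^ 'n \<Rightarrow> complex"
    assume K': "compact K'" "K' \<subseteq> S" and h: "\<And>j. C2c K' (h j)"
    have h1: "C1c K' (h j)" "C1c K' (lderiv v (h j))" for j v
      using h by (auto simp: C2c_def)
    have dzh: "C1c K' (dz i (h j))" for i j
      by (rule C1c_dz(1)[OF h1 compact_imp_closed[OF K'(1)]])
    \<comment> \<open>The free slot, at the constant matrix \<open>unit_cmat i j\<close>, joins
      \<open>cs\<close>, and the slot that held the Hessian of \<open>w\<close> becomes the free
      one. The induction hypothesis then applies with the test field \<open>G i j\<close>, whose
      derivative consists of a second derivative of h times \<open>dzb b w\<close> and of
      \<open>dz i (h j)\<close> times the Hessian of \<open>w\<close>.\<close>
    define Q where "Q = (\<lambda>a b i j x. polar_det (unit_cmat a b # map (\<lambda>w. lhess w x) ws @ unit_cmat i j # cs))"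
    define G where "G = (\<lambda>i j b x. dz i (h j) x * dzb b w x)"
    have G: "C1c K' (G i j b)" for i j b
      unfolding G_def by (rule C1c_mult(1)[OF dzh C1on_dzb[OF w] compact_imp_closed[OF K'(1)] K'(2) assms(1)])
    have dG: "dz a (G i j b) x = dz a (dz i (h j)) x * dzb b w x + dz i (h j) x * dz a (dzb b w) x" for a b i j x
      unfolding G_def by (rule dz_mult_C1c[OF dzh C1on_dzb[OF w] compact_imp_closed[OF K'(1)] K'(2) assms(1)])
    have Qc: "continuous_on S (Q a b i j)" for a b i j
      unfolding Q_def by (rule continuous_on_polar_lhess[OF _ ws]) (use len in auto)
    have IH: "(LINT x|lborel. wdiv (\<lambda>a b. Q a b i j) (G i j) x) = 0" for i j
      unfolding Q_def by (rule Cons.IH[OF _ ws K' G]) (use len in auto)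
    have Gi: "integrable lborel (wdiv (\<lambda>a b. Q a b i j) (G i j))" for i j
      by (rule integrable_wdiv[OF G K' assms(1) Qc])
    have Qswap: "Q a b i j x = - Q i b a j x" for a b i j x
    proof -
      have "Q a b i j x = polar_det (unit_cmat a b # unit_cmat i j # map (\<lambda>w. lhess w x) ws @ cs)" for a b i j
        unfolding Q_def by (rule cform_sym[OF cform_polar_det]) (use len in auto)
      then show ?thesis
        using polar_det_unit_swap[of "map (\<lambda>w. lhess w x) ws @ cs" a b i j] len by simp
    qed
    have expand: "wdiv ?T h x = (\<Sum>i\<in>UNIV. \<Sum>j\<in>UNIV. wdiv (\<lambda>a b. Q a b i j) (G i j) x)" for x
    proof -
      have "wdiv (\<lambda>a b. Q a b i j) (G i j) x =
          (\<Sum>a\<in>UNIV. \<Sum>b\<in>UNIV. dz a (dz i (h j)) x * dzb b w x * Q a b i j x) +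
          dz i (h j) x * ?T i j x" for i j
      proof -
        have "wdiv (\<lambda>a b. Q a b i j) (G i j) x =
          (\<Sum>a\<in>UNIV. \<Sum>b\<in>UNIV. dz a (dz i (h j)) x * dzb b w x * Q a b i j x) +
          dz i (h j) x * (\<Sum>a\<in>UNIV. \<Sum>b\<in>UNIV. lhess w x $ a $ b * Q a b i j x)"
          unfolding wdiv_def dG
          by (simp add: lhess_def sum.distrib sum_distrib_left algebra_simps)
        also have "(\<Sum>a\<in>UNIV. \<Sum>b\<in>UNIV. lhess w x $ a $ b * Q a b i j x) =
            polar_det (lhess w x # map (\<lambda>w. lhess w x) ws @ unit_cmat i j # cs)"
          unfolding Q_def by (rule cform_head_expand[OF cform_polar_det, symmetric]) (use len in simp)
        also have "\<dots> = ?T i j x"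
          by (rule cform_sym[OF cform_polar_det]) (use len in auto)
        finally show ?thesis .
      qed
      \<comment> \<open>The second derivative is symmetric in a and i while \<open>Q\<close> changes
        sign, so the sum equals its own negative.\<close>
      moreover have "(\<Sum>i\<in>UNIV. \<Sum>j\<in>UNIV. \<Sum>a\<in>UNIV. \<Sum>b\<in>UNIV. dz a (dz i (h j)) x * dzb b w x * Q a b i j x) = 0"
        (is "?S = 0")
      proof -
        have "?S = (\<Sum>j\<in>UNIV. \<Sum>i\<in>UNIV. \<Sum>a\<in>UNIV. \<Sum>b\<in>UNIV. dz a (dz i (h j)) x * dzb b w x * Q a b i j x)"
          by (rule sum.swap)
        also have "\<dots> = (\<Sum>j\<in>UNIV. \<Sum>a\<in>UNIV. \<Sum>i\<in>UNIV. \<Sum>b\<in>UNIV. dz a (dz i (h j)) x * dzb b w x * Q a b i j x)"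
          by (rule sum.cong[OF refl], rule sum.swap)
        also have "\<dots> = (\<Sum>j\<in>UNIV. \<Sum>a\<in>UNIV. \<Sum>i\<in>UNIV. \<Sum>b\<in>UNIV. - (dz i (dz a (h j)) x * dzb b w x * Q i b a j x))"
        proof (intro sum.cong refl)
          fix j a i b
          show "dz a (dz i (h j)) x * dzb b w x * Q a b i j x = - (dz i (dz a (h j)) x * dzb b w x * Q i b a j x)"
            unfolding dz_commute[OF h, of a i] Qswap[of a b i j x] by simp
        qed
        also have "\<dots> = - (\<Sum>j\<in>UNIV. \<Sum>i\<in>UNIV. \<Sum>a\<in>UNIV. \<Sum>b\<in>UNIV. dz a (dz i (h j)) x * dzb b w x * Q a b i j x)"
          by (simp add: sum_negf)
        also have "(\<Sum>j\<in>UNIV. \<Sum>i\<in>UNIV. \<Sum>a\<in>UNIV. \<Sum>b\<in>UNIV. dz a (dz i (h j)) x * dzb b w x * Q a b i j x) = ?S"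
          by (rule sum.swap)
        finally show ?thesis by simp
      qed
      ultimately show ?thesis
        by (simp add: wdiv_def sum.distrib)
    qed
    show "(LINT x|lborel. wdiv ?T h x) = 0"
      unfolding expand
      by (simp add: Bochner_Integration.integral_sum Bochner_Integration.integrable_sum Gi IH)
  qed
qed

section \<open>Integration by parts for the Hessian form\<close>

lemma outer_expand_polar:
  fixes xs :: "('n::finite) cmat list"
  assumes "Suc (length xs) = CARD('n)"
  shows "(\<Sum>i\<in>UNIV. \<Sum>j\<in>UNIV. (p i * q j) * polar_det (unit_cmat i j # xs)) =
    polar_det (outer (\<chi> i. p i) (\<chi> j. q j) # xs)"
  using cform_head_expand[OF cform_polar_det assms, of "outer (\<chi> i. p i) (\<chi> j. q j)"]
  by (simp add: outer_def)

definition grad_form ::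
    "(complex ^ 'n \<Rightarrow> complex) \<Rightarrow> (complex ^ 'n \<Rightarrow> complex) \<Rightarrow> (complex ^ 'n \<Rightarrow> complex) list \<Rightarrow> 'n cmat list \<Rightarrow>
      complex ^ 'n::finite \<Rightarrow> complex" where
  "grad_form f v ws cs x = polar_det (outer (\<chi> i. dz i f x) (\<chi> j. dzb j v x) # map (\<lambda>w. lhess w x) ws @ cs)"

definition hess_form ::
    "(complex ^ 'n \<Rightarrow> complex) \<Rightarrow> (complex ^ 'n \<Rightarrow> complex) list \<Rightarrow> 'n cmat list \<Rightarrow> complex ^ 'n::finite \<Rightarrow> complex" where
  "hess_form v ws cs x = polar_det (lhess v x # map (\<lambda>w. lhess w x) ws @ cs)"

text \<open>The weak divergence identity is applied to the field f times \<open>dzb j v\<close>; the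
  product rule splits it into the gradient form and f times the Hessian form. Here the
  undifferentiated factor has compact support.\<close>

lemma ibp_cutoff:
  fixes f v :: "complex ^ 'n::finite \<Rightarrow> complex"
  assumes S: "open S" "compact K" "K \<subseteq> S" and len: "Suc (length ws + length cs) = CARD('n)"
    and ws: "\<And>w. w \<in> set ws \<Longrightarrow> C2on S w" and f: "C1c K f" and v: "C2on S v"
  shows "(LINT x|lborel. f x * hess_form v ws cs x) = - (LINT x|lborel. grad_form f v ws cs x)"
    "integrable lborel (grad_form f v ws cs)"
proof -
  let ?U = "\<lambda>i j x. polar_det (unit_cmat i j # map (\<lambda>w. lhess w x) ws @ cs)"
  let ?g = "\<lambda>j x. f x * dzb j v x"
  have len': "Suc (length (map (\<lambda>w. lhess w x) ws @ cs)) = CARD('n)" for x using len by simp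
  have U: "continuous_on S (?U i j)" for i j
    by (rule continuous_on_polar_lhess[OF _ ws len]) auto
  have g: "C1c K (?g j)" for j
    by (rule C1c_mult(1)[OF f C1on_dzb[OF v] compact_imp_closed[OF S(2)] S(3,1)])
  have z: "(LINT x|lborel. wdiv ?U ?g x) = 0"
    by (rule weak_div_polar[OF S(1) len ws S(2,3) g])
  have eq: "wdiv ?U ?g x = grad_form f v ws cs x + f x * hess_form v ws cs x" for x
  proof -
    have "wdiv ?U ?g x = (\<Sum>i\<in>UNIV. \<Sum>j\<in>UNIV. (dz i f x * dzb j v x) * ?U i j x) +
        f x * (\<Sum>i\<in>UNIV. \<Sum>j\<in>UNIV. lhess v x $ i $ j * ?U i j x)"
      unfolding wdiv_def dz_mult_C1c[OF f C1on_dzb[OF v] compact_imp_closed[OF S(2)] S(3,1)]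
      by (simp add: lhess_def sum.distrib sum_distrib_left algebra_simps)
    then show ?thesis
      by (simp only: outer_expand_polar[OF len'] cform_head_expand[OF cform_polar_det len', symmetric]
          grad_form_def hess_form_def)
  qed
  have i1: "integrable lborel (\<lambda>x. f x * hess_form v ws cs x)"
  proof (rule integrable_cutoff_mult[OF C1cD(1)[OF f] C1cD(4)[OF f] S(2,3,1)])
    show "continuous_on S (hess_form v ws cs)"
      unfolding hess_form_def by (rule continuous_on_polar_lhess[OF continuous_on_lhess[OF v] ws len])
  qed
  have "integrable lborel (\<lambda>x. wdiv ?U ?g x - f x * hess_form v ws cs x)"
    by (rule Bochner_Integration.integrable_diff[OF integrable_wdiv[OF g S(2,3,1) U] i1])
  then show i2: "integrable lborel (grad_form f v ws cs)"
    by (simp add: eq)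
  show "(LINT x|lborel. f x * hess_form v ws cs x) = - (LINT x|lborel. grad_form f v ws cs x)"
    using z unfolding eq Bochner_Integration.integral_add[OF i2 i1]
    by (simp add: add_eq_0_iff2)
qed

text \<open>The counterpart with the field v times \<open>dzb j f\<close>: the compact support now
  comes from the function under the Hessian, and \<open>v\<close> is merely C^1. The two versions
  together let the Hessian change from one function to the other.\<close>

lemma ibp_test:
  fixes f v :: "complex ^ 'n::finite \<Rightarrow> complex"
  assumes S: "open S" "compact K" "K \<subseteq> S" and len: "Suc (length ws + length cs) = CARD('n)"
    and ws: "\<And>w. w \<in> set ws \<Longrightarrow> C2on S w" and f: "C1c K f" "\<And>v. C1c K (lderiv v f)" and v: "C1on S v"
  shows "(LINT x|lborel. v x * hess_form f ws cs x) = - (LINT x|lborel. grad_form v f ws cs x)"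
    "integrable lborel (grad_form v f ws cs)"
proof -
  let ?U = "\<lambda>i j x. polar_det (unit_cmat i j # map (\<lambda>w. lhess w x) ws @ cs)"
  let ?g = "\<lambda>j x. dzb j f x * v x"
  have len': "Suc (length (map (\<lambda>w. lhess w x) ws @ cs)) = CARD('n)" for x using len by simp
  note cl = compact_imp_closed[OF S(2)]
  have U: "continuous_on S (?U i j)" for i j
    by (rule continuous_on_polar_lhess[OF _ ws len]) auto
  have fb: "C1c K (dzb j f)" for j by (rule C1c_dz(2)[OF f cl])
  have g: "C1c K (?g j)" for j
    by (rule C1c_mult(1)[OF fb v cl S(3,1)])
  have z: "(LINT x|lborel. wdiv ?U ?g x) = 0"
    by (rule weak_div_polar[OF S(1) len ws S(2,3) g])
  have eq: "wdiv ?U ?g x = grad_form v f ws cs x + v x * hess_form f ws cs x" for x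
  proof -
    have "wdiv ?U ?g x = (\<Sum>i\<in>UNIV. \<Sum>j\<in>UNIV. (dz i v x * dzb j f x) * ?U i j x) +
        v x * (\<Sum>i\<in>UNIV. \<Sum>j\<in>UNIV. lhess f x $ i $ j * ?U i j x)"
      unfolding wdiv_def dz_mult_C1c[OF fb v cl S(3,1)]
      by (simp add: lhess_def sum.distrib sum_distrib_left algebra_simps)
    then show ?thesis
      by (simp only: outer_expand_polar[OF len'] cform_head_expand[OF cform_polar_det len', symmetric]
          grad_form_def hess_form_def)
  qed
  have i1: "integrable lborel (\<lambda>x. v x * hess_form f ws cs x)"
  proof -
    have "integrable lborel (\<lambda>x. dz i (dzb j f) x * (v x * ?U i j x))" for i j
      by (rule C1c_integrable_dz_mult[OF fb S(2,3,1)]) (intro continuous_on_mult C1onD(1)[OF v] U)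
    then have "integrable lborel (\<lambda>x. \<Sum>i\<in>UNIV. \<Sum>j\<in>UNIV. dz i (dzb j f) x * (v x * ?U i j x))"
      by (intro Bochner_Integration.integrable_sum)
    moreover have "v x * hess_form f ws cs x = (\<Sum>i\<in>UNIV. \<Sum>j\<in>UNIV. dz i (dzb j f) x * (v x * ?U i j x))" for x
    proof -
      have "hess_form f ws cs x = (\<Sum>i\<in>UNIV. \<Sum>j\<in>UNIV. lhess f x $ i $ j * ?U i j x)"
        unfolding hess_form_def by (rule cform_head_expand[OF cform_polar_det len'])
      then show ?thesis
        by (simp add: lhess_def sum_distrib_left mult_ac)
    qed
    ultimately show ?thesis by simp
  qed
  have "integrable lborel (\<lambda>x. wdiv ?U ?g x - v x * hess_form f ws cs x)"
    by (rule Bochner_Integration.integrable_diff[OF integrable_wdiv[OF g S(2,3,1) U] i1])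
  then show i2: "integrable lborel (grad_form v f ws cs)"
    by (simp add: eq)
  show "(LINT x|lborel. v x * hess_form f ws cs x) = - (LINT x|lborel. grad_form v f ws cs x)"
    using z unfolding eq Bochner_Integration.integral_add[OF i2 i1]
    by (simp add: add_eq_0_iff2)
qed

subsection \<open>A truncation of the identity vanishing near the origin\<close>

text \<open>For s > 0 this is s^3 / (1 + s^2). It is C^2 across 0, stays within distance 1 of the
  positive part, and its derivative is bounded and tends to 1, all by elementary estimates.\<close>

definition ramp :: "real \<Rightarrow> real" where
  "ramp s = s * (max 0 s)\<^sup>2 / (1 + (max 0 s)\<^sup>2)"

definition ramp' :: "real \<Rightarrow> real" where
  "ramp' s = (3 * (max 0 s)\<^sup>2 + ((max 0 s)\<^sup>2)\<^sup>2) / (1 + (max 0 s)\<^sup>2)\<^sup>2"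

definition ramp'' :: "real \<Rightarrow> real" where
  "ramp'' s = ((3 + 2 * (max 0 s)\<^sup>2) * (1 + (max 0 s)\<^sup>2) - 2 * (3 * (max 0 s)\<^sup>2 + ((max 0 s)\<^sup>2)\<^sup>2)) * (2 * max 0 s)
     / (1 + (max 0 s)\<^sup>2) ^ 3"

lemma one_plus_square_pos: "0 < 1 + (x::real)\<^sup>2"
  by (rule add_pos_nonneg) auto

lemma ramp_deriv: "(ramp has_real_derivative ramp' s) (at s)"
proof -
  let ?q = "(max 0 s)\<^sup>2" and ?m = "max 0 s"
  have "((\<lambda>s. s * (max 0 s)\<^sup>2) has_real_derivative (1 * ?q + (2 * ?m) * s)) (at s)"
    by (rule DERIV_mult[OF DERIV_ident max_0_power2_deriv])
  moreover have "((\<lambda>s. 1 + (max 0 s)\<^sup>2) has_real_derivative (0 + 2 * ?m)) (at s)"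
    by (rule DERIV_add[OF DERIV_const max_0_power2_deriv])
  ultimately have "((\<lambda>s. s * (max 0 s)\<^sup>2 / (1 + (max 0 s)\<^sup>2)) has_real_derivative
     ((1 * ?q + (2 * ?m) * s) * (1 + ?q) - (s * ?q) * (0 + 2 * ?m)) / ((1 + ?q) * (1 + ?q))) (at s)"
    by (rule DERIV_divide) (use one_plus_square_pos[of ?m] in simp)
  moreover have "((1 * ?q + (2 * ?m) * s) * (1 + ?q) - (s * ?q) * (0 + 2 * ?m)) / ((1 + ?q) * (1 + ?q)) = ramp' s"
  proof -
    have "?m * s = ?q" by (simp add: max_def power2_eq_square)
    then have "(1 * ?q + (2 * ?m) * s) * (1 + ?q) - (s * ?q) * (0 + 2 * ?m) = (1 * ?q + 2 * ?q) * (1 + ?q) - 2 * (?q * ?q)"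
      by (simp add: mult.assoc mult.left_commute[of s] mult.commute[of s])
    also have "\<dots> = 3 * ?q + ?q\<^sup>2" by (simp add: power2_eq_square[of "?q"] algebra_simps)
    finally show ?thesis by (simp add: ramp'_def power2_eq_square[of "1 + ?q"])
  qed
  ultimately show ?thesis by (simp add: ramp_def[abs_def])
qed

lemma ramp'_deriv: "(ramp' has_real_derivative ramp'' s) (at s)"
proof -
  let ?q = "(max 0 s)\<^sup>2" and ?m = "max 0 s"
  have pos: "1 + ?q \<noteq> 0" using one_plus_square_pos[of ?m] by simp
  have "((\<lambda>q::real. (3 * q + q\<^sup>2) / (1 + q)\<^sup>2) has_real_derivative
     ((3 + 2 * ?q) * (1 + ?q) - 2 * (3 * ?q + ?q\<^sup>2)) / (1 + ?q) ^ 3) (at ?q)"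
  proof -
    have "((\<lambda>q::real. (3 * q + q\<^sup>2) / (1 + q)\<^sup>2) has_real_derivative
      ((3 + 2 * ?q) * (1 + ?q)\<^sup>2 - (3 * ?q + ?q\<^sup>2) * (2 * (1 + ?q))) / ((1 + ?q)\<^sup>2 * (1 + ?q)\<^sup>2)) (at ?q)"
      by (rule DERIV_divide) (use pos in \<open>auto intro!: derivative_eq_intros\<close>)
    moreover have eqn: "((3 + 2 * q) * (1 + q)\<^sup>2 - (3 * q + q\<^sup>2) * (2 * (1 + q))) / ((1 + q)\<^sup>2 * (1 + q)\<^sup>2)
      = ((3 + 2 * q) * (1 + q) - 2 * (3 * q + q\<^sup>2)) / (1 + q) ^ 3" if "1 + q \<noteq> 0" for q :: real
    proof -
      have "((3 + 2 * q) * (1 + q)\<^sup>2 - (3 * q + q\<^sup>2) * (2 * (1 + q))) = ((3 + 2 * q) * (1 + q) - 2 * (3 * q + q\<^sup>2)) * (1 + q)"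
        by (simp add: power2_eq_square algebra_simps)
      moreover have "(1 + q)\<^sup>2 * (1 + q)\<^sup>2 = (1 + q) ^ 3 * (1 + q)"
        by (simp add: power2_eq_square power3_eq_cube mult.assoc)
      ultimately show ?thesis
        using that by simp
    qed
    ultimately show ?thesis by (simp only: eqn[OF pos])
  qed
  from DERIV_chain2[OF this max_0_power2_deriv]
  show ?thesis
    by (simp add: ramp'_def[abs_def] ramp''_def)
qed

lemma ramp''_continuous: "continuous_on UNIV ramp''"
  unfolding ramp''_def by (intro continuous_intros) (use one_plus_square_pos in \<open>auto simp: less_imp_neq[symmetric]\<close>)

lemma ramp_bound: "\<bar>ramp s - max 0 s\<bar> \<le> 1"
proof -
  let ?m = "max 0 s"
  have "s * ?m\<^sup>2 = ?m * ?m\<^sup>2" by (simp add: max_def)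
  then have "ramp s = ?m * ?m\<^sup>2 / (1 + ?m\<^sup>2)"
    by (simp only: ramp_def)
  also have "\<dots> = ?m - ?m / (1 + ?m\<^sup>2)"
    using one_plus_square_pos[of ?m] by (simp add: field_simps)
  finally have "\<bar>ramp s - ?m\<bar> = ?m / (1 + ?m\<^sup>2)"
    using one_plus_square_pos[of ?m] by simp
  moreover have "?m \<le> 1 + ?m\<^sup>2"
  proof -
    have "0 \<le> (?m - 1)\<^sup>2" by simp
    then show ?thesis by (simp only: power2_diff) (use zero_le_power2[of ?m] in \<open>simp add: max_def split: if_splits\<close>)
  qed
  ultimately show ?thesis
    using one_plus_square_pos[of ?m] by simp
qed

lemma ramp'_bounds: "0 \<le> ramp' s" "ramp' s \<le> 3" "s \<le> 0 \<Longrightarrow> ramp' s = 0" "s \<le> 0 \<Longrightarrow> ramp s = 0"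
proof -
  let ?q = "(max 0 s)\<^sup>2"
  show "0 \<le> ramp' s" by (simp add: ramp'_def)
  have "3 * ?q + ?q\<^sup>2 \<le> 3 * (1 + ?q)\<^sup>2"
    by (simp add: power2_sum)
  then show "ramp' s \<le> 3"
    using one_plus_square_pos[of "max 0 s"] by (simp add: ramp'_def divide_le_eq)
qed (simp_all add: ramp'_def ramp_def max_def)

lemma ramp'_near_1:
  assumes "0 < s"
  shows "\<bar>ramp' (s - 1) - 1\<bar> \<le> 4 / s"
proof (cases "s \<le> 1")
  case True
  then show ?thesis using assms ramp'_bounds(3)[of "s - 1"] by (simp add: field_simps)
next
  case False
  define q where "q = (max 0 (s - 1))\<^sup>2"
  have q: "q = (s - 1)\<^sup>2" using False by (simp add: q_def max_def)
  have q0: "0 \<le> q" by (simp add: q_def)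
  have pos: "0 < (1 + q)\<^sup>2" using q0 by simp
  have "ramp' (s - 1) - 1 = (q - 1) / (1 + q)\<^sup>2"
    unfolding ramp'_def q_def[symmetric] using pos by (simp add: field_simps power2_eq_square)
  then have "\<bar>ramp' (s - 1) - 1\<bar> = \<bar>q - 1\<bar> / (1 + q)\<^sup>2"
    by simp
  also have "\<dots> \<le> (1 + q) / (1 + q)\<^sup>2"
    by (rule divide_right_mono) (use q0 in auto)
  also have "\<dots> = 1 / (1 + q)"
    using q0 by (simp add: power2_eq_square)
  also have "\<dots> \<le> 1 / (s / 4)"
  proof (rule divide_left_mono)
    \<comment> \<open>Completing the square: 1 + (s - 1)^2 - s / 4 = (s - 9/8)^2 + 47/64.\<close>
    have "0 \<le> (s - 9/8)\<^sup>2" by simp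
    then show "s / 4 \<le> 1 + q"
      unfolding q by (simp add: power2_eq_square algebra_simps)
    show "0 < (1 + q) * (s / 4)" using q0 assms by simp
  qed simp
  finally show ?thesis by simp
qed

text \<open>The shift by 1 inside the ramps creates a dead zone of radius 1 / (n + 1) around 0,
  which will give the truncated functions compact support. The rescaling makes the distance to the
  identity of order 1 / n, while the derivative keeps a bound independent of n and tends to 1 away
  from 0.\<close>

definition trunc :: "nat \<Rightarrow> real \<Rightarrow> real" where
  "trunc n t = (ramp (real (Suc n) * t - 1) - ramp (- (real (Suc n) * t) - 1)) / real (Suc n)"

definition trunc' :: "nat \<Rightarrow> real \<Rightarrow> real" where
  "trunc' n t = ramp' (real (Suc n) * t - 1) + ramp' (- (real (Suc n) * t) - 1)"

definition trunc'' :: "nat \<Rightarrow> real \<Rightarrow> real" where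
  "trunc'' n t = (ramp'' (real (Suc n) * t - 1) - ramp'' (- (real (Suc n) * t) - 1)) * real (Suc n)"

lemma trunc_deriv: "(trunc n has_real_derivative trunc' n t) (at t)"
proof -
  let ?N = "real (Suc n)"
  have 1: "((\<lambda>t. ?N * t - 1) has_real_derivative ?N) (at t)" "((\<lambda>t. - (?N * t) - 1) has_real_derivative - ?N) (at t)"
    by (auto intro!: derivative_eq_intros)
  have "((\<lambda>t. (ramp (?N * t - 1) - ramp (- (?N * t) - 1)) / ?N) has_real_derivative
     (ramp' (?N * t - 1) * ?N - ramp' (- (?N * t) - 1) * (- ?N)) / ?N) (at t)"
    by (intro DERIV_cdivide DERIV_diff DERIV_chain2[OF ramp_deriv 1(1)] DERIV_chain2[OF ramp_deriv 1(2)])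
  moreover have "(a * ?N - b * (- ?N)) / ?N = a + b" for a b
    by (simp add: field_simps del: of_nat_Suc)
  ultimately show ?thesis
    by (simp only: trunc_def[abs_def] trunc'_def)
qed

lemma trunc'_deriv: "(trunc' n has_real_derivative trunc'' n t) (at t)"
proof -
  let ?N = "real (Suc n)"
  have 1: "((\<lambda>t. ?N * t - 1) has_real_derivative ?N) (at t)" "((\<lambda>t. - (?N * t) - 1) has_real_derivative - ?N) (at t)"
    by (auto intro!: derivative_eq_intros)
  have "((\<lambda>t. ramp' (?N * t - 1) + ramp' (- (?N * t) - 1)) has_real_derivative
     (ramp'' (?N * t - 1) * ?N + ramp'' (- (?N * t) - 1) * (- ?N))) (at t)"
    by (intro DERIV_add DERIV_chain2[OF ramp'_deriv 1(1)] DERIV_chain2[OF ramp'_deriv 1(2)])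
  moreover have "a * ?N + b * (- ?N) = (a - b) * ?N" for a b
    by (simp add: algebra_simps del: of_nat_Suc)
  ultimately show ?thesis
    by (simp only: trunc'_def[abs_def] trunc''_def)
qed

lemma trunc''_continuous: "continuous_on UNIV (trunc'' n)"
  unfolding trunc''_def
  by (intro continuous_on_mult continuous_on_diff continuous_on_const
      continuous_on_compose2[OF ramp''_continuous _ subset_UNIV] continuous_intros)

lemma trunc_eq_0: "\<bar>t\<bar> \<le> 1 / real (Suc n) \<Longrightarrow> trunc n t = 0"
proof -
  let ?N = "real (Suc n)"
  assume "\<bar>t\<bar> \<le> 1 / ?N"
  then have "?N * \<bar>t\<bar> \<le> 1" by (simp add: field_simps del: of_nat_Suc)
  then have "\<bar>?N * t\<bar> \<le> 1" by (simp add: abs_mult del: of_nat_Suc)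
  then have "?N * t - 1 \<le> 0" "- (?N * t) - 1 \<le> 0" by linarith+
  then show ?thesis
    unfolding trunc_def by (simp only: ramp'_bounds(4)) simp
qed

lemma trunc_approx: "\<bar>trunc n t - t\<bar> \<le> 3 / real (Suc n)"
proof -
  let ?N = "real (Suc n)"
  let ?s = "?N * t"
  \<comment> \<open>Each ramp errs by at most 1, and the dead zone by at most 1 more.\<close>
  have "\<bar>ramp (?s - 1) - ramp (- ?s - 1) - ?s\<bar> \<le> 3"
    using ramp_bound[of "?s - 1"] ramp_bound[of "- ?s - 1"]
    by (simp only: abs_le_iff max_def split: if_splits; linarith)
  moreover have "trunc n t - t = (ramp (?s - 1) - ramp (- ?s - 1) - ?s) / ?N"
    by (simp add: trunc_def field_simps del: of_nat_Suc)
  ultimately show ?thesis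
    by (simp add: divide_right_mono abs_divide del: of_nat_Suc)
qed

lemma trunc'_bound: "\<bar>trunc' n t\<bar> \<le> 6"
  using ramp'_bounds(1,2) unfolding trunc'_def by (smt (verit))

lemma trunc'_limit: "(\<lambda>n. trunc' n t) \<longlonglongrightarrow> (if t = 0 then 0 else 1)"
proof (cases "t = 0")
  case True
  then show ?thesis by (simp add: trunc'_def ramp'_bounds(3))
next
  case False
  have est: "\<bar>trunc' n t - 1\<bar> \<le> (4 / \<bar>t\<bar>) * (1 / real (Suc n))" for n
  proof -
    let ?N = "real (Suc n)"
    have N: "0 < ?N" by simp
    show ?thesis
    proof (cases "t > 0")
      case True
      then have "\<bar>ramp' (?N * t - 1) - 1\<bar> \<le> 4 / (?N * t)"
        by (intro ramp'_near_1 mult_pos_pos N)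
      moreover have "ramp' (- (?N * t) - 1) = 0"
      proof (rule ramp'_bounds(3))
        have "0 \<le> ?N * t" using True N by (intro mult_nonneg_nonneg) auto
        then show "- (?N * t) - 1 \<le> 0" by linarith
      qed
      moreover have "4 / (?N * t) = (4 / \<bar>t\<bar>) * (1 / ?N)"
        using True by (simp del: of_nat_Suc)
      ultimately show ?thesis
        by (simp only: trunc'_def add_0_right)
    next
      case neg: False
      then have t: "0 < - t" using False by simp
      then have "\<bar>ramp' (?N * (- t) - 1) - 1\<bar> \<le> 4 / (?N * (- t))"
        by (intro ramp'_near_1 mult_pos_pos N)
      moreover have "ramp' (?N * t - 1) = 0"
      proof (rule ramp'_bounds(3))
        have "0 \<le> ?N * (- t)" using t N by (intro mult_nonneg_nonneg) auto
        then show "?N * t - 1 \<le> 0" by simp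
      qed
      moreover have "4 / (?N * (- t)) = (4 / \<bar>t\<bar>) * (1 / ?N)"
        using t by (simp del: of_nat_Suc)
      ultimately show ?thesis
        by (simp only: trunc'_def add_0_left mult_minus_right)
    qed
  qed
  have "(\<lambda>n. (4 / \<bar>t\<bar>) * (1 / real (Suc n))) \<longlonglongrightarrow> (4 / \<bar>t\<bar>) * 0"
    by (intro tendsto_mult tendsto_const LIMSEQ_Suc[OF lim_1_over_n])
  then have lim: "(\<lambda>n. (4 / \<bar>t\<bar>) * (1 / real (Suc n))) \<longlonglongrightarrow> 0"
    by (simp only: mult_zero_right)
  have "(\<lambda>n. trunc' n t - 1) \<longlonglongrightarrow> 0"
  proof (rule Lim_null_comparison[OF _ lim])
    show "\<forall>\<^sub>F n in sequentially. norm (trunc' n t - 1) \<le> (4 / \<bar>t\<bar>) * (1 / real (Suc n))"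
      by (rule always_eventually) (simp only: real_norm_def est simp_thms)
  qed
  then have "(\<lambda>n. trunc' n t) \<longlonglongrightarrow> 1"
    by (simp add: LIM_zero_iff)
  then show ?thesis using False by simp
qed

subsection \<open>Composition of real functions with the truncation\<close>

abbreviation cx :: "('a \<Rightarrow> real) \<Rightarrow> 'a \<Rightarrow> complex" where
  "cx u \<equiv> (\<lambda>x. complex_of_real (u x))"

lemma real_lderiv:
  assumes "has_lderiv v (cx u) d x"
  shows "Im d = 0" "((\<lambda>t. u (x + t *\<^sub>R v)) has_real_derivative Re d) (at 0)"
proof -
  have "((\<lambda>t. Re (cx u (x + t *\<^sub>R v))) has_vector_derivative Re d) (at 0)"
    by (rule bounded_linear.has_vector_derivative[OF bounded_linear_Re assms])
  then show "((\<lambda>t. u (x + t *\<^sub>R v)) has_real_derivative Re d) (at 0)"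
    by (simp add: has_real_derivative_iff_has_vector_derivative)
  have "((\<lambda>t. Im (cx u (x + t *\<^sub>R v))) has_vector_derivative Im d) (at 0)"
    by (rule bounded_linear.has_vector_derivative[OF bounded_linear_Im assms])
  then have "((\<lambda>t. 0) has_vector_derivative Im d) (at (0::real))"
    by simp
  then show "Im d = 0"
    using vector_derivative_unique_at[OF _ has_vector_derivative_const] by blast
qed

lemma has_lderiv_compose:
  assumes d: "has_lderiv v (cx u) d x" and \<phi>: "(\<phi> has_real_derivative e) (at (u x))"
  shows "has_lderiv v (cx (\<lambda>y. \<phi> (u y))) (of_real e * d) x"
proof -
  have "(\<phi> has_real_derivative e) (at (u (x + 0 *\<^sub>R v)))" using \<phi> by simp
  from DERIV_chain2[OF this real_lderiv(2)[OF d]]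
  have "((\<lambda>t. \<phi> (u (x + t *\<^sub>R v))) has_vector_derivative e * Re d) (at 0)"
    by (simp add: has_real_derivative_iff_has_vector_derivative)
  then have "((\<lambda>t. cx (\<lambda>y. \<phi> (u y)) (x + t *\<^sub>R v)) has_vector_derivative of_real (e * Re d)) (at 0)"
    by (rule bounded_linear.has_vector_derivative[OF bounded_linear_of_real])
  moreover have "of_real (e * Re d) = of_real e * d"
    using real_lderiv(1)[OF d] by (simp add: complex_eq_iff)
  ultimately show ?thesis by (simp only:)
qed

lemma C1on_compose:
  assumes u: "C1on S (cx u)" and \<phi>: "\<And>t. (\<phi> has_real_derivative \<phi>' t) (at t)" "continuous_on UNIV \<phi>'"
  shows "C1on S (cx (\<lambda>x. \<phi> (u x)))"
    "\<And>v x. x \<in> S \<Longrightarrow> lderiv v (cx (\<lambda>x. \<phi> (u x))) x = of_real (\<phi>' (u x)) * lderiv v (cx u) x"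
proof -
  have d: "has_lderiv v (cx (\<lambda>x. \<phi> (u x))) (of_real (\<phi>' (u x)) * lderiv v (cx u) x) x" if "x \<in> S" for v x
    by (rule has_lderiv_compose[OF C1onD(3)[OF u that] \<phi>(1)])
  have "continuous_on S (\<lambda>x. Re (cx u x))"
    by (intro continuous_on_Re C1onD(1)[OF u])
  then have cu: "continuous_on S u" by simp
  have "continuous_on UNIV \<phi>"
    using \<phi>(1) by (intro DERIV_continuous_on) (auto intro: has_field_derivative_at_within)
  then have c\<phi>: "continuous_on S (\<lambda>x. \<phi> (u x))"
    by (rule continuous_on_compose2[OF _ cu subset_UNIV])
  have c\<phi>': "continuous_on S (\<lambda>x. \<phi>' (u x))"
    by (rule continuous_on_compose2[OF \<phi>(2) cu subset_UNIV])
  show "C1on S (cx (\<lambda>x. \<phi> (u x)))"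
  proof (rule C1onI[where g="\<lambda>v x. of_real (\<phi>' (u x)) * lderiv v (cx u) x"])
    show "continuous_on S (cx (\<lambda>x. \<phi> (u x)))" by (intro continuous_on_of_real c\<phi>)
    show "continuous_on S (\<lambda>x. of_real (\<phi>' (u x)) * lderiv v (cx u) x)" for v
      by (intro continuous_on_mult continuous_on_of_real c\<phi>' C1onD(2)[OF u])
  qed (rule d)
  show "\<And>v x. x \<in> S \<Longrightarrow> lderiv v (cx (\<lambda>x. \<phi> (u x))) x = of_real (\<phi>' (u x)) * lderiv v (cx u) x"
    by (rule lderiv_eq) (rule d)
qed

lemma C2on_cong_open:
  assumes "C2on S f" "open S" "\<And>x. x \<in> S \<Longrightarrow> f x = g x"
  shows "C2on S g" "\<And>v x. x \<in> S \<Longrightarrow> lderiv v g x = lderiv v f x"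
    "\<And>v w x. x \<in> S \<Longrightarrow> lderiv v (lderiv w g) x = lderiv v (lderiv w f) x"
proof -
  note f = C2on_imp_C1on[OF assms(1)] C2on_lderiv[OF assms(1)]
  show e: "\<And>v x. x \<in> S \<Longrightarrow> lderiv v g x = lderiv v f x"
    by (rule C1on_cong_open(2)[OF f(1) assms(2,3)])
  have "C1on S (lderiv v g)" for v
    by (rule C1on_cong_open(1)[OF f(2) assms(2) e[symmetric]])
  then show "C2on S g"
    using C1on_cong_open(1)[OF f(1) assms(2,3)] by (simp add: C2on_def)
  show "\<And>v w x. x \<in> S \<Longrightarrow> lderiv v (lderiv w g) x = lderiv v (lderiv w f) x"
    by (rule C1on_cong_open(2)[OF f(2) assms(2) e[symmetric]])
qed

lemma C2on_compose:
  assumes u: "C2on S (cx u)" and S: "open S"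
    and \<phi>: "\<And>t. (\<phi> has_real_derivative \<phi>' t) (at t)" "\<And>t. (\<phi>' has_real_derivative \<phi>'' t) (at t)" "continuous_on UNIV \<phi>''"
  shows "C2on S (cx (\<lambda>x. \<phi> (u x)))"
proof -
  have c\<phi>': "continuous_on UNIV \<phi>'"
    using \<phi>(2) by (intro DERIV_continuous_on) (auto intro: has_field_derivative_at_within)
  note u1 = C2on_imp_C1on[OF u]
  have 1: "C1on S (cx (\<lambda>x. \<phi> (u x)))"
    by (rule C1on_compose(1)[OF u1 \<phi>(1) c\<phi>'])
  have "C1on S (lderiv v (cx (\<lambda>x. \<phi> (u x))))" for v
  proof (rule C1on_cong_open(1)[OF _ S])
    show "C1on S (\<lambda>x. of_real (\<phi>' (u x)) * lderiv v (cx u) x)"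
      by (rule C1on_mult(1)[OF C1on_compose(1)[OF u1 \<phi>(2,3)] C2on_lderiv[OF u]])
    show "of_real (\<phi>' (u x)) * lderiv v (cx u) x = lderiv v (cx (\<lambda>x. \<phi> (u x))) x" if "x \<in> S" for x
      by (rule C1on_compose(2)[OF u1 \<phi>(1) c\<phi>' that, symmetric])
  qed
  with 1 show ?thesis by (simp add: C2on_def)
qed

definition cutoff :: "'a set \<Rightarrow> ('a \<Rightarrow> real) \<Rightarrow> nat \<Rightarrow> 'a \<Rightarrow> complex" where
  "cutoff S u n x = (if x \<in> S then of_real (trunc n (u x)) else 0)"

text \<open>u is continuous on the compact closure and 0 on the frontier, so |u| >= 1 / (n + 1)
  holds only on a compact subset \<open>K\<close> of \<open>S\<close>, and off \<open>K\<close> the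
  truncation is 0. Regularity on \<open>S\<close> and on the complement of \<open>K\<close> glues to
  the whole space.\<close>

lemma cutoff_props:
  fixes u :: "'a::euclidean_space \<Rightarrow> real"
  assumes S: "open S" "bounded S" and u: "C2on S (cx u)" "continuous_on (closure S) u" "\<forall>x\<in>frontier S. u x = 0"
  shows "\<exists>K. compact K \<and> K \<subseteq> S \<and> C1c K (cutoff S u n) \<and> (\<forall>v. C1c K (lderiv v (cutoff S u n))) \<and>
    C2on S (cutoff S u n) \<and>
    (\<forall>v. \<forall>x\<in>S. lderiv v (cutoff S u n) x = of_real (trunc' n (u x)) * lderiv v (cx u) x)"
proof -
  let ?f = "cutoff S u n"
  define K where "K = closure S \<inter> (\<lambda>x. \<bar>u x\<bar>) -` {1 / real (Suc n)..}"
  have K: "compact K"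
  proof -
    have "closed K"
      unfolding K_def by (rule continuous_closed_preimage) (auto intro!: continuous_intros u)
    then show ?thesis
      using bounded_subset[OF bounded_closure[OF S(2)], of K] by (auto simp: compact_eq_bounded_closed K_def)
  qed
  have KS: "K \<subseteq> S"
  proof
    fix x assume x: "x \<in> K"
    have "u x \<noteq> 0"
    proof
      assume "u x = 0"
      then have "1 / real (Suc n) \<le> 0" using x by (simp add: K_def del: of_nat_Suc)
      then show False by (simp del: of_nat_Suc)
    qed
    then have "x \<notin> frontier S" using u(3) by auto
    then show "x \<in> S" using x S(1) by (simp add: K_def frontier_def interior_open)
  qed
  have zero: "?f x = 0" if "x \<notin> K" for x
  proof (cases "x \<in> S")
    case True
    then have "\<bar>u x\<bar> \<le> 1 / real (Suc n)"
      using that closure_subset[of S] by (auto simp: K_def)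
    then show ?thesis using trunc_eq_0 by (simp add: cutoff_def)
  qed (simp add: cutoff_def)
  have C2: "C2on S (cx (\<lambda>x. trunc n (u x)))"
    by (rule C2on_compose[OF u(1) S(1) trunc_deriv trunc'_deriv trunc''_continuous])
  have eq: "cx (\<lambda>x. trunc n (u x)) x = ?f x" if "x \<in> S" for x
    using that by (simp add: cutoff_def)
  have C2f: "C2on S ?f"
    by (rule C2on_cong_open(1)[OF C2 S(1) eq])
  have un: "S \<union> - K = UNIV" using KS by auto
  have oK: "open (- K)" using compact_imp_closed[OF K] by (rule open_Compl)
  have "C1on (- K) ?f"
    by (rule C1on_cong_open(1)[OF C1on_const[of "- K" 0] oK]) (use zero in auto)
  from C1on_Un[OF C2on_imp_C1on[OF C2f] this S(1) oK]
  have f1: "C1c K ?f" using zero by (auto simp: C1c_def un)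
  have lz: "lderiv v ?f x = 0" if "x \<notin> K" for v x
    by (rule C1c_lderiv_eq_0[OF f1 compact_imp_closed[OF K] that])
  have "C1on (- K) (lderiv v ?f)" for v
    by (rule C1on_cong_open(1)[OF C1on_const[of "- K" 0] oK]) (use lz in auto)
  from C1on_Un[OF C2on_lderiv[OF C2f] this S(1) oK]
  have f2: "C1c K (lderiv v ?f)" for v using lz by (auto simp: C1c_def un)
  have c': "continuous_on UNIV (trunc' n)"
    using trunc'_deriv by (intro DERIV_continuous_on) (auto intro: has_field_derivative_at_within)
  have "lderiv v ?f x = of_real (trunc' n (u x)) * lderiv v (cx u) x" if "x \<in> S" for v x
  proof -
    have "lderiv v ?f x = lderiv v (cx (\<lambda>x. trunc n (u x))) x"
      by (rule C2on_cong_open(2)[OF C2 S(1) eq that])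
    also have "\<dots> = of_real (trunc' n (u x)) * lderiv v (cx u) x"
      by (rule C1on_compose(2)[OF C2on_imp_C1on[OF u(1)] trunc_deriv c' that])
    finally show ?thesis .
  qed
  then show ?thesis
    by (intro exI[of _ K] conjI allI ballI K KS f1 f2 C2f)
qed

subsection \<open>Symmetry of second derivatives\<close>

text \<open>Two applications of the mean value theorem to the second difference over a
  parallelogram, an expression symmetric in \<open>v\<close> and \<open>w\<close>. The mean value
  theorem is the reason for the real parts.\<close>

lemma second_difference:
  fixes u :: "'a::real_normed_vector \<Rightarrow> real"
  assumes t: "0 < t" and D: "\<And>s r. 0 \<le> s \<Longrightarrow> s \<le> t \<Longrightarrow> 0 \<le> r \<Longrightarrow> r \<le> t \<Longrightarrow> x + s *\<^sub>R v + r *\<^sub>R w \<in> S"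
    and 1: "\<And>y. y \<in> S \<Longrightarrow> has_lderiv v (cx u) (f y) y"
    and 2: "\<And>y. y \<in> S \<Longrightarrow> has_lderiv w f (g y) y"
  obtains \<xi> \<eta> where "0 < \<xi>" "\<xi> < t" "0 < \<eta>" "\<eta> < t"
    "u (x + t *\<^sub>R v + t *\<^sub>R w) - u (x + t *\<^sub>R v) - u (x + t *\<^sub>R w) + u x = t * t * Re (g (x + \<xi> *\<^sub>R v + \<eta> *\<^sub>R w))"
proof -
  have line: "((\<lambda>s. u (x + s *\<^sub>R v + r *\<^sub>R w)) has_real_derivative Re (f (x + s *\<^sub>R v + r *\<^sub>R w))) (at s)"
    if "0 \<le> s" "s \<le> t" "0 \<le> r" "r \<le> t" for s r
  proof -
    have "has_lderiv v (cx u) (f (x + s *\<^sub>R v + r *\<^sub>R w)) ((x + r *\<^sub>R w) + s *\<^sub>R v)"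
      using 1[OF D[OF that]] by (simp add: algebra_simps)
    from has_lderiv_shift[OF this]
    have "((\<lambda>s. Re (cx u ((x + r *\<^sub>R w) + s *\<^sub>R v))) has_vector_derivative Re (f (x + s *\<^sub>R v + r *\<^sub>R w))) (at s)"
      by (rule bounded_linear.has_vector_derivative[OF bounded_linear_Re])
    then show ?thesis
      by (simp add: has_real_derivative_iff_has_vector_derivative algebra_simps)
  qed
  let ?h = "\<lambda>s. u (x + s *\<^sub>R v + t *\<^sub>R w) - u (x + s *\<^sub>R v + 0 *\<^sub>R w)"
  have "\<exists>\<xi>. 0 < \<xi> \<and> \<xi> < t \<and> ?h t - ?h 0 = (t - 0) * (Re (f (x + \<xi> *\<^sub>R v + t *\<^sub>R w)) - Re (f (x + \<xi> *\<^sub>R v + 0 *\<^sub>R w)))"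
    by (rule MVT2[OF t]) (intro DERIV_diff line; use t in simp)
  then obtain \<xi> where \<xi>: "0 < \<xi>" "\<xi> < t"
    "?h t - ?h 0 = t * (Re (f (x + \<xi> *\<^sub>R v + t *\<^sub>R w)) - Re (f (x + \<xi> *\<^sub>R v + 0 *\<^sub>R w)))"
    by auto
  have line2: "((\<lambda>r. Re (f (x + \<xi> *\<^sub>R v + r *\<^sub>R w))) has_real_derivative Re (g (x + \<xi> *\<^sub>R v + r *\<^sub>R w))) (at r)"
    if "0 \<le> r" "r \<le> t" for r
  proof -
    have "has_lderiv w f (g (x + \<xi> *\<^sub>R v + r *\<^sub>R w)) ((x + \<xi> *\<^sub>R v) + r *\<^sub>R w)"
      by (rule 2, rule D) (use \<xi> that in auto)
    from has_lderiv_shift[OF this]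
    have "((\<lambda>r. Re (f ((x + \<xi> *\<^sub>R v) + r *\<^sub>R w))) has_vector_derivative Re (g (x + \<xi> *\<^sub>R v + r *\<^sub>R w))) (at r)"
      by (rule bounded_linear.has_vector_derivative[OF bounded_linear_Re])
    then show ?thesis
      by (simp add: has_real_derivative_iff_has_vector_derivative)
  qed
  have "\<exists>\<eta>. 0 < \<eta> \<and> \<eta> < t \<and> Re (f (x + \<xi> *\<^sub>R v + t *\<^sub>R w)) - Re (f (x + \<xi> *\<^sub>R v + 0 *\<^sub>R w)) =
      (t - 0) * Re (g (x + \<xi> *\<^sub>R v + \<eta> *\<^sub>R w))"
    by (rule MVT2[OF t]) (rule line2)
  then obtain \<eta> where \<eta>: "0 < \<eta>" "\<eta> < t"
    "Re (f (x + \<xi> *\<^sub>R v + t *\<^sub>R w)) - Re (f (x + \<xi> *\<^sub>R v + 0 *\<^sub>R w)) = t * Re (g (x + \<xi> *\<^sub>R v + \<eta> *\<^sub>R w))"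
    by auto
  show ?thesis
    by (rule that[OF \<xi>(1,2) \<eta>(1,2)]) (use \<xi>(3) \<eta>(3) in \<open>simp add: algebra_simps\<close>)
qed

text \<open>Evaluating one second difference in both orders gives equal values of the two mixed
  derivatives at points near x; if they differed at x, continuity would separate these
  values.\<close>

lemma lderiv_commute:
  fixes u :: "'a::real_normed_vector \<Rightarrow> real"
  assumes u: "C2on S (cx u)" and S: "open S" "x \<in> S"
  shows "lderiv v (lderiv w (cx u)) x = lderiv w (lderiv v (cx u)) x"
proof -
  note u1 = C1onD(3)[OF C2on_imp_C1on[OF u]] and u2 = C1onD(3)[OF C2on_lderiv[OF u]]
  obtain r where r: "0 < r" "ball x r \<subseteq> S"
    using S openE by blast
  define c where "c = norm v + norm w + 1"
  have c: "0 < c" by (simp add: c_def add_nonneg_pos)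
  have near: "dist (x + s *\<^sub>R v + q *\<^sub>R w) x \<le> t * c" if "0 \<le> s" "s \<le> t" "0 \<le> q" "q \<le> t" for s q t
  proof -
    have "dist (x + s *\<^sub>R v + q *\<^sub>R w) x = norm (s *\<^sub>R v + q *\<^sub>R w)"
      by (simp add: dist_norm)
    also have "\<dots> \<le> s * norm v + q * norm w"
      using norm_triangle_ineq[of "s *\<^sub>R v" "q *\<^sub>R w"] that by simp
    also have "\<dots> \<le> t * norm v + t * norm w"
      using that by (intro add_mono mult_right_mono) auto
    also have "\<dots> \<le> t * c"
      using that by (simp add: c_def algebra_simps)
    finally show ?thesis .
  qed
  have "Re (lderiv v (lderiv w (cx u)) x) = Re (lderiv w (lderiv v (cx u)) x)"
  proof (rule ccontr)
    let ?A = "\<lambda>y. Re (lderiv v (lderiv w (cx u)) y)" and ?B = "\<lambda>y. Re (lderiv w (lderiv v (cx u)) y)"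
    assume ne: "?A x \<noteq> ?B x"
    define e where "e = \<bar>?A x - ?B x\<bar> / 2"
    have e: "0 < e" using ne by (simp add: e_def)
    have "continuous_on S ?A" "continuous_on S ?B"
      by (intro continuous_on_Re C1onD(2)[OF C2on_lderiv[OF u]])+
    then have "isCont ?A x" "isCont ?B x"
      using S by (simp_all add: continuous_on_eq_continuous_at)
    then have "\<exists>d>0. \<forall>y. dist y x < d \<longrightarrow> dist (?A y) (?A x) < e" "\<exists>d>0. \<forall>y. dist y x < d \<longrightarrow> dist (?B y) (?B x) < e"
      using e by (simp_all add: continuous_at_eps_delta)
    then obtain d1 d2 where d: "0 < d1" "\<forall>y. dist y x < d1 \<longrightarrow> dist (?A y) (?A x) < e"
      "0 < d2" "\<forall>y. dist y x < d2 \<longrightarrow> dist (?B y) (?B x) < e"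
      by (elim exE conjE)
    define t where "t = min r (min d1 d2) / (2 * c)"
    have t: "0 < t" "t * c < r" "t * c < d1" "t * c < d2"
      using r(1) d(1,3) c by (auto simp: t_def field_simps)
    have box: "x + s *\<^sub>R v + q *\<^sub>R w \<in> S" if "0 \<le> s" "s \<le> t" "0 \<le> q" "q \<le> t" for s q
      using near[OF that] t(2) r(2) by (auto simp: dist_commute subset_iff)
    have box': "x + q *\<^sub>R w + s *\<^sub>R v \<in> S" if "0 \<le> q" "q \<le> t" "0 \<le> s" "s \<le> t" for s q
      using box[OF that(3,4,1,2)] by (simp add: algebra_simps)
    obtain \<xi> \<eta> where 1: "0 < \<xi>" "\<xi> < t" "0 < \<eta>" "\<eta> < t"
      "u (x + t *\<^sub>R v + t *\<^sub>R w) - u (x + t *\<^sub>R v) - u (x + t *\<^sub>R w) + u x = t * t * ?B (x + \<xi> *\<^sub>R v + \<eta> *\<^sub>R w)"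
      by (rule second_difference[where f="lderiv v (cx u)" and g="lderiv w (lderiv v (cx u))", OF t(1) box u1 u2])
    obtain \<xi>' \<eta>' where 2: "0 < \<xi>'" "\<xi>' < t" "0 < \<eta>'" "\<eta>' < t"
      "u (x + t *\<^sub>R w + t *\<^sub>R v) - u (x + t *\<^sub>R w) - u (x + t *\<^sub>R v) + u x = t * t * ?A (x + \<xi>' *\<^sub>R w + \<eta>' *\<^sub>R v)"
      by (rule second_difference[where f="lderiv w (cx u)" and g="lderiv v (lderiv w (cx u))", OF t(1) box' u1 u2])
    have "t * t * ?B (x + \<xi> *\<^sub>R v + \<eta> *\<^sub>R w) = t * t * ?A (x + \<xi>' *\<^sub>R w + \<eta>' *\<^sub>R v)"
      unfolding 1(5)[symmetric] 2(5)[symmetric] by (simp add: algebra_simps)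
    then have eq: "?B (x + \<xi> *\<^sub>R v + \<eta> *\<^sub>R w) = ?A (x + \<xi>' *\<^sub>R w + \<eta>' *\<^sub>R v)"
      using t(1) by simp
    have "dist (x + \<xi> *\<^sub>R v + \<eta> *\<^sub>R w) x < d2"
      using near[of \<xi> t \<eta>] 1 t by simp
    moreover have "dist (x + \<xi>' *\<^sub>R w + \<eta>' *\<^sub>R v) x < d1"
      using near[of \<eta>' t \<xi>'] 2 t by (simp add: algebra_simps)
    ultimately have "\<bar>?B (x + \<xi> *\<^sub>R v + \<eta> *\<^sub>R w) - ?B x\<bar> < e" "\<bar>?A (x + \<xi>' *\<^sub>R w + \<eta>' *\<^sub>R v) - ?A x\<bar> < e"
      using d(2,4) by (simp_all add: dist_real_def)
    then have "\<bar>?A x - ?B x\<bar> < 2 * e"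
      unfolding eq by linarith
    then show False by (simp add: e_def)
  qed
  moreover have "Im (lderiv v (lderiv w (cx u)) x) = 0" for v w
  proof -
    have "has_lderiv v (cx (\<lambda>y. Re (lderiv w (cx u) y))) (lderiv v (lderiv w (cx u)) x) x"
    proof (rule has_lderiv_transform[OF u2[OF S(2)] S])
      show "lderiv w (cx u) y = cx (\<lambda>y. Re (lderiv w (cx u) y)) y" if "y \<in> S" for y
        using real_lderiv(1)[OF u1[OF that]] by (simp add: complex_eq_iff)
    qed
    then show ?thesis by (rule real_lderiv(1))
  qed
  ultimately show ?thesis by (simp add: complex_eq_iff)
qed

lemma cnj_dz:
  assumes "C1on S (cx u)" "x \<in> S"
  shows "cnj (dz i (cx u) x) = dzb i (cx u) x" "cnj (dzb i (cx u) x) = dz i (cx u) x"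
  using real_lderiv(1)[OF C1onD(3)[OF assms]] by (auto simp: dz_def dzb_def complex_eq_iff)

lemma lderiv_lderiv_real:
  assumes u: "C2on S (cx u)" and S: "open S" "x \<in> S"
  shows "Im (lderiv v (lderiv w (cx u)) x) = 0"
proof -
  note u1 = C1onD(3)[OF C2on_imp_C1on[OF u]] and u2 = C1onD(3)[OF C2on_lderiv[OF u]]
  have "has_lderiv v (cx (\<lambda>y. Re (lderiv w (cx u) y))) (lderiv v (lderiv w (cx u)) x) x"
  proof (rule has_lderiv_transform[OF u2[OF S(2)] S])
    show "lderiv w (cx u) y = cx (\<lambda>y. Re (lderiv w (cx u) y)) y" if "y \<in> S" for y
      using real_lderiv(1)[OF u1[OF that]] by (simp add: complex_eq_iff)
  qed
  then show ?thesis by (rule real_lderiv(1))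
qed

lemma lhess_nth:
  assumes u: "C2on S f" and x: "x \<in> S"
  shows "lhess f x $ i $ j =
    (1 / 4) * (lderiv (axis i 1) (lderiv (axis j 1) f) x + lderiv (axis i \<i>) (lderiv (axis j \<i>) f) x)
    + (\<i> / 4) * (lderiv (axis i 1) (lderiv (axis j \<i>) f) x - lderiv (axis i \<i>) (lderiv (axis j 1) f) x)"
proof -
  have "lderiv v (dzb j f) x = (1 / 2) * lderiv v (lderiv (axis j 1) f) x + (\<i> / 2) * lderiv v (lderiv (axis j \<i>) f) x" for v
    unfolding dzb_def by (rule C1on_lincomb(2)[OF C2on_lderiv[OF u] C2on_lderiv[OF u] x])
  then have "lhess f x $ i $ j =
      (1 / 2) * ((1 / 2) * lderiv (axis i 1) (lderiv (axis j 1) f) x + (\<i> / 2) * lderiv (axis i 1) (lderiv (axis j \<i>) f) x) +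
      (- \<i> / 2) * ((1 / 2) * lderiv (axis i \<i>) (lderiv (axis j 1) f) x + (\<i> / 2) * lderiv (axis i \<i>) (lderiv (axis j \<i>) f) x)"
    by (simp only: lhess_def dz_def[of i] vec_lambda_beta)
  then show ?thesis
    by (simp add: field_simps)
qed

lemma lhess_hermitian:
  assumes u: "C2on S (cx u)" and S: "open S" "x \<in> S"
  shows "lhess (cx u) x \<in> hermitian_matrices"
proof (rule hermitianI)
  fix i j
  show "cnj (lhess (cx u) x $ i $ j) = lhess (cx u) x $ j $ i"
    unfolding lhess_nth[OF u S(2)]
    using lderiv_lderiv_real[OF u S] lderiv_commute[OF u S, of "axis i 1" "axis j 1"]
      lderiv_commute[OF u S, of "axis i \<i>" "axis j \<i>"] lderiv_commute[OF u S, of "axis i 1" "axis j \<i>"]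
      lderiv_commute[OF u S, of "axis i \<i>" "axis j 1"]
    by (simp add: complex_eq_iff; simp add: field_simps)
qed

subsection \<open>Integrals over bounded domains\<close>

lemma bounded_mult_image:
  fixes f g :: "'a \<Rightarrow> complex"
  assumes "bounded (f ` S)" "bounded (g ` S)"
  shows "bounded ((\<lambda>x. f x * g x) ` S)"
proof -
  obtain a b where ab: "\<And>x. x \<in> S \<Longrightarrow> norm (f x) \<le> a" "\<And>x. x \<in> S \<Longrightarrow> norm (g x) \<le> b"
    using assms unfolding bounded_iff by blast
  have "norm (f x * g x) \<le> a * b" if "x \<in> S" for x
    unfolding norm_mult using ab(1)[OF that] ab(2)[OF that]
    by (intro mult_mono) (auto intro: order_trans[OF norm_ge_zero])
  then show ?thesis unfolding bounded_iff by blast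
qed

lemma bounded_add_image:
  fixes f g :: "'a \<Rightarrow> complex"
  assumes "bounded (f ` S)" "bounded (g ` S)"
  shows "bounded ((\<lambda>x. f x + g x) ` S)"
proof -
  obtain a b where ab: "\<And>x. x \<in> S \<Longrightarrow> norm (f x) \<le> a" "\<And>x. x \<in> S \<Longrightarrow> norm (g x) \<le> b"
    using assms unfolding bounded_iff by blast
  have "norm (f x + g x) \<le> a + b" if "x \<in> S" for x
    using norm_triangle_mono[OF ab(1)[OF that] ab(2)[OF that]] .
  then show ?thesis unfolding bounded_iff by blast
qed

lemma bounded_const_image: "bounded ((\<lambda>x. c) ` S)"
  by (rule bounded_subset[of "{c}"]) auto

lemma bounded_sum_image:
  fixes f :: "'i \<Rightarrow> 'a \<Rightarrow> complex"
  assumes "\<And>i. i \<in> I \<Longrightarrow> bounded (f i ` S)"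
  shows "bounded ((\<lambda>x. \<Sum>i\<in>I. f i x) ` S)"
  using assms
  by (induction I rule: infinite_finite_induct) (simp_all add: bounded_const_image bounded_add_image)

lemma bounded_prod_image:
  fixes f :: "'i \<Rightarrow> 'a \<Rightarrow> complex"
  assumes "\<And>i. i \<in> I \<Longrightarrow> bounded (f i ` S)"
  shows "bounded ((\<lambda>x. \<Prod>i\<in>I. f i x) ` S)"
  using assms
  by (induction I rule: infinite_finite_induct) (simp_all add: bounded_const_image bounded_mult_image)

lemma bounded_polar_det:
  fixes F :: "('a \<Rightarrow> ('n::finite) cmat) list"
  assumes "\<And>f i j. f \<in> set F \<Longrightarrow> bounded ((\<lambda>x. f x $ i $ j) ` S)" "length F = CARD('n)"
  shows "bounded ((\<lambda>x. polar_det (map (\<lambda>f. f x) F)) ` S)"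
proof -
  have pos: "pos (i::'n) < length F" for i
    using bij_betw_pos assms(2) by (auto simp: bij_betw_def)
  have "bounded ((\<lambda>x. (\<Sum>\<pi> | \<pi> permutes UNIV. \<Sum>p | p permutes UNIV. of_int (sign p) *
      (\<Prod>i\<in>UNIV. (F ! pos (\<pi> i)) x $ i $ p i)) * (1 / fact CARD('n))) ` S)"
    by (intro bounded_mult_image bounded_sum_image bounded_prod_image bounded_const_image assms nth_mem pos)
  then show ?thesis
    unfolding polar_det_def mixed_disc_def det_def by (simp add: pos)
qed

lemma integrable_bounded_open:
  fixes f :: "'a::euclidean_space \<Rightarrow> complex"
  assumes "open S" "bounded S" "continuous_on S f" "bounded (f ` S)"
  shows "integrable lborel (\<lambda>x. indicator S x *\<^sub>R f x)"
proof -
  obtain B where B: "\<And>x. x \<in> S \<Longrightarrow> norm (f x) \<le> B"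
    using assms(4) unfolding bounded_iff by blast
  have "integrable lborel (\<lambda>x. indicator S x *\<^sub>R (indicator S x *\<^sub>R f x))"
  proof (rule integrableI_bounded_set_indicator)
    show "(\<lambda>x. indicator S x *\<^sub>R f x) \<in> borel_measurable lborel"
      using borel_measurable_continuous_on_indicator[of S f] assms(1,3) by simp
    show "emeasure lborel S < \<infinity>" by (rule emeasure_bounded_finite[OF assms(2)])
    show "AE x in lborel. x \<in> S \<longrightarrow> norm (indicator S x *\<^sub>R f x) \<le> B"
      using B by (intro AE_I2) (simp add: indicator_def)
  qed (use assms(1) in simp)
  moreover have "(\<lambda>x. indicator S x *\<^sub>R (indicator S x *\<^sub>R f x)) = (\<lambda>x. indicator S x *\<^sub>R f x)"
    by (auto simp: indicator_def fun_eq_iff)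
  ultimately show ?thesis by (simp only:)
qed

section \<open>Function classes on a bounded domain and the energy identity\<close>

text \<open>Bounds for all derivatives up to order two are what C^2 regularity up to the closure of
  a bounded domain provides. They make the energy integrands integrable, and they pass to linear
  combinations.\<close>

definition C2bd :: "'a::real_normed_vector set \<Rightarrow> ('a \<Rightarrow> real) \<Rightarrow> bool" where
  "C2bd S u \<longleftrightarrow> C2on S (cx u) \<and> bounded (cx u ` S) \<and> (\<forall>v. bounded (lderiv v (cx u) ` S)) \<and>
     (\<forall>v w. bounded ((\<lambda>x. lderiv v (lderiv w (cx u)) x) ` S))"

definition C2zero :: "'a::real_normed_vector set \<Rightarrow> ('a \<Rightarrow> real) \<Rightarrow> bool" where
  "C2zero S u \<longleftrightarrow> C2bd S u \<and> continuous_on (closure S) u \<and> (\<forall>x\<in>frontier S. u x = 0)"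

lemma bounded_image_cong: "bounded (f ` S) \<Longrightarrow> (\<And>x. x \<in> S \<Longrightarrow> f x = g x) \<Longrightarrow> bounded (g ` S)"
  using image_cong[of S S f g] by metis

lemma bounded_lhess:
  assumes "C2bd S u"
  shows "bounded ((\<lambda>x. lhess (cx u) x $ i $ j) ` S)"
proof (rule bounded_image_cong)
  have b: "bounded ((\<lambda>x. lderiv v (lderiv w (cx u)) x) ` S)" for v w
    using assms by (simp add: C2bd_def)
  show "bounded ((\<lambda>x. (1 / 4) * (lderiv (axis i 1) (lderiv (axis j 1) (cx u)) x + lderiv (axis i \<i>) (lderiv (axis j \<i>) (cx u)) x)
    + (\<i> / 4) * (lderiv (axis i 1) (lderiv (axis j \<i>) (cx u)) x + (- 1) * lderiv (axis i \<i>) (lderiv (axis j 1) (cx u)) x)) ` S)"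
    by (intro bounded_add_image bounded_mult_image bounded_const_image b)
  show "(1 / 4) * (lderiv (axis i 1) (lderiv (axis j 1) (cx u)) x + lderiv (axis i \<i>) (lderiv (axis j \<i>) (cx u)) x)
    + (\<i> / 4) * (lderiv (axis i 1) (lderiv (axis j \<i>) (cx u)) x + (- 1) * lderiv (axis i \<i>) (lderiv (axis j 1) (cx u)) x)
    = lhess (cx u) x $ i $ j" if "x \<in> S" for x
    using lhess_nth[of S "cx u" x i j] assms that by (simp add: C2bd_def)
qed

lemma bounded_hess_form:
  assumes "C2bd S v" "\<And>w. w \<in> set ws \<Longrightarrow> C2bd S w" "Suc (length ws + length cs) = CARD('n::finite)"
  shows "bounded (hess_form (cx v) (map cx ws) cs ` (S :: (complex ^ 'n) set))"
proof -
  have "bounded ((\<lambda>x. polar_det (map (\<lambda>f. f x) (lhess (cx v) # map (\<lambda>w. lhess (cx w)) ws @ map (\<lambda>c _. c) cs))) ` S)"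
    by (rule bounded_polar_det) (use assms in \<open>auto intro: bounded_lhess bounded_const_image\<close>)
  then show ?thesis
    by (simp add: hess_form_def[abs_def] o_def)
qed

lemma bounded_grad_form:
  assumes "C2bd S u" "C2bd S v" "\<And>w. w \<in> set ws \<Longrightarrow> C2bd S w" "Suc (length ws + length cs) = CARD('n::finite)"
  shows "bounded (grad_form (cx u) (cx v) (map cx ws) cs ` (S :: (complex ^ 'n) set))"
proof -
  have b: "bounded ((\<lambda>x. lderiv e (cx u) x) ` S)" "bounded ((\<lambda>x. lderiv e (cx v) x) ` S)" for e
    using assms(1,2) by (simp_all add: C2bd_def)
  have "bounded ((\<lambda>x. dz i (cx u) x * dzb j (cx v) x) ` S)" for i j
    unfolding dz_def dzb_def by (intro bounded_mult_image bounded_add_image bounded_const_image b)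
  then have "bounded ((\<lambda>x. polar_det (map (\<lambda>f. f x) ((\<lambda>x. outer (\<chi> i. dz i (cx u) x) (\<chi> j. dzb j (cx v) x))
      # map (\<lambda>w. lhess (cx w)) ws @ map (\<lambda>c _. c) cs))) ` S)"
    by (intro bounded_polar_det)
      (use assms in \<open>auto intro: bounded_lhess bounded_const_image simp: outer_def\<close>)
  then show ?thesis
    by (simp add: grad_form_def[abs_def] o_def)
qed

lemma continuous_on_hess_form:
  assumes "C2on S f" "\<And>w. w \<in> set ws \<Longrightarrow> C2on S w" "Suc (length ws + length cs) = CARD('n::finite)"
  shows "continuous_on (S :: (complex ^ 'n) set) (hess_form f ws cs)"
  unfolding hess_form_def by (rule continuous_on_polar_lhess[OF continuous_on_lhess[OF assms(1)] assms(2,3)])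

lemma continuous_on_grad_form:
  assumes "C2on S f" "C2on S g" "\<And>w. w \<in> set ws \<Longrightarrow> C2on S w" "Suc (length ws + length cs) = CARD('n::finite)"
  shows "continuous_on (S :: (complex ^ 'n) set) (grad_form f g ws cs)"
  unfolding grad_form_def
  by (rule continuous_on_polar_lhess[OF _ assms(3,4)])
    (simp add: outer_def continuous_on_mult continuous_on_dz continuous_on_dzb C2on_imp_C1on assms)

lemma outer_cscale: "outer (\<chi> i. c * p i) (\<chi> j. q j) = cscale c (outer (\<chi> i. p i) (\<chi> j. q j))"
  "outer (\<chi> i. p i) (\<chi> j. c * q j) = cscale c (outer (\<chi> i. p i) (\<chi> j. q j))"
  by (simp_all add: outer_def vec_eq_iff mult_ac)

lemma hess_form_test_integrable:
  fixes f h :: "complex ^ 'n::finite \<Rightarrow> complex"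
  assumes S: "open S" "compact K" "K \<subseteq> S" and len: "Suc (length ws + length cs) = CARD('n)"
    and ws: "\<And>w. w \<in> set ws \<Longrightarrow> C2on S w" and f: "C1c K f" "\<And>v. C1c K (lderiv v f)" and h: "continuous_on S h"
  shows "integrable lborel (\<lambda>x. h x * hess_form f ws cs x)"
proof -
  let ?U = "\<lambda>i j x. polar_det (unit_cmat i j # map (\<lambda>w. lhess w x) ws @ cs)"
  have len': "Suc (length (map (\<lambda>w. lhess w x) ws @ cs)) = CARD('n)" for x using len by simp
  have U: "continuous_on S (?U i j)" for i j
    by (rule continuous_on_polar_lhess[OF _ ws len]) auto
  have fb: "C1c K (dzb j f)" for j by (rule C1c_dz(2)[OF f compact_imp_closed[OF S(2)]])
  have "integrable lborel (\<lambda>x. dz i (dzb j f) x * (h x * ?U i j x))" for i j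
    by (rule C1c_integrable_dz_mult[OF fb S(2,3,1)]) (intro continuous_on_mult h U)
  then have "integrable lborel (\<lambda>x. \<Sum>i\<in>UNIV. \<Sum>j\<in>UNIV. dz i (dzb j f) x * (h x * ?U i j x))"
    by (intro Bochner_Integration.integrable_sum)
  moreover have "h x * hess_form f ws cs x = (\<Sum>i\<in>UNIV. \<Sum>j\<in>UNIV. dz i (dzb j f) x * (h x * ?U i j x))" for x
  proof -
    have "hess_form f ws cs x = (\<Sum>i\<in>UNIV. \<Sum>j\<in>UNIV. lhess f x $ i $ j * ?U i j x)"
      unfolding hess_form_def by (rule cform_head_expand[OF cform_polar_det len'])
    then show ?thesis
      by (simp add: lhess_def sum_distrib_left mult_ac)
  qed
  ultimately show ?thesis by simp
qed

lemma polar_det_zero_head: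
  assumes "Suc (length xs) = CARD('n)"
  shows "polar_det (0 # (xs :: ('n::finite) cmat list)) = 0"
  using cform_head_scale[OF cform_polar_det assms, of 0 0] by simp

text \<open>For a real function \<open>dz\<close> and \<open>dzb\<close> are conjugate, so conjugate
  transposition of the rank one matrix exchanges u and v and leaves the Hermitian matrices alone.
  The symmetry of the energy comes from here.\<close>

lemma grad_form_cnj:
  fixes u v :: "complex ^ 'n::finite \<Rightarrow> real"
  assumes S: "open S" "x \<in> S" and u: "C2on S (cx u)" and v: "C2on S (cx v)" and ws: "\<And>w. w \<in> set ws \<Longrightarrow> C2on S (cx w)"
    and cs: "set cs \<subseteq> hermitian_matrices" and len: "Suc (length ws + length cs) = CARD('n)"
  shows "grad_form (cx u) (cx v) (map cx ws) cs x = cnj (grad_form (cx v) (cx u) (map cx ws) cs x)"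
proof -
  let ?xs = "outer (\<chi> i. dz i (cx v) x) (\<chi> j. dzb j (cx u) x) # map (\<lambda>w. lhess w x) (map cx ws) @ cs"
  have eqm: "map ctrans ?xs = outer (\<chi> i. dz i (cx u) x) (\<chi> j. dzb j (cx v) x) # map (\<lambda>w. lhess w x) (map cx ws) @ cs"
  proof -
    have "ctrans (outer (\<chi> i. dz i (cx v) x) (\<chi> j. dzb j (cx u) x)) = outer (\<chi> i. dz i (cx u) x) (\<chi> j. dzb j (cx v) x)"
      using cnj_dz[OF C2on_imp_C1on[OF u] S(2)] cnj_dz[OF C2on_imp_C1on[OF v] S(2)]
      by (simp add: ctrans_def outer_def vec_eq_iff mult.commute)
    moreover have "map ctrans (map (\<lambda>w. lhess w x) (map cx ws)) = map (\<lambda>w. lhess w x) (map cx ws)"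
      using lhess_hermitian[OF ws S] by (simp add: ctrans_eq_iff_hermitian)
    moreover have "map ctrans cs = cs"
      using cs by (intro map_idI) (auto simp: ctrans_eq_iff_hermitian)
    ultimately show ?thesis by simp
  qed
  have "polar_det (map ctrans ?xs) = cnj (polar_det ?xs)"
    by (rule polar_det_ctrans) (use len in simp)
  then show ?thesis
    by (simp only: grad_form_def eqm)
qed

lemma hess_form_real:
  fixes v :: "complex ^ 'n::finite \<Rightarrow> real"
  assumes S: "open S" "x \<in> S" and v: "C2on S (cx v)" and ws: "\<And>w. w \<in> set ws \<Longrightarrow> C2on S (cx w)"
    and cs: "set cs \<subseteq> hermitian_matrices" and len: "Suc (length ws + length cs) = CARD('n)"
  shows "hess_form (cx v) (map cx ws) cs x \<in> \<real>"
  unfolding hess_form_def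
  by (rule polar_det_hermitian_real) (use lhess_hermitian[OF v S] lhess_hermitian[OF ws S] cs len in auto)

lemma cutoff_limit: "x \<in> S \<Longrightarrow> (\<lambda>n. cutoff S u n x) \<longlonglongrightarrow> complex_of_real (u x)"
proof -
  assume x: "x \<in> S"
  have "(\<lambda>n. 3 * (1 / real (Suc n))) \<longlonglongrightarrow> 3 * 0"
    by (intro tendsto_mult tendsto_const LIMSEQ_Suc[OF lim_1_over_n])
  then have lim: "(\<lambda>n. 3 * (1 / real (Suc n))) \<longlonglongrightarrow> 0"
    by (simp only: mult_zero_right)
  have "(\<lambda>n. trunc n (u x) - u x) \<longlonglongrightarrow> 0"
  proof (rule Lim_null_comparison[OF _ lim])
    show "\<forall>\<^sub>F n in sequentially. norm (trunc n (u x) - u x) \<le> 3 * (1 / real (Suc n))"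
      by (rule always_eventually) (use trunc_approx in simp)
  qed
  then have "(\<lambda>n. trunc n (u x)) \<longlonglongrightarrow> u x"
    by (simp add: LIM_zero_iff)
  then have "(\<lambda>n. complex_of_real (trunc n (u x))) \<longlonglongrightarrow> complex_of_real (u x)"
    by (rule tendsto_of_real)
  then show ?thesis using x by (simp add: cutoff_def)
qed

lemma cutoff_bound: "norm (cutoff S u n x) \<le> norm (complex_of_real (u x)) + 3"
proof -
  have "3 / real (Suc n) \<le> 3" by (simp add: field_simps)
  then have "\<bar>trunc n (u x)\<bar> \<le> \<bar>u x\<bar> + 3"
    using trunc_approx[of n "u x"] by linarith
  then show ?thesis by (simp add: cutoff_def)
qed

lemma trunc'_limit_cx: "(\<lambda>n. complex_of_real (trunc' n t)) \<longlonglongrightarrow> (if t = 0 then 0 else 1)"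
  using tendsto_of_real[OF trunc'_limit[of t], where 'a=complex] by (simp split: if_splits)

text \<open>The boundary values enter only through compactly supported truncations of the functions, so no
  divergence theorem on the domain is needed. The indicator of \<open>u \<noteq> 0\<close>, \<open>v \<noteq> 0\<close> is what
  the derivative of the truncation leaves in the limit; it is harmless for the symmetry and
  positivity of the resulting form.\<close>

lemma energy_identity:
  fixes u v :: "complex ^ 'n::finite \<Rightarrow> real"
  assumes S: "open S" "bounded S" and u: "C2zero S u" and v: "C2zero S v" and ws: "\<And>w. w \<in> set ws \<Longrightarrow> C2bd S w"
    and cs: "set cs \<subseteq> hermitian_matrices" and len: "Suc (length ws + length cs) = CARD('n)"
  shows "(LINT x|lborel. indicator S x *\<^sub>R (of_real (u x) * hess_form (cx v) (map cx ws) cs x)) =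
    - (LINT x|lborel. indicator S x *\<^sub>R ((if u x = 0 \<or> v x = 0 then 0 else 1) * grad_form (cx v) (cx u) (map cx ws) cs x))"
proof -
  let ?W = "map cx ws"
  let ?R = "\<lambda>x. map (\<lambda>w. lhess w x) ?W @ cs"
  let ?c = "\<lambda>w x. if w x = (0::real) then 0 else (1::complex)"
  have u2: "C2on S (cx u)" and v2: "C2on S (cx v)" and ub: "C2bd S u" and vb: "C2bd S v"
    using u v by (simp_all add: C2zero_def C2bd_def)
  have W: "w \<in> set ?W \<Longrightarrow> C2on S w" for w using ws by (auto simp: C2bd_def)
  have wc: "w \<in> set ws \<Longrightarrow> C2on S (cx w)" for w using ws by (auto simp: C2bd_def)
  have lenW: "Suc (length ?W + length cs) = CARD('n)" using len by simp
  have lenR: "Suc (length (?R x)) = CARD('n)" for x using len by simp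
  have uc: "continuous_on (closure S) u" "\<forall>x\<in>frontier S. u x = 0"
    and vc: "continuous_on (closure S) v" "\<forall>x\<in>frontier S. v x = 0"
    using u v by (auto simp: C2zero_def)
  let ?H = "hess_form (cx v) ?W cs" and ?G = "grad_form (cx v) (cx u) ?W cs"
  \<comment> \<open>Truncating \<open>u\<close> alone would leave the indicator of u \<noteq> 0,
    which is not symmetric in u and v. So for fixed n the Hessian is first moved from
    \<open>v\<close> to the truncated \<open>u\<close>; then \<open>v\<close> is truncated with
    index m, and m tending to infinity inserts the indicator of v \<noteq> 0. Only afterwards does n
    tend to infinity.\<close>
  have step: "(LINT x|lborel. cutoff S u n x * ?H x) = - (LINT x|lborel. ?c v x * grad_form (cx v) (cutoff S u n) ?W cs x)
     \<and> integrable lborel (\<lambda>x. ?c v x * grad_form (cx v) (cutoff S u n) ?W cs x)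
     \<and> (\<forall>x. grad_form (cx v) (cutoff S u n) ?W cs x = indicator S x *\<^sub>R (of_real (trunc' n (u x)) * ?G x))
     \<and> integrable lborel (\<lambda>x. cutoff S u n x * ?H x)" for n
  proof -
    obtain K where K: "compact K" "K \<subseteq> S" and f1: "C1c K (cutoff S u n)" "\<forall>e. C1c K (lderiv e (cutoff S u n))"
      and f2: "C2on S (cutoff S u n)"
      and fd': "\<forall>e. \<forall>x\<in>S. lderiv e (cutoff S u n) x = of_real (trunc' n (u x)) * lderiv e (cx u) x"
      using cutoff_props[OF S u2 uc, of n] by (elim exE conjE)
    note f = f1(1) f1(2)[rule_format] and fd = fd'[rule_format]
    let ?f = "cutoff S u n"
    note cl = compact_imp_closed[OF K(1)]
    have fz: "x \<notin> S \<Longrightarrow> x \<notin> K" for x using K(2) by auto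
    have dzf: "dz i ?f x = of_real (trunc' n (u x)) * dz i (cx u) x" "dzb i ?f x = of_real (trunc' n (u x)) * dzb i (cx u) x"
      if "x \<in> S" for i x
      using fd[OF that] by (simp_all add: dz_def dzb_def algebra_simps)
    have Gf: "grad_form (cx v) ?f ?W cs x = indicator S x *\<^sub>R (of_real (trunc' n (u x)) * ?G x)" for x
    proof (cases "x \<in> S")
      case True
      then show ?thesis
        unfolding grad_form_def dzf[OF True] outer_cscale cform_head_scale[OF cform_polar_det lenR] by simp
    next
      case False
      have "outer (\<chi> i. dz i (cx v) x) (\<chi> j. dzb j ?f x) = 0"
        using C1c_dzb_eq_0[OF f(1) cl fz[OF False]] by (simp add: outer_def vec_eq_iff)
      then show ?thesis
        using False polar_det_zero_head[OF lenR] by (simp add: grad_form_def)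
    qed
    have Gf': "grad_form ?f (cx v) ?W cs x = cnj (grad_form (cx v) ?f ?W cs x)" for x
    proof (cases "x \<in> S")
      case True
      have "grad_form ?f (cx v) ?W cs x = of_real (trunc' n (u x)) * grad_form (cx u) (cx v) ?W cs x"
        unfolding grad_form_def dzf[OF True] outer_cscale cform_head_scale[OF cform_polar_det lenR] ..
      also have "grad_form (cx u) (cx v) ?W cs x = cnj (?G x)"
        by (rule grad_form_cnj[OF S(1) True u2 v2 wc cs len])
      finally show ?thesis
        unfolding Gf using True by simp
    next
      case False
      have "outer (\<chi> i. dz i ?f x) (\<chi> j. dzb j (cx v) x) = 0"
        using C1c_dz_eq_0[OF f(1) cl fz[OF False]] by (simp add: outer_def vec_eq_iff)
      then show ?thesis
        unfolding Gf using False polar_det_zero_head[OF lenR] by (simp add: grad_form_def)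
    qed
    note A1 = ibp_cutoff[OF S(1) K lenW W f(1) v2]
    note A2 = ibp_test[OF S(1) K lenW W f C2on_imp_C1on[OF v2]]
    have fH: "cnj (?f x * ?H x) = ?f x * ?H x" for x
    proof (cases "x \<in> S")
      case True
      then show ?thesis
        using hess_form_real[OF S(1) True v2 wc cs len] by (simp add: cutoff_def Reals_cnj_iff)
    qed (simp add: cutoff_def)
    have iH: "integrable lborel (\<lambda>x. ?f x * ?H x)"
      by (rule integrable_cutoff_mult[OF C1cD(1)[OF f(1)] C1cD(4)[OF f(1)] K S(1) continuous_on_hess_form[OF v2 W lenW]])
    \<comment> \<open>\<open>ibp_cutoff\<close> yields the gradient form with the truncation in the
      first place, \<open>ibp_test\<close> with \<open>v\<close> there. The integral is real, so
      conjugation brings both to the same order.\<close>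
    have "(LINT x|lborel. ?f x * ?H x) = cnj (LINT x|lborel. ?f x * ?H x)"
      by (subst Bochner_Integration.integral_cnj[symmetric]) (simp only: fH)
    also have "\<dots> = - cnj (LINT x|lborel. cnj (grad_form (cx v) ?f ?W cs x))"
      by (simp only: A1(1) Gf' complex_cnj_minus)
    also have "\<dots> = - (LINT x|lborel. grad_form (cx v) ?f ?W cs x)"
      by (simp only: Bochner_Integration.integral_cnj complex_cnj_cnj)
    finally have B: "(LINT x|lborel. ?f x * ?H x) = - (LINT x|lborel. grad_form (cx v) ?f ?W cs x)" .
    let ?hf = "hess_form ?f ?W cs"
    have ihf: "integrable lborel (\<lambda>x. h x * ?hf x)" if "continuous_on S h" for h
      by (rule hess_form_test_integrable[OF S(1) K lenW W f that])
    have hfz: "?hf x = 0" if "x \<notin> S" for x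
    proof -
      have "dz i (dzb j ?f) x = 0" for i j
        by (rule C1c_dz_eq_0[OF C1c_dz(2)[OF f cl] cl fz[OF that]])
      then have "lhess ?f x = 0" by (simp add: lhess_def vec_eq_iff)
      then show ?thesis using polar_det_zero_head[OF lenR] by (simp add: hess_form_def)
    qed
    have C: "(LINT x|lborel. cutoff S v m x * ?hf x) = - (LINT x|lborel. of_real (trunc' m (v x)) * grad_form (cx v) ?f ?W cs x)
      \<and> integrable lborel (\<lambda>x. of_real (trunc' m (v x)) * grad_form (cx v) ?f ?W cs x)
      \<and> integrable lborel (\<lambda>x. cutoff S v m x * ?hf x)" for m
    proof -
      obtain L where L: "compact L" "L \<subseteq> S" and g: "C1c L (cutoff S v m)"
        and gd': "\<forall>e. \<forall>x\<in>S. lderiv e (cutoff S v m) x = of_real (trunc' m (v x)) * lderiv e (cx v) x"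
        using cutoff_props[OF S v2 vc, of m] by (elim exE conjE)
      note gd = gd'[rule_format]
      have dzg: "dz i (cutoff S v m) x = of_real (trunc' m (v x)) * dz i (cx v) x" if "x \<in> S" for i x
        using gd[OF that] by (simp add: dz_def algebra_simps)
      have eqf: "grad_form (cutoff S v m) ?f ?W cs = (\<lambda>x. of_real (trunc' m (v x)) * grad_form (cx v) ?f ?W cs x)"
      proof (rule ext)
        fix x
        show "grad_form (cutoff S v m) ?f ?W cs x = of_real (trunc' m (v x)) * grad_form (cx v) ?f ?W cs x"
      proof (cases "x \<in> S")
        case True
        show ?thesis
          unfolding grad_form_def dzg[OF True] outer_cscale cform_head_scale[OF cform_polar_det lenR] ..
      next
        case False
        have "outer (\<chi> i. dz i (cutoff S v m) x) (\<chi> j. dzb j ?f x) = 0"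
          using C1c_dzb_eq_0[OF f(1) cl fz[OF False]] by (simp add: outer_def vec_eq_iff)
        then show ?thesis
          unfolding Gf using False polar_det_zero_head[OF lenR] by (simp add: grad_form_def)
      qed
      qed
      have "integrable lborel (\<lambda>x. cutoff S v m x * ?hf x)"
        by (rule ihf) (rule C1cD(1)[OF g])
      then show ?thesis
        using ibp_cutoff[OF S(1) L lenW W g f2] unfolding eqf by blast
    qed
    have lim1: "(\<lambda>m. LINT x|lborel. cutoff S v m x * ?hf x) \<longlonglongrightarrow> (LINT x|lborel. cx v x * ?hf x)"
    proof (rule integral_dominated_convergence[where w="\<lambda>x. norm (cx v x * ?hf x) + 3 * norm (1 * ?hf x)"])
      show "(\<lambda>x. cx v x * ?hf x) \<in> borel_measurable lborel"
        by (rule borel_measurable_integrable, rule ihf, rule C1onD(1)[OF C2on_imp_C1on[OF v2]])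
      show "(\<lambda>x. cutoff S v m x * ?hf x) \<in> borel_measurable lborel" for m
        by (rule borel_measurable_integrable) (use C in blast)
      show "integrable lborel (\<lambda>x. norm (cx v x * ?hf x) + 3 * norm (1 * ?hf x))"
        by (intro Bochner_Integration.integrable_add integrable_mult_right integrable_norm ihf
            C1onD(1)[OF C2on_imp_C1on[OF v2]] continuous_on_const)
      show "AE x in lborel. (\<lambda>m. cutoff S v m x * ?hf x) \<longlonglongrightarrow> cx v x * ?hf x"
      proof (rule AE_I2)
        fix x
        show "(\<lambda>m. cutoff S v m x * ?hf x) \<longlonglongrightarrow> cx v x * ?hf x"
        proof (cases "x \<in> S")
          case True
          then show ?thesis
            by (intro tendsto_mult tendsto_const cutoff_limit)
        next
          case False
          then show ?thesis by (simp add: hfz)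
        qed
      qed
      show "AE x in lborel. norm (cutoff S v m x * ?hf x) \<le> norm (cx v x * ?hf x) + 3 * norm (1 * ?hf x)" for m
      proof (rule AE_I2)
        fix x
        have "norm (cutoff S v m x) * norm (?hf x) \<le> (norm (cx v x) + 3) * norm (?hf x)"
          by (intro mult_right_mono cutoff_bound) simp
        then show "norm (cutoff S v m x * ?hf x) \<le> norm (cx v x * ?hf x) + 3 * norm (1 * ?hf x)"
          by (simp add: norm_mult algebra_simps)
      qed
    qed
    have pt: "(\<lambda>m. of_real (trunc' m (v x)) * grad_form (cx v) ?f ?W cs x) \<longlonglongrightarrow> ?c v x * grad_form (cx v) ?f ?W cs x" for x
      by (intro tendsto_mult tendsto_const trunc'_limit_cx)
    have meas: "(\<lambda>x. ?c v x * grad_form (cx v) ?f ?W cs x) \<in> borel_measurable lborel"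
      by (rule borel_measurable_LIMSEQ_metric[OF _ pt]) (rule borel_measurable_integrable, use C in blast)
    note dom = meas borel_measurable_integrable[OF conjunct1[OF conjunct2[OF C]]]
      integrable_mult_right[OF integrable_norm[OF A2(2)], of 6]
    have dom1: "AE x in lborel. (\<lambda>m. of_real (trunc' m (v x)) * grad_form (cx v) ?f ?W cs x) \<longlonglongrightarrow> ?c v x * grad_form (cx v) ?f ?W cs x"
      by (rule AE_I2) (rule pt)
    have dom2: "AE x in lborel. norm (of_real (trunc' m (v x)) * grad_form (cx v) ?f ?W cs x) \<le> 6 * norm (grad_form (cx v) ?f ?W cs x)" for m
      by (rule AE_I2) (simp add: norm_mult mult_right_mono trunc'_bound)
    have lim2: "(\<lambda>m. LINT x|lborel. of_real (trunc' m (v x)) * grad_form (cx v) ?f ?W cs x) \<longlonglongrightarrow>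
        (LINT x|lborel. ?c v x * grad_form (cx v) ?f ?W cs x)"
      by (rule integral_dominated_convergence[OF dom dom1 dom2])
    have int2: "integrable lborel (\<lambda>x. ?c v x * grad_form (cx v) ?f ?W cs x)"
      by (rule integrable_dominated_convergence[OF dom dom1 dom2])
    have "(\<lambda>m. LINT x|lborel. cutoff S v m x * ?hf x) \<longlonglongrightarrow> - (LINT x|lborel. ?c v x * grad_form (cx v) ?f ?W cs x)"
      using tendsto_minus[OF lim2] C by (simp only:)
    from LIMSEQ_unique[OF lim1 this]
    have "(LINT x|lborel. cx v x * ?hf x) = - (LINT x|lborel. ?c v x * grad_form (cx v) ?f ?W cs x)" .
    then show ?thesis
      using B A2(1) int2 iH Gf by (simp only: simp_thms)
  qed
  have mH: "integrable lborel (\<lambda>x. indicator S x *\<^sub>R (h x * ?H x))" if "continuous_on S h" "bounded (h ` S)" for h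
    by (rule integrable_bounded_open[OF S continuous_on_mult[OF that(1) continuous_on_hess_form[OF v2 W lenW]]
          bounded_mult_image[OF that(2) bounded_hess_form[OF vb ws len]]])
  have mG: "integrable lborel (\<lambda>x. indicator S x *\<^sub>R ?G x)"
    by (rule integrable_bounded_open[OF S continuous_on_grad_form[OF v2 u2 W lenW] bounded_grad_form[OF vb ub ws len]])
  have cu: "continuous_on S (cx u)" "bounded (cx u ` S)"
    using ub C1onD(1)[OF C2on_imp_C1on[OF u2]] by (simp_all add: C2bd_def)
  have lim1: "(\<lambda>n. LINT x|lborel. cutoff S u n x * ?H x) \<longlonglongrightarrow> (LINT x|lborel. indicator S x *\<^sub>R (of_real (u x) * ?H x))"
  proof (rule integral_dominated_convergence[where w="\<lambda>x. norm (indicator S x *\<^sub>R (cx u x * ?H x)) + 3 * norm (indicator S x *\<^sub>R (1 * ?H x))"])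
    show "(\<lambda>x. indicator S x *\<^sub>R (of_real (u x) * ?H x)) \<in> borel_measurable lborel"
      by (rule borel_measurable_integrable[OF mH[OF cu]])
    show "(\<lambda>x. cutoff S u n x * ?H x) \<in> borel_measurable lborel" for n
      by (rule borel_measurable_integrable) (use step in blast)
    show "integrable lborel (\<lambda>x. norm (indicator S x *\<^sub>R (cx u x * ?H x)) + 3 * norm (indicator S x *\<^sub>R (1 * ?H x)))"
      by (intro Bochner_Integration.integrable_add integrable_mult_right integrable_norm mH cu continuous_on_const bounded_const_image)
    show "AE x in lborel. (\<lambda>n. cutoff S u n x * ?H x) \<longlonglongrightarrow> indicator S x *\<^sub>R (of_real (u x) * ?H x)"
    proof (rule AE_I2)
      fix x
      show "(\<lambda>n. cutoff S u n x * ?H x) \<longlonglongrightarrow> indicator S x *\<^sub>R (of_real (u x) * ?H x)"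
      proof (cases "x \<in> S")
        case True
        then have "(\<lambda>n. cutoff S u n x * ?H x) \<longlonglongrightarrow> cx u x * ?H x"
          by (intro tendsto_mult tendsto_const cutoff_limit)
        then show ?thesis using True by simp
      qed (simp add: cutoff_def)
    qed
    show "AE x in lborel. norm (cutoff S u n x * ?H x) \<le> norm (indicator S x *\<^sub>R (cx u x * ?H x)) + 3 * norm (indicator S x *\<^sub>R (1 * ?H x))" for n
    proof (rule AE_I2)
      fix x
      have "norm (cutoff S u n x) * norm (?H x) \<le> (norm (cx u x) + 3) * norm (?H x)"
        by (intro mult_right_mono cutoff_bound) simp
      then show "norm (cutoff S u n x * ?H x) \<le> norm (indicator S x *\<^sub>R (cx u x * ?H x)) + 3 * norm (indicator S x *\<^sub>R (1 * ?H x))"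
        by (cases "x \<in> S") (simp_all add: norm_mult algebra_simps cutoff_def)
    qed
  qed
  have pt: "(\<lambda>n. ?c v x * grad_form (cx v) (cutoff S u n) ?W cs x) \<longlonglongrightarrow>
      indicator S x *\<^sub>R ((if u x = 0 \<or> v x = 0 then 0 else 1) * ?G x)" for x
  proof -
    have "(\<lambda>n. ?c v x * (indicator S x *\<^sub>R (of_real (trunc' n (u x)) * ?G x))) \<longlonglongrightarrow> ?c v x * (indicator S x *\<^sub>R (?c u x * ?G x))"
      by (intro tendsto_mult tendsto_scaleR tendsto_const trunc'_limit_cx)
    moreover have "?c v x * (indicator S x *\<^sub>R (?c u x * ?G x)) = indicator S x *\<^sub>R ((if u x = 0 \<or> v x = 0 then 0 else 1) * ?G x)"
      by simp
    ultimately show ?thesis using step by (simp only:)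
  qed
  have lim2: "(\<lambda>n. LINT x|lborel. ?c v x * grad_form (cx v) (cutoff S u n) ?W cs x) \<longlonglongrightarrow>
      (LINT x|lborel. indicator S x *\<^sub>R ((if u x = 0 \<or> v x = 0 then 0 else 1) * ?G x))"
  proof (rule integral_dominated_convergence[where w="\<lambda>x. 6 * norm (indicator S x *\<^sub>R ?G x)"])
    show m: "(\<lambda>x. ?c v x * grad_form (cx v) (cutoff S u n) ?W cs x) \<in> borel_measurable lborel" for n
      by (rule borel_measurable_integrable) (use step in blast)
    show "(\<lambda>x. indicator S x *\<^sub>R ((if u x = 0 \<or> v x = 0 then 0 else 1) * ?G x)) \<in> borel_measurable lborel"
      by (rule borel_measurable_LIMSEQ_metric[OF m pt])
    show "integrable lborel (\<lambda>x. 6 * norm (indicator S x *\<^sub>R ?G x))"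
      by (intro integrable_mult_right integrable_norm mG)
    show "AE x in lborel. (\<lambda>n. ?c v x * grad_form (cx v) (cutoff S u n) ?W cs x) \<longlonglongrightarrow>
        indicator S x *\<^sub>R ((if u x = 0 \<or> v x = 0 then 0 else 1) * ?G x)"
      by (rule AE_I2) (rule pt)
    show "AE x in lborel. norm (?c v x * grad_form (cx v) (cutoff S u n) ?W cs x) \<le> 6 * norm (indicator S x *\<^sub>R ?G x)" for n
    proof (rule AE_I2)
      fix x
      have g: "grad_form (cx v) (cutoff S u n) ?W cs x = indicator S x *\<^sub>R (of_real (trunc' n (u x)) * ?G x)"
        using step by blast
      show "norm (?c v x * grad_form (cx v) (cutoff S u n) ?W cs x) \<le> 6 * norm (indicator S x *\<^sub>R ?G x)"
        unfolding g by (cases "x \<in> S") (simp_all add: norm_mult mult_right_mono trunc'_bound)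
    qed
  qed
  have "(\<lambda>n. LINT x|lborel. cutoff S u n x * ?H x) \<longlonglongrightarrow>
      - (LINT x|lborel. indicator S x *\<^sub>R ((if u x = 0 \<or> v x = 0 then 0 else 1) * ?G x))"
    using tendsto_minus[OF lim2] step by (simp only:)
  from LIMSEQ_unique[OF lim1 this] show ?thesis .
qed

section \<open>The energy: symmetry and positivity in the first two places\<close>

definition energy :: "(complex ^ 'n::finite) set \<Rightarrow> (complex ^ 'n \<Rightarrow> real) list \<Rightarrow> 'n cmat list \<Rightarrow>
    (complex ^ 'n \<Rightarrow> real) \<Rightarrow> (complex ^ 'n \<Rightarrow> real) \<Rightarrow> real" where
  "energy S ws cs u v = - Re (LINT x|lborel. indicator S x *\<^sub>R (of_real (u x) * hess_form (cx v) (map cx ws) cs x))"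

lemma energy_sym:
  fixes u v :: "complex ^ 'n::finite \<Rightarrow> real"
  assumes S: "open S" "bounded S" and u: "C2zero S u" and v: "C2zero S v" and ws: "\<And>w. w \<in> set ws \<Longrightarrow> C2bd S w"
    and cs: "set cs \<subseteq> hermitian_matrices" and len: "Suc (length ws + length cs) = CARD('n)"
  shows "energy S ws cs u v = energy S ws cs v u"
proof -
  have u2: "C2on S (cx u)" and v2: "C2on S (cx v)" and wc: "\<And>w. w \<in> set ws \<Longrightarrow> C2on S (cx w)"
    using u v ws by (simp_all add: C2zero_def C2bd_def)
  let ?f = "\<lambda>x. indicator S x *\<^sub>R ((if u x = 0 \<or> v x = 0 then 0 else 1) * grad_form (cx v) (cx u) (map cx ws) cs x)"
  let ?g = "\<lambda>x. indicator S x *\<^sub>R ((if v x = 0 \<or> u x = 0 then 0 else 1) * grad_form (cx u) (cx v) (map cx ws) cs x)"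
  have "?g = (\<lambda>x. cnj (?f x))"
  proof
    fix x
    show "?g x = cnj (?f x)"
      by (cases "x \<in> S") (auto simp: grad_form_cnj[OF S(1) _ u2 v2 wc cs len])
  qed
  then have "(LINT x|lborel. ?g x) = cnj (LINT x|lborel. ?f x)"
    by (simp only: Bochner_Integration.integral_cnj)
  then have "Re (LINT x|lborel. ?g x) = Re (LINT x|lborel. ?f x)"
    by simp
  moreover have "energy S ws cs u v = - Re (- (LINT x|lborel. ?f x))"
    unfolding energy_def by (rule arg_cong[where f="\<lambda>z. - Re z"], rule energy_identity[OF S u v _ cs len]) (rule ws)
  moreover have "energy S ws cs v u = - Re (- (LINT x|lborel. ?g x))"
    unfolding energy_def by (rule arg_cong[where f="\<lambda>z. - Re z"], rule energy_identity[OF S v u _ cs len]) (rule ws)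
  ultimately show ?thesis by simp
qed

lemma energy_nonneg:
  fixes u :: "complex ^ 'n::finite \<Rightarrow> real"
  assumes S: "open S" "bounded S" and u: "C2zero S u" and ws: "\<And>w. w \<in> set ws \<Longrightarrow> C2bd S w"
    and k: "Suc (length ws) = k" "k \<le> CARD('n)"
    and G: "\<And>w x. w \<in> set ws \<Longrightarrow> x \<in> S \<Longrightarrow> eigenvalue_vector (lhess (cx w) x) \<in> Gamma_cone k"
  shows "0 \<le> energy S ws (replicate (CARD('n) - k) (mat 1)) u u"
proof -
  let ?cs = "replicate (CARD('n) - k) (mat 1) :: 'n cmat list"
  have cs: "set ?cs \<subseteq> hermitian_matrices" by auto
  have len: "Suc (length ws + length ?cs) = CARD('n)" using k by simp
  have u2: "C2on S (cx u)" and ub: "C2bd S u" and wc: "\<And>w. w \<in> set ws \<Longrightarrow> C2on S (cx w)"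
    using u ws by (simp_all add: C2zero_def C2bd_def)
  let ?f = "\<lambda>x. indicator S x *\<^sub>R ((if u x = 0 \<or> u x = 0 then 0 else 1) * grad_form (cx u) (cx u) (map cx ws) ?cs x)"
  have pos: "0 \<le> Re (?f x)" for x
  proof (cases "x \<in> S")
    case True
    have "(\<chi> j. dzb j (cx u) x) = (\<chi> j. cnj ((\<chi> i. dz i (cx u) x) $ j))"
      using cnj_dz(1)[OF C2on_imp_C1on[OF u2] True] by simp
    then have "grad_form (cx u) (cx u) (map cx ws) ?cs x =
        polar_S (outer (\<chi> i. dz i (cx u) x) (\<chi> j. cnj ((\<chi> i. dz i (cx u) x) $ j)) # map (\<lambda>w. lhess (cx w) x) ws)"
      using k by (simp add: grad_form_def polar_S_def o_def)
    moreover have "0 \<le> Re (polar_S (outer (\<chi> i. dz i (cx u) x) (\<chi> j. cnj ((\<chi> i. dz i (cx u) x) $ j)) # map (\<lambda>w. lhess (cx w) x) ws))"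
      by (rule polar_S_outer_nonneg[OF k(2)]) (use k G True lhess_hermitian[OF wc S(1) True] in auto)
    ultimately show ?thesis using True by simp
  qed simp
  have "energy S ws ?cs u u = - Re (- (LINT x|lborel. ?f x))"
    unfolding energy_def by (rule arg_cong[where f="\<lambda>z. - Re z"], rule energy_identity[OF S u u _ cs len]) (rule ws)
  then have "energy S ws ?cs u u = Re (LINT x|lborel. ?f x)"
    by simp
  also have "0 \<le> \<dots>"
  proof (cases "integrable lborel ?f")
    case True
    have "Re (LINT x|lborel. ?f x) = (LINT x|lborel. Re (?f x))"
      by (rule integral_Re[OF True, symmetric])
    also have "0 \<le> \<dots>"
      by (intro Bochner_Integration.integral_nonneg pos)
    finally show ?thesis .
  next
    \<comment> \<open>A function that is not integrable has integral 0 by convention.\<close>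
    case False
    then show ?thesis by (simp only: not_integrable_integral_eq[OF False]) simp
  qed
  finally show ?thesis .
qed

subsection \<open>Frechet derivatives and line derivatives\<close>

lemma differentiable_imp_line_derivative:
  assumes "f differentiable (at x)"
  shows "((\<lambda>t. f (x + t *\<^sub>R v)) has_vector_derivative dir_deriv v f x) (at 0)"
proof -
  let ?F = "frechet_derivative f (at x)"
  have F: "(f has_derivative ?F) (at x)"
    using assms frechet_derivative_works by blast
  have "((\<lambda>t. x + t *\<^sub>R v) has_derivative (\<lambda>t. t *\<^sub>R v)) (at 0)"
    by (auto intro!: derivative_eq_intros)
  moreover have "(f has_derivative ?F) (at (x + 0 *\<^sub>R v))" using F by simp
  ultimately have "((\<lambda>t. f (x + t *\<^sub>R v)) has_derivative (\<lambda>t. ?F (t *\<^sub>R v))) (at 0)"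
    by (rule has_derivative_compose)
  moreover have "?F (t *\<^sub>R v) = t *\<^sub>R ?F v" for t
    using has_derivative_linear[OF F] by (simp add: linear_scale)
  ultimately show ?thesis
    by (simp add: has_vector_derivative_def dir_deriv_def)
qed

lemma dir_deriv_eq_lderiv: "f differentiable (at x) \<Longrightarrow> dir_deriv v f x = lderiv v f x"
  by (rule lderiv_eq[symmetric]) (rule differentiable_imp_line_derivative)

lemma differentiable_cx:
  assumes "u differentiable (at x)"
  shows "cx u differentiable (at x)"
proof -
  obtain F where "(u has_derivative F) (at x)" using assms by (auto simp: differentiable_def)
  from bounded_linear.has_derivative[OF bounded_linear_of_real this]
  show ?thesis by (auto simp: differentiable_def)
qed

lemma lderiv_cx:
  assumes "u differentiable (at x)"
  shows "has_lderiv v (cx u) (complex_of_real (dir_deriv v u x)) x"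
    "lderiv v (cx u) x = complex_of_real (dir_deriv v u x)"
proof -
  show "has_lderiv v (cx u) (complex_of_real (dir_deriv v u x)) x"
    by (rule bounded_linear.has_vector_derivative[OF bounded_linear_of_real differentiable_imp_line_derivative[OF assms]])
  then show "lderiv v (cx u) x = complex_of_real (dir_deriv v u x)"
    by (rule lderiv_eq)
qed

text \<open>\<open>complex_Hessian\<close> is built from Frechet derivatives whereas
  \<open>C2bd\<close> records line derivatives, so both conditions are carried along and checked
  directly for u + v.\<close>

definition twice_diff :: "'a::real_normed_vector set \<Rightarrow> ('a \<Rightarrow> real) \<Rightarrow> bool" where
  "twice_diff D f \<longleftrightarrow> (\<forall>x\<in>D. f differentiable (at x) \<and> (\<forall>v. dir_deriv v f differentiable (at x)))"

lemma C1on_cx: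
  assumes "open D" "\<And>x. x \<in> D \<Longrightarrow> u differentiable (at x)" "\<And>v. continuous_on D (dir_deriv v u)"
  shows "C1on D (cx u)"
proof (rule C1onI[where g="\<lambda>v x. complex_of_real (dir_deriv v u x)"])
  have "continuous_on D u"
    using assms(1,2) by (meson differentiable_at_withinI differentiable_imp_continuous_on differentiable_on_def)
  then show "continuous_on D (cx u)"
    by (rule continuous_on_of_real)
  show "continuous_on D (\<lambda>x. complex_of_real (dir_deriv v u x))" for v
    by (intro continuous_on_of_real assms)
  show "has_lderiv v (cx u) (complex_of_real (dir_deriv v u x)) x" if "x \<in> D" for v x
    by (rule lderiv_cx(1)[OF assms(2)[OF that]])
qed

lemma Ck_closure_2_imp:
  fixes u :: "'a::euclidean_space \<Rightarrow> real"
  assumes D: "open D" "bounded D" and u: "Ck_closure 2 D u"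
  shows "twice_diff D u" "C2bd D u" "continuous_on (closure D) u"
proof -
  have d: "iter_dir_deriv vs u differentiable_on D" if "length vs < 2" for vs
    using u that by (simp add: Ck_closure_def Ck_on_def)
  have c: "continuous_on D (iter_dir_deriv vs u)" if "length vs \<le> 2" for vs
    using u that by (simp add: Ck_closure_def Ck_on_def)
  \<comment> \<open>Each derivative extends continuously to the compact closure, hence is
    bounded.\<close>
  have b: "bounded (iter_dir_deriv vs u ` D)" if vs: "length vs \<le> 2" for vs
  proof -
    obtain g where g: "continuous_on (closure D) g" "\<forall>x\<in>D. g x = iter_dir_deriv vs u x"
      using u vs unfolding Ck_closure_def by blast
    have "compact (closure D)" using D(2) by simp
    then have "bounded (g ` closure D)"
      by (intro compact_imp_bounded compact_continuous_image g)
    then have "bounded (g ` D)"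
      by (rule bounded_subset) (intro image_mono closure_subset)
    then show ?thesis
      by (rule bounded_image_cong) (use g in auto)
  qed
  have 0: "u differentiable (at x)" if "x \<in> D" for x
    using d[of "[]"] that D(1) by (simp add: differentiable_on_eq_differentiable_at)
  have 1: "dir_deriv v u differentiable (at x)" if "x \<in> D" for x v
    using d[of "[v]"] that D(1) by (simp add: differentiable_on_eq_differentiable_at)
  show td: "twice_diff D u" using 0 1 by (simp add: twice_diff_def)
  have c1: "continuous_on D (dir_deriv v u)" for v using c[of "[v]"] by simp
  have c2: "continuous_on D (dir_deriv w (dir_deriv v u))" for v w using c[of "[w, v]"] by simp
  have C1: "C1on D (cx u)" by (rule C1on_cx[OF D(1) 0 c1])
  have l1: "cx (dir_deriv v u) x = lderiv v (cx u) x" if "x \<in> D" for v x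
    by (rule lderiv_cx(2)[OF 0[OF that], symmetric])
  have C1': "C1on D (cx (dir_deriv v u))" for v
    by (rule C1on_cx[OF D(1) 1 c2])
  have C2: "C2on D (cx u)"
    unfolding C2on_def using C1 C1on_cong_open(1)[OF C1' D(1) l1] by blast
  have l2: "cx (dir_deriv w (dir_deriv v u)) x = lderiv w (lderiv v (cx u)) x" if "x \<in> D" for v w x
  proof -
    have "lderiv w (lderiv v (cx u)) x = lderiv w (cx (dir_deriv v u)) x"
      by (rule C1on_cong_open(2)[OF C1' D(1) l1 that])
    also have "\<dots> = cx (dir_deriv w (dir_deriv v u)) x"
      by (rule lderiv_cx(2)[OF 1[OF that]])
    finally show ?thesis by (rule sym)
  qed
  have bc: "bounded (cx f ` D)" if "bounded (f ` D)" for f :: "'a \<Rightarrow> real"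
    using that unfolding bounded_iff by auto
  show "C2bd D u"
    unfolding C2bd_def
  proof (intro conjI allI C2)
    show "bounded (cx u ` D)" using bc b[of "[]"] by simp
    show "bounded (lderiv v (cx u) ` D)" for v
      by (rule bounded_image_cong[OF bc l1]) (use b[of "[v]"] in auto)
    show "bounded ((\<lambda>x. lderiv w (lderiv v (cx u)) x) ` D)" for w v
      by (rule bounded_image_cong[OF bc l2]) (use b[of "[w, v]"] in auto)
  qed
  show "continuous_on (closure D) u" using u by (simp add: Ck_closure_def)
qed

text \<open>The directional derivative agrees with the line derivative at points of
  differentiability, so \<open>d_zbar j\<close> has to be shown differentiable at x; on the open set
  it equals a combination of differentiable functions.\<close>

lemma complex_Hessian_eq_lhess:
  fixes u :: "complex ^ 'n::finite \<Rightarrow> real"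
  assumes D: "open D" "x \<in> D" and u: "twice_diff D u"
  shows "complex_Hessian u x = lhess (cx u) x"
proof -
  have 0: "u differentiable (at y)" and 1: "dir_deriv v u differentiable (at y)" if "y \<in> D" for y v
    using u that by (auto simp: twice_diff_def)
  have zb: "d_zbar j (cx u) y = dzb j (cx u) y" if "y \<in> D" for j y
    using dir_deriv_eq_lderiv[OF differentiable_cx[OF 0[OF that]]] by (simp add: d_zbar_def dzb_def add_divide_distrib)
  have df: "d_zbar j (cx u) differentiable (at x)" for j
  proof -
    let ?Z = "\<lambda>y. (cx (dir_deriv (axis j 1) u) y + \<i> * cx (dir_deriv (axis j \<i>) u) y) * (1 / 2)"
    have "?Z differentiable (at x)"
      by (intro differentiable_mult differentiable_add differentiable_cx 1 D differentiable_const)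
    then obtain F where F: "(?Z has_derivative F) (at x)" by (auto simp: differentiable_def)
    have "(d_zbar j (cx u) has_derivative F) (at x)"
    proof (rule has_derivative_transform_within_open[OF F D])
      fix y assume "y \<in> D"
      then show "?Z y = d_zbar j (cx u) y"
        using dir_deriv_eq_lderiv[OF differentiable_cx[OF 0]] lderiv_cx(2)[OF 0] by (simp add: d_zbar_def)
    qed
    then show ?thesis by (auto simp: differentiable_def)
  qed
  have "dir_deriv v (d_zbar j (cx u)) x = lderiv v (dzb j (cx u)) x" for v j
  proof -
    have "has_lderiv v (dzb j (cx u)) (dir_deriv v (d_zbar j (cx u)) x) x"
      by (rule has_lderiv_transform[OF differentiable_imp_line_derivative[OF df] D zb])
    then show ?thesis by (rule lderiv_eq[symmetric])
  qed
  then show ?thesis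
    by (simp add: complex_Hessian_def lhess_def vec_eq_iff d_z_def dz_def[of _ "dzb _ _"] diff_divide_distrib)
qed

lemma twice_diff_add:
  fixes u v :: "'a::real_normed_vector \<Rightarrow> real"
  assumes D: "open D" and u: "twice_diff D u" and v: "twice_diff D v"
  shows "twice_diff D (\<lambda>x. u x + v x)"
  unfolding twice_diff_def
proof (intro ballI conjI allI)
  fix x w assume x: "x \<in> D"
  have d: "u differentiable (at y)" "v differentiable (at y)" if "y \<in> D" for y
    using u v that by (auto simp: twice_diff_def)
  show "(\<lambda>x. u x + v x) differentiable (at x)"
    by (intro differentiable_add d x)
  have "dir_deriv w (\<lambda>x. u x + v x) y = dir_deriv w u y + dir_deriv w v y" if "y \<in> D" for y
  proof -
    have "((\<lambda>t. u (y + t *\<^sub>R w) + v (y + t *\<^sub>R w)) has_vector_derivative dir_deriv w u y + dir_deriv w v y) (at 0)"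
      by (intro has_vector_derivative_add differentiable_imp_line_derivative d that)
    moreover have "((\<lambda>t. u (y + t *\<^sub>R w) + v (y + t *\<^sub>R w)) has_vector_derivative dir_deriv w (\<lambda>x. u x + v x) y) (at 0)"
      by (rule differentiable_imp_line_derivative) (intro differentiable_add d that)
    ultimately show ?thesis
      using vector_derivative_unique_at by blast
  qed
  note eq = this
  have "(\<lambda>y. dir_deriv w u y + dir_deriv w v y) differentiable (at x)"
    using u v x by (intro differentiable_add) (auto simp: twice_diff_def)
  then obtain F where F: "((\<lambda>y. dir_deriv w u y + dir_deriv w v y) has_derivative F) (at x)"
    by (auto simp: differentiable_def)
  have "(dir_deriv w (\<lambda>x. u x + v x) has_derivative F) (at x)"
    by (rule has_derivative_transform_within_open[OF F D x]) (rule eq[symmetric])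
  then show "dir_deriv w (\<lambda>x. u x + v x) differentiable (at x)" by (auto simp: differentiable_def)
qed

lemma C2bd_lincomb:
  assumes S: "open S" and u: "C2bd S u" and v: "C2bd S v"
  shows "C2bd S (\<lambda>x. a * u x + b * v x)"
proof -
  have eq: "cx (\<lambda>x. a * u x + b * v x) = (\<lambda>x. of_real a * cx u x + of_real b * cx v x)"
    by simp
  let ?g = "\<lambda>x. of_real a * cx u x + of_real b * cx v x"
  have u2: "C2on S (cx u)" and v2: "C2on S (cx v)" using u v by (simp_all add: C2bd_def)
  note u1 = C2on_imp_C1on[OF u2] and v1 = C2on_imp_C1on[OF v2]
  have l1: "of_real a * lderiv w (cx u) x + of_real b * lderiv w (cx v) x = lderiv w ?g x" if "x \<in> S" for w x
    by (rule C1on_lincomb(2)[OF u1 v1 that, symmetric])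
  have C1': "C1on S (\<lambda>x. of_real a * lderiv w (cx u) x + of_real b * lderiv w (cx v) x)" for w
    by (rule C1on_lincomb(1)[OF C2on_lderiv[OF u2] C2on_lderiv[OF v2]])
  have C2: "C2on S ?g"
    unfolding C2on_def using C1on_lincomb(1)[OF u1 v1] C1on_cong_open(1)[OF C1' S l1] by blast
  have l2: "of_real a * lderiv e (lderiv w (cx u)) x + of_real b * lderiv e (lderiv w (cx v)) x = lderiv e (lderiv w ?g) x"
    if "x \<in> S" for e w x
  proof -
    have "lderiv e (lderiv w ?g) x = lderiv e (\<lambda>x. of_real a * lderiv w (cx u) x + of_real b * lderiv w (cx v) x) x"
      by (rule C1on_cong_open(2)[OF C1' S l1 that])
    also have "\<dots> = of_real a * lderiv e (lderiv w (cx u)) x + of_real b * lderiv e (lderiv w (cx v)) x"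
      by (rule C1on_lincomb(2)[OF C2on_lderiv[OF u2] C2on_lderiv[OF v2] that])
    finally show ?thesis by (rule sym)
  qed
  have bu: "bounded (cx u ` S)" "bounded (lderiv w (cx u) ` S)" "bounded ((\<lambda>x. lderiv e (lderiv w (cx u)) x) ` S)" for e w
    using u by (simp_all add: C2bd_def)
  have bv: "bounded (cx v ` S)" "bounded (lderiv w (cx v) ` S)" "bounded ((\<lambda>x. lderiv e (lderiv w (cx v)) x) ` S)" for e w
    using v by (simp_all add: C2bd_def)
  show ?thesis
    unfolding C2bd_def eq
  proof (intro conjI allI C2)
    show "bounded (?g ` S)"
      by (intro bounded_add_image bounded_mult_image bounded_const_image bu bv)
    show "bounded (lderiv w ?g ` S)" for w
      by (rule bounded_image_cong[OF _ l1]) (intro bounded_add_image bounded_mult_image bounded_const_image bu bv)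
    show "bounded ((\<lambda>x. lderiv e (lderiv w ?g) x) ` S)" for e w
      by (rule bounded_image_cong[OF _ l2]) (intro bounded_add_image bounded_mult_image bounded_const_image bu bv)
  qed
qed

lemma C2zero_lincomb:
  assumes "open S" "C2zero S u" "C2zero S v"
  shows "C2zero S (\<lambda>x. a * u x + b * v x)"
  using assms C2bd_lincomb[of S u v a b] unfolding C2zero_def by (auto intro!: continuous_intros)

subsection \<open>Positive semidefinite symmetric forms\<close>

lemma quadratic_nonneg_imp_discriminant:
  fixes A B C :: real
  assumes "\<And>s t. 0 \<le> s * s * A + 2 * s * t * B + t * t * C"
  shows "B\<^sup>2 \<le> A * C"
proof -
  have C: "0 \<le> C" using assms[of 0 1] by simp
  show ?thesis
  proof (cases "C = 0")
    case True
    have "B = 0"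
    proof (rule ccontr)
      assume "B \<noteq> 0"
      \<comment> \<open>For C = 0 and s = 1 the form is A + 2 t B; this t brings it to -1.\<close>
      then have "1 * 1 * A + 2 * 1 * (- (A + 1) / (2 * B)) * B + (- (A + 1) / (2 * B)) * (- (A + 1) / (2 * B)) * C = - 1"
        using True by (simp, simp add: field_simps)
      then show False using assms[of 1 "- (A + 1) / (2 * B)"] by linarith
    qed
    then show ?thesis using True by simp
  next
    case False
    then have "0 < C" using C by simp
    \<comment> \<open>The minimizing ratio t / s = - B / C, cleared of its denominator.\<close>
    have "C * C * A + 2 * C * (- B) * B + (- B) * (- B) * C = C * (A * C - B\<^sup>2)"
      by (simp add: power2_eq_square algebra_simps)
    then have "0 \<le> C * (A * C - B\<^sup>2)" using assms[of C "- B"] by simp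
    then show ?thesis using \<open>0 < C\<close> by (simp add: zero_le_mult_iff)
  qed
qed

text \<open>Among the tuples maximizing the normalized form, one with the most equal entries is constant:
  Cauchy--Schwarz in two distinct entries \<open>x\<close>, \<open>y\<close> shows that replacing \<open>y\<close> by \<open>x\<close>
  preserves maximality.\<close>

lemma cauchy_schwarz_mixed_bound:
  fixes Q :: "'a list \<Rightarrow> real" and c :: "'a \<Rightarrow> real"
  assumes X: "finite X"
    and sym: "\<And>us us'. set us \<subseteq> X \<Longrightarrow> length us = p \<Longrightarrow> mset us = mset us' \<Longrightarrow> Q us = Q us'"
    and CS: "\<And>a b R. a \<in> X \<Longrightarrow> b \<in> X \<Longrightarrow> set R \<subseteq> X \<Longrightarrow> length R + 2 = p \<Longrightarrow>
      (Q (a # b # R))\<^sup>2 \<le> Q (a # a # R) * Q (b # b # R)"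
    and c: "\<And>x. x \<in> X \<Longrightarrow> 0 < c x" "\<And>x. x \<in> X \<Longrightarrow> \<bar>Q (replicate p x)\<bar> \<le> c x ^ p"
    and us: "set us \<subseteq> X" "length us = p" "p \<noteq> 0"
  shows "\<bar>Q us\<bar> \<le> prod_list (map c us)"
proof -
  define L where "L = {us. set us \<subseteq> X \<and> length us = p}"
  define g where "g = (\<lambda>us. \<bar>Q us\<bar> / prod_list (map c us))"
  have finL: "finite L" unfolding L_def by (rule finite_lists_length_eq[OF X])
  have pp: "0 < prod_list (map c us)" if "set us \<subseteq> X" for us
    using that c(1) by (induction us) auto
  have gsym: "g us = g us'" if "us \<in> L" "mset us = mset us'" for us us'
  proof -
    have "prod_list (map c us) = prod_list (map c us')"
      using that(2) by (metis mset_map prod_mset_prod_list)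
    then show ?thesis using that sym by (simp add: g_def L_def)
  qed
  define m where "m = Max (g ` L)"
  have usL: "us \<in> L" using us by (simp add: L_def)
  have le_m: "g us \<le> m" if "us \<in> L" for us
    unfolding m_def using finL that by simp
  have "m \<in> g ` L" unfolding m_def by (rule Max_in) (use finL usL in auto)
  then obtain u0 where u0: "u0 \<in> L" "g u0 = m" by auto
  \<comment> \<open>Pairs of a maximizing tuple and one of its entries; z is chosen so that the
    multiplicity of that entry is largest.\<close>
  let ?P = "\<lambda>z. fst z \<in> L \<and> g (fst z) = m \<and> snd z \<in> set (fst z)"
  have "u0 \<noteq> []" using u0 us by (auto simp: L_def)
  then have "?P (u0, hd u0)" using u0 by simp
  moreover have "\<forall>z. ?P z \<longrightarrow> count (mset (fst z)) (snd z) < Suc p"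
    by (auto simp: L_def less_Suc_eq_le) (metis count_le_size size_mset)
  ultimately obtain z where z: "?P z" "\<And>y. ?P y \<Longrightarrow> count (mset (fst y)) (snd y) \<le> count (mset (fst z)) (snd z)"
    using ex_has_greatest_nat[of ?P "(u0, hd u0)" "\<lambda>z. count (mset (fst z)) (snd z)" "Suc p"] by (metis less_imp_le)
  obtain w x where wx: "z = (w, x)" by (cases z)
  have w: "w \<in> L" "g w = m" "x \<in> set w" using z(1) wx by auto
  have xX: "x \<in> X" using w by (auto simp: L_def)
  have "m \<le> 1"
  proof (cases "\<forall>y\<in>set w. y = x")
    case True
    then have "w = replicate p x"
      using w(1) by (simp add: L_def replicate_eqI)
    then have "m = \<bar>Q (replicate p x)\<bar> / c x ^ p"
      using w(2) by (simp add: g_def)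
    also have "\<dots> \<le> 1"
      using c[OF xX] by (simp add: divide_le_eq)
    finally show ?thesis .
  next
    case False
    then obtain y where y: "y \<in> set w" "y \<noteq> x" by blast
    have yX: "y \<in> X" using y w by (auto simp: L_def)
    obtain R where R: "mset w = mset (x # y # R)"
    proof -
      have "mset w = add_mset x (mset w - {#x#})"
        using w(3) by simp
      moreover have "y \<in># mset w - {#x#}"
        using y by (simp add: in_diff_count)
      then have "mset w - {#x#} = add_mset y (mset w - {#x#} - {#y#})"
        by (rule insert_DiffM[symmetric])
      moreover obtain R where "mset R = mset w - {#x#} - {#y#}"
        using ex_mset by blast
      ultimately have "mset w = mset (x # y # R)" by simp
      then show ?thesis by (rule that)
    qed
    have setw: "set w = set (x # y # R)" using R by (metis set_mset_mset)
    have "length w = length (x # y # R)" using R by (metis size_mset)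
    then have len: "length R + 2 = p" using w(1) by (simp add: L_def)
    have RX: "set R \<subseteq> X" using setw w(1) by (auto simp: L_def)
    have inL: "a # b # R \<in> L" if "a \<in> X" "b \<in> X" for a b
      using that RX len by (simp add: L_def)
    have gm: "g (x # y # R) = m" using gsym[OF w(1) R] w(2) by simp
    show ?thesis
    proof (rule ccontr)
      assume "\<not> m \<le> 1"
      then have m: "0 < m" by simp
      let ?r = "prod_list (map c R)"
      have r: "0 < ?r" by (rule pp[OF RX])
      have cx: "0 < c x" "0 < c y" using c xX yX by auto
      have "(g (x # y # R))\<^sup>2 \<le> g (x # x # R) * g (y # y # R)"
      proof -
        have "(g (x # y # R))\<^sup>2 = (Q (x # y # R))\<^sup>2 / (c x * (c y * ?r))\<^sup>2"
          by (simp add: g_def power_divide)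
        also have "\<dots> \<le> (Q (x # x # R) * Q (y # y # R)) / (c x * (c y * ?r))\<^sup>2"
          by (intro divide_right_mono CS xX yX RX len) simp
        also have "\<dots> \<le> \<bar>Q (x # x # R) * Q (y # y # R)\<bar> / (c x * (c y * ?r))\<^sup>2"
          by (intro divide_right_mono) auto
        also have "\<dots> = g (x # x # R) * g (y # y # R)"
          by (simp add: g_def abs_mult power2_eq_square mult_ac)
        finally show ?thesis .
      qed
      also have "\<dots> \<le> g (x # x # R) * m"
      proof (rule mult_left_mono)
        show "g (y # y # R) \<le> m" by (intro le_m inL yX)
        show "0 \<le> g (x # x # R)"
          using pp[of "x # x # R"] xX RX by (simp add: g_def del: prod_list.Cons)
      qed
      finally have "m * m \<le> g (x # x # R) * m" by (simp add: gm power2_eq_square)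
      then have "m \<le> g (x # x # R)" using m by simp
      then have "g (x # x # R) = m" using le_m[OF inL[OF xX xX]] by simp
      then have "?P (x # x # R, x)" using inL[OF xX xX] by simp
      from z(2)[OF this] have "count (mset (x # x # R)) x \<le> count (mset w) x" by (simp add: wx)
      then show False using R y(2) by simp
    qed
  qed
  then have "g us \<le> 1" using le_m[OF usL] by simp
  then show ?thesis using pp[OF us(1)] by (simp add: g_def divide_le_eq)
qed

text \<open>The previous bound divides by the normalizing constants, but a diagonal value of
  \<open>Q\<close> may be 0. Hence e is added to every root, and then e tends to 0.\<close>

lemma cauchy_schwarz_mixed_root:
  fixes Q :: "'a list \<Rightarrow> real"
  assumes sym: "\<And>us us'. set us \<subseteq> X \<Longrightarrow> length us = p \<Longrightarrow> mset us = mset us' \<Longrightarrow> Q us = Q us'"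
    and CS: "\<And>a b R. a \<in> X \<Longrightarrow> b \<in> X \<Longrightarrow> set R \<subseteq> X \<Longrightarrow> length R + 2 = p \<Longrightarrow>
      (Q (a # b # R))\<^sup>2 \<le> Q (a # a # R) * Q (b # b # R)"
    and pos: "\<And>x. x \<in> X \<Longrightarrow> 0 \<le> Q (replicate p x)"
    and us: "set us \<subseteq> X" "length us = p" "p \<noteq> 0"
  shows "\<bar>Q us\<bar> \<le> prod_list (map (\<lambda>u. root p (Q (replicate p u))) us)"
proof -
  let ?a = "\<lambda>u. root p (Q (replicate p u))"
  have a0: "0 \<le> ?a x" if "x \<in> set us" for x
    using pos us that by auto
  have "\<bar>Q us\<bar> \<le> prod_list (map (\<lambda>u. ?a u + e) us)" if e: "0 < e" for e
  proof (rule cauchy_schwarz_mixed_bound[where X="set us" and p=p])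
    show "0 < ?a x + e" if "x \<in> set us" for x
      using a0[OF that] e by simp
    show "\<bar>Q (replicate p x)\<bar> \<le> (?a x + e) ^ p" if "x \<in> set us" for x
    proof -
      have Q0: "0 \<le> Q (replicate p x)" using pos us that by auto
      then have "\<bar>Q (replicate p x)\<bar> = ?a x ^ p"
        using us(3) by (simp add: real_root_pow_pos2)
      also have "\<dots> \<le> (?a x + e) ^ p"
        using a0[OF that] e by (intro power_mono) auto
      finally show ?thesis .
    qed
  qed (use us in \<open>auto intro!: sym CS dest: subsetD\<close>)
  then have ev: "\<forall>\<^sub>F e in at_right 0. \<bar>Q us\<bar> \<le> prod_list (map (\<lambda>u. ?a u + e) us)"
    by (intro eventually_at_rightI[of 0 1]) auto
  have "((\<lambda>e. prod_list (map (\<lambda>u. ?a u + e) us)) \<longlongrightarrow> prod_list (map (\<lambda>u. ?a u + 0) us)) (at_right 0)"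
  proof (induction us)
    case (Cons u us)
    show ?case
      by (simp only: list.map prod_list.Cons) (intro tendsto_mult Cons.IH tendsto_add tendsto_const tendsto_ident_at)
  qed simp
  from tendsto_lowerbound[OF this ev] show ?thesis by simp
qed

subsection \<open>The energy as a symmetric multilinear form\<close>

text \<open>The k + 1 arguments of the energy as one list: the head is the undifferentiated
  function, and the second entry is the one paired with it by integration by parts. The encoding is
  meaningful for k >= 1.\<close>

definition elist :: "nat \<Rightarrow> (complex ^ 'n::finite) set \<Rightarrow> (complex ^ 'n \<Rightarrow> real) list \<Rightarrow> real" where
  "elist k S us = energy S (tl (tl us)) (replicate (CARD('n) - k) (mat 1)) (hd us) (hd (tl us))"

lemma hess_form_polar_S:
  assumes "length ws = k" "ws \<noteq> []"
  shows "hess_form (cx (hd ws)) (map cx (tl ws)) (replicate (CARD('n::finite) - k) (mat 1)) x =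
    polar_S (map (\<lambda>w. lhess (cx w) (x :: complex ^ 'n)) ws)"
  using assms by (cases ws) (simp_all add: hess_form_def polar_S_def o_def)

lemma integrable_energy:
  fixes u v :: "complex ^ 'n::finite \<Rightarrow> real"
  assumes S: "open S" "bounded S" and u: "C2bd S u" and v: "C2bd S v" and ws: "\<And>w. w \<in> set ws \<Longrightarrow> C2bd S w"
    and len: "Suc (length ws + length cs) = CARD('n)"
  shows "integrable lborel (\<lambda>x. indicator S x *\<^sub>R (of_real (u x) * hess_form (cx v) (map cx ws) cs x))"
proof (rule integrable_bounded_open[OF S])
  have c: "C1on S (cx u)" "C2on S (cx v)" using u v C2on_imp_C1on by (auto simp: C2bd_def)
  show "continuous_on S (\<lambda>x. of_real (u x) * hess_form (cx v) (map cx ws) cs x)"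
    by (intro continuous_on_mult C1onD(1)[OF c(1)] continuous_on_hess_form[OF c(2)])
      (use ws len in \<open>auto simp: C2bd_def\<close>)
  show "bounded ((\<lambda>x. of_real (u x) * hess_form (cx v) (map cx ws) cs x) ` S)"
    by (rule bounded_mult_image[OF _ bounded_hess_form[OF v ws len]]) (use u in \<open>simp add: C2bd_def\<close>)
qed

lemma energy_eq_integral:
  fixes u v :: "complex ^ 'n::finite \<Rightarrow> real"
  assumes "open S" "bounded S" "C2bd S u" "C2bd S v" "\<And>w. w \<in> set ws \<Longrightarrow> C2bd S w"
    and len: "Suc (length ws + length cs) = CARD('n)"
  shows "energy S ws cs u v = (LINT x:S|lborel. - u x * Re (hess_form (cx v) (map cx ws) cs x))"
proof -
  let ?f = "\<lambda>x. indicator S x *\<^sub>R (of_real (u x) * hess_form (cx v) (map cx ws) cs x)"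
  have i: "integrable lborel ?f" by (rule integrable_energy[OF assms])
  have "energy S ws cs u v = - (LINT x|lborel. Re (?f x))"
    unfolding energy_def by (simp only: integral_Re[OF i])
  also have "\<dots> = (LINT x|lborel. - Re (?f x))" by simp
  also have "(\<lambda>x. - Re (?f x)) = (\<lambda>x. indicator S x *\<^sub>R (- u x * Re (hess_form (cx v) (map cx ws) cs x)))"
    by (auto simp: fun_eq_iff)
  finally show ?thesis unfolding set_lebesgue_integral_def .
qed

lemma energy_linear:
  fixes u v :: "complex ^ 'n::finite \<Rightarrow> real"
  assumes S: "open S" "bounded S" and u: "C2bd S u" and u': "C2bd S u'" and v: "C2bd S v"
    and ws: "\<And>w. w \<in> set ws \<Longrightarrow> C2bd S w" and len: "Suc (length ws + length cs) = CARD('n)"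
  shows "energy S ws cs (\<lambda>x. a * u x + b * u' x) v = a * energy S ws cs u v + b * energy S ws cs u' v"
proof -
  let ?f = "\<lambda>u x. indicator S x *\<^sub>R (complex_of_real (u x) * hess_form (cx v) (map cx ws) cs x)"
  have i: "integrable lborel (?f y)" if "C2bd S y" for y
    by (rule integrable_energy[OF S that v _ len]) (rule ws)
  have "?f (\<lambda>x. a * u x + b * u' x) = (\<lambda>x. of_real a * ?f u x + of_real b * ?f u' x)"
    by (simp add: fun_eq_iff algebra_simps)
  then have "(LINT x|lborel. ?f (\<lambda>x. a * u x + b * u' x) x) = (LINT x|lborel. of_real a * ?f u x + of_real b * ?f u' x)"
    by (simp only:)
  also have "\<dots> = of_real a * (LINT x|lborel. ?f u x) + of_real b * (LINT x|lborel. ?f u' x)"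
    by (subst Bochner_Integration.integral_add) (simp_all only: integral_mult_right_zero integrable_mult_right i u u')
  finally show ?thesis
    unfolding energy_def by simp
qed

definition Pcone :: "(complex ^ 'n::finite) set \<Rightarrow> nat \<Rightarrow> (complex ^ 'n \<Rightarrow> real) set" where
  "Pcone S k = {u. C2bd S u \<and> (\<forall>x\<in>S. eigenvalue_vector (lhess (cx u) x) \<in> Gamma_cone k)}"

context
  fixes S :: "(complex ^ 'n::finite) set" and k :: nat
  assumes S: "open S" "bounded S" and k: "1 \<le> k" "k \<le> CARD('n)"
begin

lemma elist_integral:
  assumes us: "\<And>u. u \<in> set us \<Longrightarrow> C2bd S u" "length us = Suc k"
  shows "elist k S us = (LINT x:S|lborel. - hd us x * Re (polar_S (map (\<lambda>w. lhess (cx w) x) (tl us))))"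
proof -
  obtain a t where t: "us = a # t" "length t = k"
    using us(2) by (cases us) auto
  then obtain b R where R: "us = a # b # R" "Suc (length R) = k"
    using k by (cases t) auto
  have "energy S R (replicate (CARD('n) - k) (mat 1)) a b =
      (LINT x:S|lborel. - a x * Re (hess_form (cx b) (map cx R) (replicate (CARD('n) - k) (mat 1)) x))"
    by (rule energy_eq_integral[OF S]) (use us(1) R k in auto)
  moreover have "hess_form (cx b) (map cx R) (replicate (CARD('n) - k) (mat 1)) x = polar_S (map (\<lambda>w. lhess (cx w) x) (b # R))" for x
    using hess_form_polar_S[of "b # R" k x] R by simp
  ultimately show ?thesis
    by (simp only: elist_def R(1) list.sel)
qed

lemma elist_tail:
  assumes "mset t = mset t'" "length t = k"
  shows "elist k S (a # t) = elist k S (a # t')"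
proof -
  have len': "length t' = k" using assms by (metis size_mset)
  have ne: "t \<noteq> []" "t' \<noteq> []" using assms len' k by auto
  have "polar_S (map (\<lambda>w. lhess (cx w) x) t) = polar_S (map (\<lambda>w. lhess (cx w) x) t')" for x :: "complex ^ 'n"
    unfolding polar_S_def length_map assms(2) len'
  proof (rule cform_sym[OF cform_polar_det])
    show "mset (map (\<lambda>w. lhess (cx w) x) t @ replicate (CARD('n) - k) (mat 1)) =
        mset (map (\<lambda>w. lhess (cx w) x) t' @ replicate (CARD('n) - k) (mat 1))"
      by (simp add: assms(1))
    show "length (map (\<lambda>w. lhess (cx w) x) t @ replicate (CARD('n) - k) (mat 1)) = CARD('n)"
      using assms(2) k by simp
  qed
  then show ?thesis
    unfolding elist_def energy_def
    by (simp add: hess_form_polar_S[OF assms(2) ne(1)] hess_form_polar_S[OF len' ne(2)])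
qed

lemma elist_swap:
  assumes "C2zero S a" "C2zero S b" "\<And>w. w \<in> set R \<Longrightarrow> C2bd S w" "Suc (length R) = k"
  shows "elist k S (a # b # R) = elist k S (b # a # R)"
  unfolding elist_def
  by (simp, rule energy_sym[OF S assms(1,2,3)]) (use assms(4) k in auto)

text \<open>Permutations of the tail leave the integrand unchanged pointwise, exchanging the first
  two entries is the symmetry of the energy, and together they generate all permutations. Entries of
  \<open>vs\<close> carry no boundary condition and keep their place at the end.\<close>

lemma elist_sym:
  assumes us: "\<And>u. u \<in> set us \<Longrightarrow> C2zero S u" and vs: "\<And>v. v \<in> set vs \<Longrightarrow> C2bd S v"
    and len: "length us + length vs = Suc k" and eq: "mset us = mset us'"
  shows "elist k S (us @ vs) = elist k S (us' @ vs)"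
proof (cases us)
  case Nil
  then show ?thesis using eq by simp
next
  case (Cons a t)
  then obtain a' t' where us': "us' = a' # t'" using eq by (cases us') auto
  show ?thesis
  proof (cases "a = a'")
    case True
    have "elist k S (a # (t @ vs)) = elist k S (a # (t' @ vs))"
      by (rule elist_tail) (use eq Cons us' True len in auto)
    then show ?thesis using Cons us' True by simp
  next
    case False
    have "a' \<in># mset us" using eq us' by simp
    then have a't: "a' \<in> set t" using Cons False by simp
    obtain t2 where t2: "mset t2 = mset t - {#a'#}" using ex_mset by blast
    have mt: "mset t = mset (a' # t2)" using t2 a't by simp
    have mt': "mset t' = mset (a # t2)"
    proof -
      have "add_mset a (mset t) = add_mset a' (mset t')" using eq Cons us' by simp
      then have "add_mset a' (mset (a # t2)) = add_mset a' (mset t')" using mt by (simp add: add_mset_commute)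
      then show ?thesis by simp
    qed
    have st: "set t2 \<subseteq> set us"
      using mset_eq_setD[OF mt] Cons by auto
    have lent: "length t = Suc (length t2)" using mt by (metis length_Cons size_mset)
    have lent': "length t' = Suc (length t2)" using mt' by (metis length_Cons size_mset)
    have "elist k S (a # (t @ vs)) = elist k S (a # (a' # t2 @ vs))"
      by (rule elist_tail) (use mt len Cons in auto)
    also have "\<dots> = elist k S (a' # a # (t2 @ vs))"
    proof (rule elist_swap)
      show "C2zero S a" "C2zero S a'" using us Cons a't by auto
      show "Suc (length (t2 @ vs)) = k" using len Cons lent by simp
      show "C2bd S w" if "w \<in> set (t2 @ vs)" for w
        using that us vs st by (auto simp: C2zero_def)
    qed
    also have "\<dots> = elist k S (a' # (t' @ vs))"
      by (rule elist_tail) (use mt' len Cons lent in auto)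
    finally show ?thesis using Cons us' by simp
  qed
qed

lemma elist_linear:
  assumes "C2bd S u" "C2bd S u'" "\<And>w. w \<in> set R \<Longrightarrow> C2bd S w" "length R = k"
  shows "elist k S ((\<lambda>x. a * u x + b * u' x) # R) = a * elist k S (u # R) + b * elist k S (u' # R)"
proof -
  have "R \<noteq> []" using assms(4) k by auto
  then have R: "hd R \<in> set R" "set (tl R) \<subseteq> set R" by (auto simp: list.set_sel)
  show ?thesis
    unfolding elist_def list.sel
    by (rule energy_linear[OF S assms(1,2)]) (use R assms k in auto)
qed

lemma elist_nonneg:
  assumes "C2zero S a" "set R \<subseteq> Pcone S k" "Suc (length R) = k"
  shows "0 \<le> elist k S (a # a # R)"
  unfolding elist_def list.sel
  by (rule energy_nonneg[OF S assms(1) _ assms(3) k(2)]) (use assms(2) in \<open>auto simp: Pcone_def\<close>)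

text \<open>Positivity in the first two places holds for every function vanishing on the boundary,
  inside the cone or not; so all real combinations s a + t b are admissible and the discriminant can
  be used.\<close>

lemma elist_CS:
  assumes a: "C2zero S a" and b: "C2zero S b" and R: "set R \<subseteq> Pcone S k" "Suc (length R) = k"
  shows "(elist k S (a # b # R))\<^sup>2 \<le> elist k S (a # a # R) * elist k S (b # b # R)"
proof (rule quadratic_nonneg_imp_discriminant)
  fix s t :: real
  let ?w = "\<lambda>x. s * a x + t * b x"
  have w: "C2zero S ?w" by (rule C2zero_lincomb[OF S(1) a b])
  have bd: "C2bd S a" "C2bd S b" "C2bd S ?w" using a b w by (simp_all add: C2zero_def)
  have Rb: "w \<in> set R \<Longrightarrow> C2bd S w" for w using R(1) by (auto simp: Pcone_def)
  have lin: "elist k S (?w # y # R) = s * elist k S (a # y # R) + t * elist k S (b # y # R)" if "C2bd S y" for y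
    by (rule elist_linear[OF bd(1,2)]) (use that Rb R(2) in auto)
  have sw: "elist k S (y # z # R) = elist k S (z # y # R)" if "C2zero S y" "C2zero S z" for y z
    by (rule elist_swap[OF that Rb R(2)])
  have "elist k S (?w # ?w # R) = s * elist k S (?w # a # R) + t * elist k S (?w # b # R)"
    unfolding lin[OF bd(3)] sw[OF w a] sw[OF w b] ..
  also have "\<dots> = s * (s * elist k S (a # a # R) + t * elist k S (a # b # R)) + t * (s * elist k S (a # b # R) + t * elist k S (b # b # R))"
    unfolding lin[OF bd(1)] lin[OF bd(2)] sw[OF b a] ..
  finally have "elist k S (?w # ?w # R) = s * s * elist k S (a # a # R) + 2 * s * t * elist k S (a # b # R) + t * t * elist k S (b # b # R)"
    by (simp add: algebra_simps)
  then show "0 \<le> s * s * elist k S (a # a # R) + 2 * s * t * elist k S (a # b # R) + t * t * elist k S (b # b # R)"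
    using elist_nonneg[OF w R] by simp
qed

text \<open>The functions \<open>vs\<close> are frozen and Cauchy-Schwarz is iterated in the other p
  places. The bound 2 <= p says that the first two places are among them, which is m < k in terms of
  part (b).\<close>

lemma elist_holder:
  assumes us: "\<And>u. u \<in> set us \<Longrightarrow> C2zero S u \<and> u \<in> Pcone S k" and vs: "set vs \<subseteq> Pcone S k"
    and len: "length us = p" "p + length vs = Suc k" "2 \<le> p"
  shows "\<bar>elist k S (us @ vs)\<bar> \<le> prod_list (map (\<lambda>u. root p (elist k S (replicate p u @ vs))) us)"
    "u \<in> set us \<Longrightarrow> 0 \<le> elist k S (replicate p u @ vs)"
proof -
  have vb: "v \<in> set vs \<Longrightarrow> C2bd S v" for v using vs by (auto simp: Pcone_def)
  have zero: "C2zero S u" and cone: "u \<in> Pcone S k" if "u \<in> set us" for u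
    using us[OF that] by blast+
  have pos: "0 \<le> elist k S (replicate p u @ vs)" if u: "u \<in> set us" for u
  proof -
    define q where "q = p - 2"
    have q: "p = Suc (Suc q)" using len(3) unfolding q_def by arith
    have "0 \<le> elist k S (u # u # (replicate q u @ vs))"
    proof (rule elist_nonneg[OF zero[OF u]])
      show "set (replicate q u @ vs) \<subseteq> Pcone S k"
        using cone[OF u] vs by (simp add: set_replicate_conv_if)
      show "Suc (length (replicate q u @ vs)) = k" using len q by simp
    qed
    then show ?thesis using q by (simp only: replicate_Suc append_Cons)
  qed
  show "0 \<le> elist k S (replicate p u @ vs)" if "u \<in> set us" by (rule pos[OF that])
  show "\<bar>elist k S (us @ vs)\<bar> \<le> prod_list (map (\<lambda>u. root p (elist k S (replicate p u @ vs))) us)"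
  proof (rule cauchy_schwarz_mixed_root[where X="set us" and Q="\<lambda>us. elist k S (us @ vs)" and p=p and us=us])
    fix ws ws' assume *: "set ws \<subseteq> set us" "length ws = p" "mset ws = mset ws'"
    show "elist k S (ws @ vs) = elist k S (ws' @ vs)"
    proof (rule elist_sym[OF _ vb _ *(3)])
      show "C2zero S u" if "u \<in> set ws" for u by (rule zero) (use that *(1) in blast)
      show "length ws + length vs = Suc k" using *(2) len(2) by simp
    qed
  next
    fix a b R assume *: "a \<in> set us" "b \<in> set us" "set R \<subseteq> set us" "length R + 2 = p"
    have "(elist k S (a # b # (R @ vs)))\<^sup>2 \<le> elist k S (a # a # (R @ vs)) * elist k S (b # b # (R @ vs))"
    proof (rule elist_CS[OF zero[OF *(1)] zero[OF *(2)]])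
      show "set (R @ vs) \<subseteq> Pcone S k"
        using subsetD[OF *(3), THEN cone] vs by (simp only: set_append Un_subset_iff subset_iff simp_thms) simp
      show "Suc (length (R @ vs)) = k" using *(4) len(2) by simp
    qed
    then show "(elist k S ((a # b # R) @ vs))\<^sup>2 \<le> elist k S ((a # a # R) @ vs) * elist k S ((b # b # R) @ vs)"
      by (simp only: append_Cons)
  next
    show "p \<noteq> 0" using len(3) by simp
  next
    show "0 \<le> elist k S (replicate p x @ vs)" if "x \<in> set us" for x by (rule pos[OF that])
  next
    show "set us \<subseteq> set us" by (rule order_refl)
  next
    show "length us = p" by (rule len(1))
  qed
qed

text \<open>After the expansion only tuples of u and v are left. Each is bounded by the mixed
  inequality, and the bounds add up to the p-th power of the right-hand side; u + v itself enters
  through multilinearity alone.\<close>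

lemma elist_minkowski:
  assumes u: "C2zero S u" "u \<in> Pcone S k" and v: "C2zero S v" "v \<in> Pcone S k" and vs: "set vs \<subseteq> Pcone S k"
    and len: "p + length vs = Suc k" "2 \<le> p"
  shows "root p (elist k S (replicate p (\<lambda>x. u x + v x) @ vs)) \<le>
    root p (elist k S (replicate p u @ vs)) + root p (elist k S (replicate p v @ vs))"
proof -
  let ?w = "\<lambda>x. u x + v x"
  let ?Q = "\<lambda>us. elist k S (us @ vs)"
  let ?\<alpha> = "root p (?Q (replicate p u))" and ?\<beta> = "root p (?Q (replicate p v))"
  have vb: "v \<in> set vs \<Longrightarrow> C2bd S v" for v using vs by (auto simp: Pcone_def)
  have w: "C2zero S ?w" using C2zero_lincomb[OF S(1) u(1) v(1), of 1 1] by simp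
  have X: "C2zero S y" if "y \<in> {?w, u, v}" for y
    using that u(1) v(1) w by blast
  have bd: "C2bd S u" "C2bd S v" using u v by (simp_all add: C2zero_def)
  have p: "0 < p" using len by simp
  have "?Q ([] @ replicate p ?w) =
    (\<Sum>i\<le>p. of_nat (p choose i) * (1 ^ i * 1 ^ (p - i) * ?Q ([] @ replicate i u @ replicate (p - i) v)))"
  proof (rule sym_form_binomial[where V="{?w, u, v}" and p=p and T="?Q"
        and a=1 and b=1 and u=u and v=v and w="?w" and xs="[]" and m=p])
    fix xs ys assume *: "mset xs = mset ys" "set xs \<subseteq> {?w, u, v}" "length xs = p"
    show "?Q xs = ?Q ys"
    proof (rule elist_sym[OF _ vb _ *(1)])
      show "C2zero S y" if "y \<in> set xs" for y
        using X *(2) that by blast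
      show "length xs + length vs = Suc k" using *(3) len by simp
    qed
  next
    fix xs assume xs: "set xs \<subseteq> {?w, u, v}" "Suc (length xs) = p"
    have "elist k S ((\<lambda>x. 1 * u x + 1 * v x) # (xs @ vs)) = 1 * elist k S (u # (xs @ vs)) + 1 * elist k S (v # (xs @ vs))"
    proof (rule elist_linear[where a=1 and b=1 and R="xs @ vs", OF bd])
      show "C2bd S y" if "y \<in> set (xs @ vs)" for y
      proof (cases "y \<in> set vs")
        case False
        then have "C2zero S y" using X xs(1) that by auto
        then show ?thesis by (simp add: C2zero_def)
      qed (rule vb)
      show "length (xs @ vs) = k" using xs(2) len(1) by simp
    qed
    then show "?Q (?w # xs) = 1 * ?Q (u # xs) + 1 * ?Q (v # xs)" by simp
  qed auto
  then have "?Q (replicate p ?w) = (\<Sum>i\<le>p. of_nat (p choose i) * ?Q (replicate i u @ replicate (p - i) v))"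
    by simp
  also have "\<dots> \<le> (\<Sum>i\<le>p. of_nat (p choose i) * (?\<alpha> ^ i * ?\<beta> ^ (p - i)))"
  proof (intro sum_mono mult_left_mono)
    fix i assume i: "i \<in> {..p}"
    let ?us = "replicate i u @ replicate (p - i) v"
    have "\<bar>?Q ?us\<bar> \<le> prod_list (map (\<lambda>u. root p (?Q (replicate p u))) ?us)"
    proof (rule elist_holder(1)[OF _ vs _ len])
      show "C2zero S y \<and> y \<in> Pcone S k" if "y \<in> set ?us" for y
        using that u v by (simp add: set_replicate_conv_if split: if_splits) blast+
      show "length ?us = p" using i by simp
    qed
    then show "?Q ?us \<le> ?\<alpha> ^ i * ?\<beta> ^ (p - i)"
      by simp
  qed simp
  also have "\<dots> = (?\<alpha> + ?\<beta>) ^ p"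
    by (simp add: binomial_ring mult.assoc)
  finally have le: "?Q (replicate p ?w) \<le> (?\<alpha> + ?\<beta>) ^ p" .
  have "0 \<le> ?Q (replicate p y)" if y: "C2zero S y" "y \<in> Pcone S k" for y
  proof (rule elist_holder(2)[of "replicate p y", OF _ vs _ len])
    show "C2zero S z \<and> z \<in> Pcone S k" if "z \<in> set (replicate p y)" for z
      using that y by simp
    show "y \<in> set (replicate p y)" using p by simp
  qed simp
  from this[OF u] this[OF v] have "0 \<le> ?Q (replicate p u)" "0 \<le> ?Q (replicate p v)" .
  then have "0 \<le> ?\<alpha> + ?\<beta>"
    by (intro add_nonneg_nonneg real_root_ge_zero)
  then have cancel: "root p ((?\<alpha> + ?\<beta>) ^ p) = ?\<alpha> + ?\<beta>"
    by (rule real_root_power_cancel[OF p])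
  show ?thesis
    by (rule order_trans[OF real_root_le_mono[OF p le] eq_refl[OF cancel]])
qed

end

subsection \<open>The theorem\<close>

lemma Hess_polar_eq:
  fixes us :: "(complex ^ 'n::finite \<Rightarrow> real) list"
  assumes D: "open D" "x \<in> D" and k: "k \<le> CARD('n)" "length us = k"
    and us: "\<And>u. u \<in> set us \<Longrightarrow> twice_diff D u \<and> C2bd D u"
  shows "Hess_polar k us x = Re (polar_S (map (\<lambda>w. lhess (cx w) x) us))"
proof -
  have "map (\<lambda>u. complex_Hessian u x) us = map (\<lambda>w. lhess (cx w) x) us"
    using us by (auto intro!: complex_Hessian_eq_lhess[OF D])
  moreover have "S_polar k (map (\<lambda>w. lhess (cx w) x) us) = Re (polar_S (map (\<lambda>w. lhess (cx w) x) us))"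
  proof (rule S_polar_eq[OF k(1)])
    show "set (map (\<lambda>w. lhess (cx w) x) us) \<subseteq> hermitian_matrices"
      using us lhess_hermitian[OF _ D] by (auto simp: C2bd_def)
  qed (use k in simp)
  ultimately show ?thesis by (simp only: Hess_polar_def)
qed

lemma Hess_op_eq:
  fixes u :: "complex ^ 'n::finite \<Rightarrow> real"
  assumes D: "open D" "x \<in> D" and k: "k \<le> CARD('n)" and u: "twice_diff D u" "C2bd D u"
  shows "Hess_op k u x = Re (polar_S (replicate k (lhess (cx u) x)))"
  using polar_S_replicate[of "lhess (cx u) x" k] lhess_hermitian[OF _ D] u k
  by (simp add: Hess_op_def complex_Hessian_eq_lhess[OF D u(1)] C2bd_def)

lemma P_class_imp:
  fixes u :: "complex ^ 'n::finite \<Rightarrow> real"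
  assumes D: "open D" "bounded D" and u: "u \<in> P_class k D"
  shows "twice_diff D u" "C2bd D u" "u \<in> Pcone D k"
proof -
  have c: "Ck_closure 2 D u" and e: "\<And>x. x \<in> D \<Longrightarrow> eigenvalue_vector (complex_Hessian u x) \<in> Gamma_cone k"
    using u by (auto simp: P_class_def)
  show t: "twice_diff D u" and b: "C2bd D u" by (rule Ck_closure_2_imp[OF D c])+
  show "u \<in> Pcone D k"
    using b e complex_Hessian_eq_lhess[OF D(1) _ t] by (simp add: Pcone_def)
qed

lemma P0_class_imp:
  fixes u :: "complex ^ 'n::finite \<Rightarrow> real"
  assumes D: "open D" "bounded D" and u: "u \<in> P0_class k D"
  shows "u \<in> P_class k D" "C2zero D u"
  using u P_class_imp(2)[OF D] Ck_closure_2_imp(3)[OF D] by (auto simp: P0_class_def P_class_def C2zero_def)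

text \<open>The undifferentiated factor is one more entry of the list, so k copies under the Hessian
  become k + 1, and k - m become k - m + 1, the degree of the root.\<close>

lemma functionals_eq_elist:
  fixes D :: "(complex ^ 'n::finite) set"
  assumes D: "open D" "bounded D" and k: "1 \<le> k" "k \<le> CARD('n)"
  shows "(\<And>j. j \<le> k \<Longrightarrow> twice_diff D (u j) \<and> C2bd D (u j)) \<Longrightarrow> F_functional k D u = elist k D (map u [0..<Suc k])"
    "twice_diff D w \<Longrightarrow> C2bd D w \<Longrightarrow> I_functional k D w = elist k D (replicate (Suc k) w)"
    "twice_diff D w \<Longrightarrow> C2bd D w \<Longrightarrow> (\<And>v. v \<in> set vs \<Longrightarrow> twice_diff D v \<and> C2bd D v) \<Longrightarrow> length vs < k \<Longrightarrow>
       I_mixed k D vs w = elist k D (replicate (Suc (k - length vs)) w @ vs)"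
proof -
  have m: "D \<in> sets lborel" using D(1) by simp
  have gen: "(LINT x:D|lborel. - hd us x * Hess_polar k (tl us) x) = elist k D us"
    if us: "\<And>u. u \<in> set us \<Longrightarrow> twice_diff D u \<and> C2bd D u" "length us = Suc k" for us
  proof -
    have "set (tl us) \<subseteq> set us" by (cases us) auto
    then have "Hess_polar k (tl us) x = Re (polar_S (map (\<lambda>w. lhess (cx w) x) (tl us)))" if "x \<in> D" for x
      by (intro Hess_polar_eq[OF D(1) that k(2)]) (use us in auto)
    then have "(LINT x:D|lborel. - hd us x * Hess_polar k (tl us) x) =
        (LINT x:D|lborel. - hd us x * Re (polar_S (map (\<lambda>w. lhess (cx w) x) (tl us))))"
      by (intro set_lebesgue_integral_cong m) auto
    then show ?thesis
      using elist_integral[OF D k, of us] us by auto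
  qed
  show "F_functional k D u = elist k D (map u [0..<Suc k])" if "\<And>j. j \<le> k \<Longrightarrow> twice_diff D (u j) \<and> C2bd D (u j)"
  proof -
    have "[0..<Suc k] = 0 # [1..<Suc k]" by (simp add: upt_conv_Cons)
    then have e: "map u [0..<Suc k] = u 0 # map u [1..<Suc k]" by (simp only: list.map)
    have "(LINT x:D|lborel. - hd (map u [0..<Suc k]) x * Hess_polar k (tl (map u [0..<Suc k])) x) = elist k D (map u [0..<Suc k])"
      by (rule gen) (use that in auto)
    then show ?thesis
      unfolding F_functional_def by (simp only: e list.sel)
  qed
  show "I_functional k D w = elist k D (replicate (Suc k) w)" if "twice_diff D w" "C2bd D w"
  proof -
    have "I_functional k D w = (LINT x:D|lborel. - hd (replicate (Suc k) w) x * Re (polar_S (map (\<lambda>w. lhess (cx w) x) (tl (replicate (Suc k) w)))))"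
      unfolding I_functional_def
      by (intro set_lebesgue_integral_cong m) (auto simp: Hess_op_eq[OF D(1) _ k(2) that])
    also have "\<dots> = elist k D (replicate (Suc k) w)"
      by (rule elist_integral[OF D k, symmetric]) (use that in \<open>auto split: if_splits\<close>)
    finally show ?thesis .
  qed
  show "I_mixed k D vs w = elist k D (replicate (Suc (k - length vs)) w @ vs)"
    if "twice_diff D w" "C2bd D w" "\<And>v. v \<in> set vs \<Longrightarrow> twice_diff D v \<and> C2bd D v" "length vs < k"
  proof -
    have "(LINT x:D|lborel. - hd (w # replicate (k - length vs) w @ vs) x * Hess_polar k (tl (w # replicate (k - length vs) w @ vs)) x)
      = elist k D (w # replicate (k - length vs) w @ vs)"
      by (rule gen) (use that in \<open>auto split: if_splits\<close>)
    then show ?thesis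
      unfolding I_mixed_def by simp
  qed
qed

theorem theorem1:
  fixes \<Omega> :: "(complex ^ 'n) set" and k :: nat
  assumes "k \<le> CARD('n)"
    and "smooth_bounded_domain \<Omega>"
  shows "(\<forall>u :: nat \<Rightarrow> complex ^ 'n \<Rightarrow> real.
            (\<forall>j\<in>{0..k}. u j \<in> P0_class k \<Omega>) \<longrightarrow>
            F_functional k \<Omega> u \<le> (\<Prod>j\<in>{0..k}. root (k + 1) (I_functional k \<Omega> (u j)))) \<and>
         (\<forall>m vs. m < k \<and> length vs = m \<and> set vs \<subseteq> P_class k \<Omega> \<longrightarrow>
            (\<forall>u \<in> P0_class k \<Omega>. \<forall>v \<in> P0_class k \<Omega>.
               root (k - m + 1) (I_mixed k \<Omega> vs (\<lambda>x. u x + v x))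
               \<le> root (k - m + 1) (I_mixed k \<Omega> vs u) + root (k - m + 1) (I_mixed k \<Omega> vs v)))"
proof (intro conjI allI impI ballI)
  have D: "open \<Omega>" "bounded \<Omega>" using assms(2) by (simp_all add: smooth_bounded_domain_def)
  {
    fix u :: "nat \<Rightarrow> complex ^ 'n \<Rightarrow> real"
    assume "\<forall>j\<in>{0..k}. u j \<in> P0_class k \<Omega>"
    then have u: "u j \<in> P0_class k \<Omega>" if "j \<le> k" for j using that by simp
    note up = P0_class_imp[OF D u] and uc = P_class_imp[OF D P0_class_imp(1)[OF D u]]
    show "F_functional k \<Omega> u \<le> (\<Prod>j\<in>{0..k}. root (k + 1) (I_functional k \<Omega> (u j)))"
    proof (cases "k = 0")
      case True
      \<comment> \<open>With k = 0 there is no second entry for \<open>elist\<close>; both sides are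
        then the integral of - u 0, and the root is of degree 1.\<close>
      have "Hess_polar 0 [] x = Hess_op 0 (u 0) x" if "x \<in> \<Omega>" for x
        using Hess_polar_eq[OF D(1) that, of 0 "[]"] Hess_op_eq[OF D(1) that, of 0 "u 0"] uc[of 0] by simp
      then have "F_functional 0 \<Omega> u = I_functional 0 \<Omega> (u 0)"
        unfolding F_functional_def I_functional_def
        by (intro set_lebesgue_integral_cong) (use D in auto)
      then show ?thesis using True by simp
    next
      case False
      then have k: "1 \<le> k" by simp
      let ?us = "map u [0..<Suc k]"
      have "F_functional k \<Omega> u = elist k \<Omega> (?us @ [])"
        using functionals_eq_elist(1)[OF D k assms(1), of u] uc by simp
      also have "\<dots> \<le> \<bar>elist k \<Omega> (?us @ [])\<bar>" by simp
      also have "\<dots> \<le> prod_list (map (\<lambda>w. root (Suc k) (elist k \<Omega> (replicate (Suc k) w @ []))) ?us)"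
        by (rule elist_holder(1)[OF D k assms(1)]) (use up uc k in \<open>auto simp: less_Suc_eq_le\<close>)
      also have "\<dots> = prod_list (map (\<lambda>j. root (k + 1) (I_functional k \<Omega> (u j))) [0..<Suc k])"
      proof -
        have "elist k \<Omega> (replicate (Suc k) (u j)) = I_functional k \<Omega> (u j)" if "j \<in> set [0..<Suc k]" for j
          by (rule functionals_eq_elist(2)[OF D k assms(1), symmetric]) (use uc that in \<open>auto simp: less_Suc_eq_le\<close>)
        then have "map (\<lambda>j. root (Suc k) (elist k \<Omega> (replicate (Suc k) (u j)))) [0..<Suc k] =
            map (\<lambda>j. root (k + 1) (I_functional k \<Omega> (u j))) [0..<Suc k]"
          by (intro map_cong refl) simp
        then show ?thesis
          by (simp only: map_map o_def append_Nil2)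
      qed
      also have "\<dots> = (\<Prod>j\<in>set [0..<Suc k]. root (k + 1) (I_functional k \<Omega> (u j)))"
        by (rule prod.distinct_set_conv_list[symmetric]) simp
      also have "set [0..<Suc k] = {0..k}" by auto
      finally show ?thesis .
    qed
  next
    fix m vs and u v :: "complex ^ 'n \<Rightarrow> real"
    assume vs: "m < k \<and> length vs = m \<and> set vs \<subseteq> P_class k \<Omega>" and u: "u \<in> P0_class k \<Omega>" and v: "v \<in> P0_class k \<Omega>"
    have k: "1 \<le> k" and m: "length vs < k" using vs by auto
    note uc = P_class_imp[OF D P0_class_imp(1)[OF D u]] and vc = P_class_imp[OF D P0_class_imp(1)[OF D v]]
    note u0 = P0_class_imp(2)[OF D u] and v0 = P0_class_imp(2)[OF D v]
    have vsc: "x \<in> set vs \<Longrightarrow> twice_diff \<Omega> x \<and> C2bd \<Omega> x" "x \<in> set vs \<Longrightarrow> x \<in> Pcone \<Omega> k" for x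
      using vs P_class_imp[OF D] by auto
    let ?w = "\<lambda>x. u x + v x"
    have w: "twice_diff \<Omega> ?w" "C2bd \<Omega> ?w"
      using twice_diff_add[OF D(1) uc(1) vc(1)] C2bd_lincomb[OF D(1) uc(2) vc(2), of 1 1] by simp_all
    have "root (Suc (k - length vs)) (elist k \<Omega> (replicate (Suc (k - length vs)) ?w @ vs)) \<le>
        root (Suc (k - length vs)) (elist k \<Omega> (replicate (Suc (k - length vs)) u @ vs)) +
        root (Suc (k - length vs)) (elist k \<Omega> (replicate (Suc (k - length vs)) v @ vs))"
      by (rule elist_minkowski[OF D k assms(1) u0 uc(3) v0 vc(3)]) (use vsc(2) m in auto)
    then show "root (k - m + 1) (I_mixed k \<Omega> vs ?w)
         \<le> root (k - m + 1) (I_mixed k \<Omega> vs u) + root (k - m + 1) (I_mixed k \<Omega> vs v)"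
      using functionals_eq_elist(3)[OF D k assms(1) w vsc(1) m]
        functionals_eq_elist(3)[OF D k assms(1) uc(1,2) vsc(1) m]
        functionals_eq_elist(3)[OF D k assms(1) vc(1,2) vsc(1) m] vs
      by simp
  }
qed

end
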